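(* Let $\omega_\epsilon$ be a local family of integrable 1-forms on $\mathbb{R}^3$ such that $\omega_0(0)=0$ and $j^1_0\omega_0$ is not equivalent to $a(x\,dy-y\,dx)$, $a\in\mathbb{R}$. Then the family of Pfaffian equations $(\omega_\epsilon)$ is equivalent to a family of the form $$(z\,dz+U_\epsilon(x,y,z)\,dx+V_\epsilon(x,y,z)\,dy),\qquad ( * )$$ and there exists a family of formal changes of the coordinates $x,y,z$, centered at the point $x=y=z=0$ for all $\epsilon$, reducing $( * )$ to a family of Pfaffian equations generated by 1-forms $$z\,dz+d\hat f_\epsilon(x,y)+z\,d\hat g_\epsilon(x,y),$$ where the formal series $\hat f_\epsilon$ and $\hat g_\epsilon$ satisfy the relation $d\hat f_\epsilon\wedge d\hat g_\epsilon\equiv0$.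
   Context: All objects are of class $C^\infty$ and all families depend smoothly on the parameter $\epsilon$, which varies near $0\in\mathbb{R}^l$; local families are considered near the origin of $\mathbb{R}^3$ and $\epsilon=0$. A 1-form $\omega$ is integrable if $\omega\wedge d\omega=0$. For a 1-form $\omega$, the Pfaffian equation $(\omega)$ is the module over the ring of smooth functions generated by $\omega$ (so $\omega$ is defined up to multiplication by a nonvanishing function). Two local families of Pfaffian equations are equivalent if one is carried to the other by a family of local diffeomorphisms $\phi_\epsilon$ (smooth in $\epsilon$) with $\phi_0(0)=0$ (it is not required that $\phi_\epsilon(0)=0$ for $\epsilon\neq0$). Equivalence of 1-jets at $0$ (of forms vanishing at $0$) is with respect to linear changes of coordinates; the value $a=0$ is included, so in particular $j^1_0\omega_0\neq0$. A formal change of coordinates centered at $x=y=z=0$ is an invertible formal power series change of coordinates without constant terms, with coefficients depending smoothly on $\epsilon$, acting on Taylor series at $x=y=z=0$ (and Pfaffian equations are then considered as modules over formal power series). The series $\hat f_\epsilon,\hat g_\epsilon$ are formal power series in $(x,y)$ with coefficients depending smoothly on $\epsilon$. *)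

theory Defs
  imports "HOL-Analysis.Analysis" "HOL-Computational_Algebra.Formal_Power_Series"
begin

section \<open>Smooth local families on three-space\<close>

text \<open>
  The coordinates \<open>x, y, z\<close> are the components \<open>1, 2, 3\<close> of a point of \<^typ>\<open>real^3\<close>.
  A local family is a curried function of the parameter and the point; only its germ at
  \<open>(0, 0)\<close> is meaningful.
\<close>

primrec C_k_on :: "nat \<Rightarrow> 'a::real_normed_vector set \<Rightarrow> ('a \<Rightarrow> 'b::real_normed_vector) \<Rightarrow> bool"
where
  "C_k_on 0 S f \<longleftrightarrow> continuous_on S f"
| "C_k_on (Suc k) S f \<longleftrightarrow>
     (\<forall>x\<in>S. f differentiable at x) \<and> (\<forall>v. C_k_on k S (\<lambda>x. frechet_derivative f (at x) v))"

text \<open>Only used for open sets in finite-dimensional spaces.\<close>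

definition smooth_on :: "'a::real_normed_vector set \<Rightarrow> ('a \<Rightarrow> 'b::real_normed_vector) \<Rightarrow> bool"
  where "smooth_on S f \<longleftrightarrow> (\<forall>k. C_k_on k S f)"

definition smooth_family :: "(real^'l \<Rightarrow> real^3 \<Rightarrow> 'b::real_normed_vector) \<Rightarrow> bool"
  where "smooth_family f \<longleftrightarrow>
    (\<exists>N. open N \<and> (0, 0) \<in> N \<and> smooth_on N (\<lambda>(e, p). f e p))"

type_synonym one_form = "real^3 \<Rightarrow> ((real^3) \<Rightarrow>\<^sub>L real)"

definition dcoord :: "3 \<Rightarrow> ((real^3) \<Rightarrow>\<^sub>L real)"
  where "dcoord i = blinfun_inner_right (axis i 1)"

definition ext_deriv :: "one_form \<Rightarrow> real^3 \<Rightarrow> real^3 \<Rightarrow> real^3 \<Rightarrow> real"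
  where "ext_deriv \<omega> p u v =
    blinfun_apply (frechet_derivative \<omega> (at p) u) v
    - blinfun_apply (frechet_derivative \<omega> (at p) v) u"

text \<open>The wedge product of a covector and an alternating bilinear form.\<close>

definition wedge12 ::
    "((real^3) \<Rightarrow>\<^sub>L real) \<Rightarrow> (real^3 \<Rightarrow> real^3 \<Rightarrow> real) \<Rightarrow> real^3 \<Rightarrow> real^3 \<Rightarrow> real^3 \<Rightarrow> real"
  where "wedge12 \<alpha> \<beta> u v w =
    blinfun_apply \<alpha> u * \<beta> v w + blinfun_apply \<alpha> v * \<beta> w u + blinfun_apply \<alpha> w * \<beta> u v"

definition integrable_form_at :: "one_form \<Rightarrow> real^3 \<Rightarrow> bool"
  where "integrable_form_at \<omega> p \<longleftrightarrow> (\<forall>u v w. wedge12 (\<omega> p) (ext_deriv \<omega> p) u v w = 0)"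

definition integrable_family :: "(real^'l \<Rightarrow> one_form) \<Rightarrow> bool"
  where "integrable_family \<omega> \<longleftrightarrow>
    smooth_family \<omega> \<and> (\<forall>\<^sub>F (e, p) in nhds (0, 0). integrable_form_at (\<omega> e) p)"

definition pullback :: "(real^3 \<Rightarrow> real^3) \<Rightarrow> one_form \<Rightarrow> one_form"
  where "pullback \<phi> \<omega> p = \<omega> (\<phi> p) o\<^sub>L Blinfun (frechet_derivative \<phi> (at p))"

text \<open>
  The family of Pfaffian equations generated by a family of 1-forms: the module generated by it
  over the ring of germs at \<open>(0, 0)\<close> of smooth functions of the parameter and the point,
  as a set of representatives of germs.
\<close>

definition pfaffian :: "(real^'l \<Rightarrow> one_form) \<Rightarrow> (real^'l \<Rightarrow> one_form) set"
  where "pfaffian \<omega> =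
    {\<eta>. \<exists>h::real^'l \<Rightarrow> real^3 \<Rightarrow> real. smooth_family h \<and>
       (\<forall>\<^sub>F (e, p) in nhds (0, 0). \<eta> e p = h e p *\<^sub>R \<omega> e p)}"

text \<open>\<open>\<phi> e 0 = 0\<close> is required for \<open>e = 0\<close> only.\<close>

definition local_diffeo_family :: "(real^'l \<Rightarrow> real^3 \<Rightarrow> real^3) \<Rightarrow> bool"
  where "local_diffeo_family \<phi> \<longleftrightarrow> smooth_family \<phi> \<and> \<phi> 0 0 = 0 \<and>
    (\<exists>\<psi>. smooth_family \<psi> \<and>
      (\<forall>\<^sub>F (e, p) in nhds (0, 0). \<psi> e (\<phi> e p) = p \<and> \<phi> e (\<psi> e p) = p))"

definition pfaffian_equivalent :: "(real^'l \<Rightarrow> one_form) \<Rightarrow> (real^'l \<Rightarrow> one_form) \<Rightarrow> bool"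
  where "pfaffian_equivalent \<omega> \<eta> \<longleftrightarrow>
    (\<exists>\<phi>. local_diffeo_family \<phi> \<and> pfaffian (\<lambda>e. pullback (\<phi> e) (\<omega> e)) = pfaffian \<eta>)"

definition jet1 :: "one_form \<Rightarrow> one_form"
  where "jet1 \<omega> p = \<omega> 0 + frechet_derivative \<omega> (at 0) p"

definition linearly_equivalent :: "one_form \<Rightarrow> one_form \<Rightarrow> bool"
  where "linearly_equivalent \<alpha> \<beta> \<longleftrightarrow> (\<exists>L. linear L \<and> bij L \<and> pullback L \<alpha> = \<beta>)"

definition rotation_form :: "real \<Rightarrow> one_form"
  where "rotation_form a p = a *\<^sub>R (p $ 1 *\<^sub>R dcoord 2 - p $ 2 *\<^sub>R dcoord 1)"

text \<open>The 1-forms \<open>z dz + U dx + V dy\<close>.\<close>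

definition prenormal_form :: "(real^3 \<Rightarrow> real) \<Rightarrow> (real^3 \<Rightarrow> real) \<Rightarrow> one_form"
  where "prenormal_form U V p = p $ 3 *\<^sub>R dcoord 3 + U p *\<^sub>R dcoord 1 + V p *\<^sub>R dcoord 2"

section \<open>Formal power series in three variables\<close>

text \<open>
  \<open>\<real>[[x,y,z]]\<close> is represented as \<open>\<real>[[x]][[y]][[z]]\<close>, so that \<open>z\<close> is the outermost variable and
  \<^const>\<open>fps_const\<close> is the inclusion of the series in \<open>x, y\<close>.
\<close>

type_synonym fps2 = "real fps fps"
type_synonym fps3 = "real fps fps fps"

definition coeff2 :: "fps2 \<Rightarrow> nat \<Rightarrow> nat \<Rightarrow> real"
  where "coeff2 F i j = fps_nth (fps_nth F j) i"

definition coeff3 :: "fps3 \<Rightarrow> nat \<Rightarrow> nat \<Rightarrow> nat \<Rightarrow> real"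
  where "coeff3 F i j k = fps_nth (fps_nth (fps_nth F k) j) i"

definition series3 :: "(nat \<Rightarrow> nat \<Rightarrow> nat \<Rightarrow> real) \<Rightarrow> fps3"
  where "series3 c = Abs_fps (\<lambda>k. Abs_fps (\<lambda>j. Abs_fps (\<lambda>i. c i j k)))"

definition fvar :: "3 \<Rightarrow> fps3"
  where "fvar i = (if i = 1 then fps_const (fps_const fps_X)
                   else if i = 2 then fps_const fps_X
                   else fps_X)"

definition fpartial :: "3 \<Rightarrow> fps3 \<Rightarrow> fps3"
  where "fpartial n F = series3 (\<lambda>i j k.
    if n = 1 then of_nat (Suc i) * coeff3 F (Suc i) j k
    else if n = 2 then of_nat (Suc j) * coeff3 F i (Suc j) k
    else of_nat (Suc k) * coeff3 F i j (Suc k))"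

text \<open>
  Substitution of series without constant terms: a monomial of degree \<open>n\<close> contributes only to
  coefficients of degree at least \<open>n\<close>, hence the finite sum
  (compare the definition of \<^const>\<open>fps_compose\<close>).
\<close>

definition fsubst :: "fps3 \<Rightarrow> fps3^3 \<Rightarrow> fps3"
  where "fsubst F \<Phi> = series3 (\<lambda>a b c.
    \<Sum>(i, j, k) \<in> {(i, j, k). i + j + k \<le> a + b + c}.
      coeff3 F i j k * coeff3 ((\<Phi> $ 1) ^ i * (\<Phi> $ 2) ^ j * (\<Phi> $ 3) ^ k) a b c)"

definition centered :: "fps3^3 \<Rightarrow> bool"
  where "centered \<Phi> \<longleftrightarrow> (\<forall>n. coeff3 (\<Phi> $ n) 0 0 0 = 0)"

definition formal_change :: "fps3^3 \<Rightarrow> bool"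
  where "formal_change \<Phi> \<longleftrightarrow> centered \<Phi> \<and>
    (\<exists>\<Psi>. centered \<Psi> \<and> (\<forall>n. fsubst (\<Phi> $ n) \<Psi> = fvar n \<and> fsubst (\<Psi> $ n) \<Phi> = fvar n))"

text \<open>A formal 1-form is the vector of its coefficients with respect to \<open>dx, dy, dz\<close>.\<close>

type_synonym formal_form = "fps3^3"

definition fd :: "fps3 \<Rightarrow> formal_form"
  where "fd F = (\<chi> n. fpartial n F)"

definition formal_wedge :: "formal_form \<Rightarrow> formal_form \<Rightarrow> fps3^3^3"
  where "formal_wedge A B = (\<chi> m n. A $ m * B $ n - A $ n * B $ m)"

definition formal_pullback :: "fps3^3 \<Rightarrow> formal_form \<Rightarrow> formal_form"
  where "formal_pullback \<Phi> A = (\<Sum>n\<in>UNIV. fsubst (A $ n) \<Phi> *s fd (\<Phi> $ n))"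

definition smooth_coeffs2 :: "(real^'l) set \<Rightarrow> (real^'l \<Rightarrow> fps2) \<Rightarrow> bool"
  where "smooth_coeffs2 W F \<longleftrightarrow> (\<forall>i j. smooth_on W (\<lambda>e. coeff2 (F e) i j))"

definition smooth_coeffs3 :: "(real^'l) set \<Rightarrow> (real^'l \<Rightarrow> fps3) \<Rightarrow> bool"
  where "smooth_coeffs3 W F \<longleftrightarrow> (\<forall>i j k. smooth_on W (\<lambda>e. coeff3 (F e) i j k))"

text \<open>
  Module over the ring of formal power series with coefficients smooth on \<open>W\<close>; the values of a
  family outside \<open>W\<close> are irrelevant.
\<close>

definition formal_pfaffian ::
    "(real^'l) set \<Rightarrow> (real^'l \<Rightarrow> formal_form) \<Rightarrow> (real^'l \<Rightarrow> formal_form) set"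
  where "formal_pfaffian W A =
    {B. \<exists>H. smooth_coeffs3 W H \<and> (\<forall>e\<in>W. B e = H e *s A e)}"

definition partial_deriv :: "3 \<Rightarrow> (real^3 \<Rightarrow> real) \<Rightarrow> real^3 \<Rightarrow> real"
  where "partial_deriv n f p = frechet_derivative f (at p) (axis n 1)"

definition taylor :: "(real^3 \<Rightarrow> real) \<Rightarrow> fps3"
  where "taylor f = series3 (\<lambda>i j k.
    (partial_deriv 1 ^^ i) ((partial_deriv 2 ^^ j) ((partial_deriv 3 ^^ k) f)) 0
      / (fact i * fact j * fact k))"

definition taylor_form :: "one_form \<Rightarrow> formal_form"
  where "taylor_form \<omega> = (\<chi> n. taylor (\<lambda>p. blinfun_apply (\<omega> p) (axis n 1)))"

text \<open>\<open>z dz + df + z dg\<close>\<close>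

definition formal_normal_form :: "fps2 \<Rightarrow> fps2 \<Rightarrow> formal_form"
  where "formal_normal_form f g =
    fvar 3 *s fd (fvar 3) + fd (fps_const f) + fvar 3 *s fd (fps_const g)"

end

theory Submission
  imports Defs
begin

text \<open>
  \<^emph>\<open>Smooth part.\<close> If the linear part \<open>p \<mapsto> \<omega>\<^sub>0'(p)\<close> were alternating as a bilinear form, it would
  be a multiple of \<open>x dy - y dx\<close> in suitable coordinates. Hence \<open>\<omega>\<^sub>0'(v) v \<noteq> 0\<close> for some \<open>v\<close>. Along \<open>v\<close>
  as \<open>z\<close>-axis, the coefficient of \<open>dz\<close> can be taken as the new coordinate \<open>z\<close>, smoothly
  in the parameter, and \<open>\<omega>\<close> becomes a multiple of \<open>z dz + U dx + V dy\<close>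
  (\<open>prenormalization\<close>). Pullback and rescaling preserve integrability, which passes to Taylor series.

  \<^emph>\<open>Formal part.\<close> The normal form is reached by a change of \<open>z\<close> alone, \<open>w = z Y\<close> with
  \<open>Y = 1 + \<dots>\<close>. Comparing the form with \<open>w dw + df + w dg\<close> gives differential equations for \<open>Y\<close> in
  the directions of \<open>x\<close> and \<open>y\<close>. Only their contraction with the Euler field
  \<open>E = x \<partial>\<^sub>x + y \<partial>\<^sub>y\<close> is solved. It determines \<open>Y\<close> by recursion on the degree in \<open>x, y\<close>, since \<open>E\<close>
  multiplies terms of degree \<open>n\<close> by \<open>n\<close>, and along with \<open>Y\<close> two series \<open>a, b\<close> in \<open>x, y\<close>
  (\<open>radial_solution\<close>). In the new coordinate the form is a multiple of \<open>w dw + \<beta>\<close> with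
  \<open>\<beta>(E) = a + w b\<close>. Integrability, contracted with \<open>E\<close>, is a recursion that leaves no room for higher
  powers of \<open>w\<close> in \<open>\<beta>\<close> and yields \<open>\<beta> = df + w dg\<close> with \<open>E f = a\<close> and \<open>E g = b\<close>
  (\<open>affine_of_radial_equation\<close>, \<open>formal_normalization\<close>).

  \<^emph>\<open>Parameters.\<close> The recursion divides only by degrees and by the unit \<open>Y\<close>, whose constant term is
  \<open>1\<close>. Nothing has to be inverted that could vanish for some parameter, even though the form need not
  vanish at the origin for \<open>\<epsilon> \<noteq> 0\<close>. So every coefficient is a polynomial in finitely many Taylor
  coefficients of \<open>U\<close> and \<open>V\<close>, and all of them are smooth on one and the same neighborhood of
  \<open>\<epsilon> = 0\<close> (\<open>smooth_coeffs3_radial\<close>).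
\<close>

section \<open>Calculus of smooth maps\<close>

lemma C_k_on_cong:
  assumes "open S" and "\<And>x. x \<in> S \<Longrightarrow> f x = g x"
  shows "C_k_on k S f \<longleftrightarrow> C_k_on k S g"
  using assms(2)
proof (induction k arbitrary: f g)
  case 0
  then show ?case using continuous_on_cong[of S S f g] by simp
next
  case (Suc k)
  have *: "C_k_on (Suc k) S g" if fg: "\<And>x. x \<in> S \<Longrightarrow> f x = g x" and f: "C_k_on (Suc k) S f"
    for f g :: "'a \<Rightarrow> 'b"
  proof -
    have d: "(g has_derivative frechet_derivative f (at x)) (at x)" if "x \<in> S" for x
      using f that fg has_derivative_transform_within_open[OF _ assms(1) that, of f _ UNIV g]
      by (auto simp: frechet_derivative_works)
    then have eq: "frechet_derivative f (at x) = frechet_derivative g (at x)" if "x \<in> S" for x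
      using frechet_derivative_at that by blast
    have "C_k_on k S (\<lambda>x. frechet_derivative g (at x) v)" for v
      using f Suc.IH[of "\<lambda>x. frechet_derivative f (at x) v" "\<lambda>x. frechet_derivative g (at x) v"] eq
      by simp
    then show ?thesis
      using d by (auto simp: differentiable_def)
  qed
  show ?case using *[of f g] *[of g f] Suc.prems by (auto simp del: C_k_on.simps)
qed

lemma C_k_on_SucI:
  assumes "open S" and d: "\<And>x. x \<in> S \<Longrightarrow> (f has_derivative f' x) (at x)"
    and "\<And>v. C_k_on k S (\<lambda>x. f' x v)"
  shows "C_k_on (Suc k) S f"
proof -
  have "C_k_on k S (\<lambda>x. frechet_derivative f (at x) v)" for v
    using C_k_on_cong[OF assms(1), of "\<lambda>x. f' x v" "\<lambda>x. frechet_derivative f (at x) v" k]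
      assms(3) frechet_derivative_at[OF d] by auto
  then show ?thesis using d by (auto simp: differentiable_def)
qed

lemma C_k_on_Suc_derivative:
  "C_k_on (Suc k) S f \<Longrightarrow> x \<in> S \<Longrightarrow> (f has_derivative frechet_derivative f (at x)) (at x)"
  by (simp add: frechet_derivative_works)

lemma C_k_on_Suc_imp: "C_k_on (Suc k) S f \<Longrightarrow> C_k_on k S f"
proof (induction k arbitrary: f)
  case 0
  then show ?case
    by (simp add: continuous_at_imp_continuous_on differentiable_imp_continuous_within)
next
  case (Suc k)
  then show ?case by auto
qed

lemma C_k_on_subset: "C_k_on k S f \<Longrightarrow> T \<subseteq> S \<Longrightarrow> C_k_on k T f"
  by (induction k arbitrary: f) (auto intro: continuous_on_subset)

lemma C_k_on_const: "open S \<Longrightarrow> C_k_on k S (\<lambda>_. c)"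
proof (induction k arbitrary: c)
  case (Suc k)
  then show ?case by (intro C_k_on_SucI[where f'="\<lambda>_ _. 0"]) auto
qed simp

lemma C_k_on_bounded_linear: "open S \<Longrightarrow> bounded_linear L \<Longrightarrow> C_k_on k S L"
proof (induction k)
  case 0
  then show ?case by (simp add: linear_continuous_on)
next
  case (Suc k)
  show ?case
    by (rule C_k_on_SucI[OF \<open>open S\<close> bounded_linear_imp_has_derivative[OF Suc.prems(2)]])
      (rule C_k_on_const[OF \<open>open S\<close>])
qed

lemma C_k_on_add: "open S \<Longrightarrow> C_k_on k S f \<Longrightarrow> C_k_on k S g \<Longrightarrow> C_k_on k S (\<lambda>x. f x + g x)"
proof (induction k arbitrary: f g)
  case (Suc k)
  show ?case
    by (rule C_k_on_SucI[OF Suc.prems(1) has_derivative_add[OF C_k_on_Suc_derivative[OF Suc.prems(2)]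
         C_k_on_Suc_derivative[OF Suc.prems(3)]]])
      (use Suc in auto)
qed (simp add: continuous_on_add)

text \<open>
  Induction on \<open>k\<close>: by the product rule the directional derivatives are sums of two terms of the
  same shape, with one factor differentiated.
\<close>

lemma C_k_on_bilinear:
  assumes "bounded_bilinear B" "open S"
  shows "C_k_on k S f \<Longrightarrow> C_k_on k S g \<Longrightarrow> C_k_on k S (\<lambda>x. B (f x) (g x))"
proof (induction k arbitrary: f g)
  case 0
  then show ?case using bounded_bilinear.continuous_on[OF assms(1)] by simp
next
  case (Suc k)
  note fg = Suc.prems
  show ?case
    by (rule C_k_on_SucI[OF assms(2) bounded_bilinear.FDERIV[OF assms(1)
         C_k_on_Suc_derivative[OF fg(1)] C_k_on_Suc_derivative[OF fg(2)]]], assumption, assumption)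
      (rule C_k_on_add[OF assms(2) Suc.IH Suc.IH], rule C_k_on_Suc_imp[OF fg(1)],
        use fg in simp, use fg in simp, rule C_k_on_Suc_imp[OF fg(2)])
qed

lemma C_k_on_linear_compose:
  assumes "open S" "bounded_linear L"
  shows "C_k_on k S f \<Longrightarrow> C_k_on k S (\<lambda>x. L (f x))"
proof (induction k arbitrary: f)
  case 0
  then show ?case by (simp add: assms(2) bounded_linear.continuous_on)
next
  case (Suc k)
  show ?case
    by (rule C_k_on_SucI[OF assms(1) bounded_linear.has_derivative[OF assms(2)
         C_k_on_Suc_derivative[OF Suc.prems]]], assumption)
      (use Suc in auto)
qed

lemma C_k_on_sum:
  "open S \<Longrightarrow> (\<And>i. i \<in> I \<Longrightarrow> C_k_on k S (f i)) \<Longrightarrow> C_k_on k S (\<lambda>x. \<Sum>i\<in>I. f i x)"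
  by (induction I rule: infinite_finite_induct) (auto intro: C_k_on_const C_k_on_add)

lemma linear_euclidean_expand:
  fixes L :: "'a::euclidean_space \<Rightarrow> 'b::real_normed_vector"
  assumes "linear L" shows "L w = (\<Sum>b\<in>Basis. (w \<bullet> b) *\<^sub>R L b)"
proof -
  have "L w = L (\<Sum>b\<in>Basis. (w \<bullet> b) *\<^sub>R b)" by (simp add: euclidean_representation)
  then show ?thesis by (simp add: linear_sum[OF assms] linear_scale[OF assms])
qed

text \<open>
  The derivative of a composite in direction \<open>v\<close> evaluates the derivative of the outer map at a
  variable vector; expanding that vector in a basis reduces to fixed directions.
\<close>

lemma C_k_on_compose:
  fixes f :: "'b::euclidean_space \<Rightarrow> 'c::real_normed_vector"
  assumes "open S" "open T" "g ` S \<subseteq> T"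
  shows "C_k_on k T f \<Longrightarrow> C_k_on k S g \<Longrightarrow> C_k_on k S (\<lambda>x. f (g x))"
proof (induction k arbitrary: f)
  case 0
  then show ?case using assms(3) by (auto intro: continuous_on_compose2)
next
  case (Suc k)
  note f = Suc.prems(1) and g = Suc.prems(2)
  have d: "((\<lambda>x. f (g x)) has_derivative
      (\<lambda>v. \<Sum>b\<in>Basis. (frechet_derivative g (at x) v \<bullet> b) *\<^sub>R frechet_derivative f (at (g x)) b)) (at x)"
    if "x \<in> S" for x
  proof -
    have df: "(f has_derivative frechet_derivative f (at (g x))) (at (g x))"
      using f assms(3) that by (auto intro: C_k_on_Suc_derivative[OF f])
    have lin: "linear (frechet_derivative f (at (g x)))"
      using df has_derivative_linear by blast
    have "((\<lambda>x. f (g x)) has_derivative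
        (\<lambda>v. frechet_derivative f (at (g x)) (frechet_derivative g (at x) v))) (at x)"
      by (rule has_derivative_compose[OF C_k_on_Suc_derivative[OF g that] df])
    then show ?thesis by (simp only: linear_euclidean_expand[OF lin, symmetric])
  qed
  show ?case
  proof (rule C_k_on_SucI[OF assms(1) d], assumption)
    fix v
    show "C_k_on k S (\<lambda>x. \<Sum>b\<in>Basis. (frechet_derivative g (at x) v \<bullet> b) *\<^sub>R
        frechet_derivative f (at (g x)) b)"
      using f g
      by (intro C_k_on_sum[OF assms(1)] C_k_on_bilinear[OF bounded_bilinear_scaleR assms(1)]
          C_k_on_linear_compose[OF assms(1) bounded_linear_inner_left] Suc.IH[OF _ C_k_on_Suc_imp[OF g]])
        simp_all
  qed
qed

lemma C_k_on_inverse: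
  fixes f :: "'a::real_normed_vector \<Rightarrow> real"
  assumes "open S" "\<And>x. x \<in> S \<Longrightarrow> f x \<noteq> 0"
  shows "C_k_on k S f \<Longrightarrow> C_k_on k S (\<lambda>x. inverse (f x))"
proof (induction k)
  case 0
  then show ?case using assms(2) by (auto intro: continuous_on_inverse)
next
  case (Suc k)
  note f = Suc.prems and mult = C_k_on_bilinear[OF bounded_bilinear_mult assms(1)]
  have inv: "C_k_on k S (\<lambda>x. inverse (f x))"
    using Suc C_k_on_Suc_imp by blast
  show ?case
  proof (rule C_k_on_SucI[OF assms(1) Deriv.has_derivative_inverse[OF assms(2) C_k_on_Suc_derivative[OF f]]], 
      assumption, assumption)
    fix v
    have "C_k_on k S (\<lambda>x. (-1) * (inverse (f x) * frechet_derivative f (at x) v * inverse (f x)))"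
      using f by (intro mult inv C_k_on_const[OF assms(1)]) simp
    then show "C_k_on k S (\<lambda>x. - (inverse (f x) * frechet_derivative f (at x) v * inverse (f x)))"
      by simp
  qed
qed

lemma smooth_on_cong:
  "open S \<Longrightarrow> (\<And>x. x \<in> S \<Longrightarrow> f x = g x) \<Longrightarrow> smooth_on S f \<longleftrightarrow> smooth_on S g"
  unfolding smooth_on_def by (simp add: C_k_on_cong[of S f g])

lemma smooth_on_subset: "smooth_on S f \<Longrightarrow> T \<subseteq> S \<Longrightarrow> smooth_on T f"
  unfolding smooth_on_def by (auto intro: C_k_on_subset)

lemma smooth_on_const: "open S \<Longrightarrow> smooth_on S (\<lambda>_. c)"
  by (simp add: smooth_on_def C_k_on_const)

lemma smooth_on_bounded_linear: "open S \<Longrightarrow> bounded_linear L \<Longrightarrow> smooth_on S L"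
  by (simp add: smooth_on_def C_k_on_bounded_linear)

lemma smooth_on_add: "open S \<Longrightarrow> smooth_on S f \<Longrightarrow> smooth_on S g \<Longrightarrow> smooth_on S (\<lambda>x. f x + g x)"
  by (simp add: smooth_on_def C_k_on_add)

lemma smooth_on_bilinear:
  "bounded_bilinear B \<Longrightarrow> open S \<Longrightarrow> smooth_on S f \<Longrightarrow> smooth_on S g \<Longrightarrow> smooth_on S (\<lambda>x. B (f x) (g x))"
  by (simp add: smooth_on_def C_k_on_bilinear)

lemmas smooth_on_mult = smooth_on_bilinear[OF bounded_bilinear_mult]

lemma smooth_on_linear_compose:
  "open S \<Longrightarrow> bounded_linear L \<Longrightarrow> smooth_on S f \<Longrightarrow> smooth_on S (\<lambda>x. L (f x))"
  by (simp add: smooth_on_def C_k_on_linear_compose)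

lemma smooth_on_diff:
  "open S \<Longrightarrow> smooth_on S f \<Longrightarrow> smooth_on S g \<Longrightarrow> smooth_on S (\<lambda>x. f x - g x)"
  using smooth_on_add[of S f "\<lambda>x. - g x"]
    smooth_on_linear_compose[of S uminus g, OF _ bounded_linear_minus[OF bounded_linear_ident]] by simp

lemma smooth_on_sum:
  "open S \<Longrightarrow> (\<And>i. i \<in> I \<Longrightarrow> smooth_on S (f i)) \<Longrightarrow> smooth_on S (\<lambda>x. \<Sum>i\<in>I. f i x)"
  by (simp add: smooth_on_def C_k_on_sum)

lemma smooth_on_compose:
  fixes f :: "'b::euclidean_space \<Rightarrow> 'c::real_normed_vector"
  shows "open S \<Longrightarrow> open T \<Longrightarrow> g ` S \<subseteq> T \<Longrightarrow> smooth_on T f \<Longrightarrow> smooth_on S g \<Longrightarrow>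
    smooth_on S (\<lambda>x. f (g x))"
  using C_k_on_compose[of S T g _ f] by (simp add: smooth_on_def)

lemma smooth_on_inverse:
  fixes f :: "'a::real_normed_vector \<Rightarrow> real"
  shows "open S \<Longrightarrow> (\<And>x. x \<in> S \<Longrightarrow> f x \<noteq> 0) \<Longrightarrow> smooth_on S f \<Longrightarrow> smooth_on S (\<lambda>x. inverse (f x))"
  by (simp add: smooth_on_def C_k_on_inverse)

lemma smooth_on_Pair:
  assumes "open S" "smooth_on S f" "smooth_on S g"
  shows "smooth_on S (\<lambda>x. (f x, g x))"
  using smooth_on_add[OF assms(1)
    smooth_on_linear_compose[OF assms(1) bounded_linear_Pair[OF bounded_linear_ident bounded_linear_zero] assms(2)]
    smooth_on_linear_compose[OF assms(1) bounded_linear_Pair[OF bounded_linear_zero bounded_linear_ident] assms(3)]]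
  by simp

lemma smooth_on_has_derivative:
  assumes "smooth_on S f" "x \<in> S"
  shows "(f has_derivative frechet_derivative f (at x)) (at x)"
  using assms C_k_on_Suc_derivative[of 0 S f x] unfolding smooth_on_def by blast

lemma smooth_on_continuous: "smooth_on S f \<Longrightarrow> continuous_on S f"
  unfolding smooth_on_def using C_k_on.simps(1)[of S f] by blast

lemma smooth_on_directional:
  "smooth_on S f \<Longrightarrow> smooth_on S (\<lambda>x. frechet_derivative f (at x) v)"
  unfolding smooth_on_def
proof
  fix k assume "\<forall>k. C_k_on k S f"
  then have "C_k_on (Suc k) S f" ..
  then show "C_k_on k S (\<lambda>x. frechet_derivative f (at x) v)" by simp
qed

subsection \<open>Symmetry of second derivatives\<close>

text \<open>
  The mean value theorem is applied twice: along \<open>u\<close> to the increment of \<open>f\<close> in direction \<open>v\<close>, then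
  along \<open>v\<close> to the derivative in direction \<open>u\<close>.
\<close>

lemma second_difference_mean_value:
  fixes f :: "'a::real_normed_vector \<Rightarrow> real"
  assumes "0 < t" and S: "\<And>\<sigma> \<tau>. 0 \<le> \<sigma> \<Longrightarrow> \<sigma> \<le> t \<Longrightarrow> 0 \<le> \<tau> \<Longrightarrow> \<tau> \<le> t \<Longrightarrow> x + \<sigma> *\<^sub>R u + \<tau> *\<^sub>R v \<in> S"
    and f: "smooth_on S f"
  obtains \<sigma> \<tau> where "0 \<le> \<sigma>" "\<sigma> \<le> t" "0 \<le> \<tau>" "\<tau> \<le> t"
    "f (x + t *\<^sub>R u + t *\<^sub>R v) - f (x + t *\<^sub>R u) - f (x + t *\<^sub>R v) + f x =
      t * (t * frechet_derivative (\<lambda>y. frechet_derivative f (at y) u) (at (x + \<sigma> *\<^sub>R u + \<tau> *\<^sub>R v)) v)"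
proof -
  let ?D = "\<lambda>y. frechet_derivative f (at y) u"
  have along: "((\<lambda>s. h (a + s *\<^sub>R w)) has_real_derivative frechet_derivative h (at (a + s *\<^sub>R w)) w) (at s)"
    if "smooth_on S h" "a + s *\<^sub>R w \<in> S" for h :: "'a \<Rightarrow> real" and a w s
  proof -
    note h = smooth_on_has_derivative[OF that]
    have "((\<lambda>s. a + s *\<^sub>R w) has_derivative (\<lambda>r. r *\<^sub>R w)) (at s)"
      by (auto intro!: derivative_eq_intros)
    from has_derivative_compose[OF this, of h "frechet_derivative h (at (a + s *\<^sub>R w))"] h
    have "((\<lambda>s. h (a + s *\<^sub>R w)) has_derivative (\<lambda>r. frechet_derivative h (at (a + s *\<^sub>R w)) (r *\<^sub>R w))) (at s)"
      by blast
    moreover have "frechet_derivative h (at (a + s *\<^sub>R w)) (r *\<^sub>R w) =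
        frechet_derivative h (at (a + s *\<^sub>R w)) w * r" for r
      using linear_scale[OF has_derivative_linear[OF h]] by simp
    ultimately show ?thesis
      by (simp add: has_field_derivative_def)
  qed
  let ?g = "\<lambda>s. f ((x + t *\<^sub>R v) + s *\<^sub>R u) - f (x + s *\<^sub>R u)"
  let ?g' = "\<lambda>s. ?D ((x + t *\<^sub>R v) + s *\<^sub>R u) - ?D (x + s *\<^sub>R u)"
  have "(?g has_real_derivative ?g' s) (at s)" if "0 \<le> s" "s \<le> t" for s
  proof (rule DERIV_diff[OF along[OF f] along[OF f]])
    show "x + t *\<^sub>R v + s *\<^sub>R u \<in> S"
      using S[of s t] that assms(1) by (simp add: algebra_simps)
    show "x + s *\<^sub>R u \<in> S"
      using S[of s 0] that assms(1) by simp
  qed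
  then obtain \<sigma> where \<sigma>: "0 < \<sigma>" "\<sigma> < t" and 1: "?g t - ?g 0 = (t - 0) * ?g' \<sigma>"
    using MVT2[of 0 t ?g ?g', OF assms(1)] by auto
  let ?k = "\<lambda>r. ?D ((x + \<sigma> *\<^sub>R u) + r *\<^sub>R v)"
  let ?k' = "\<lambda>r. frechet_derivative ?D (at ((x + \<sigma> *\<^sub>R u) + r *\<^sub>R v)) v"
  have "(?k has_real_derivative ?k' r) (at r)" if "0 \<le> r" "r \<le> t" for r
  proof (rule along[OF smooth_on_directional[OF f]])
    show "x + \<sigma> *\<^sub>R u + r *\<^sub>R v \<in> S"
      using S[of \<sigma> r] that \<sigma> by simp
  qed
  then obtain \<tau> where \<tau>: "0 < \<tau>" "\<tau> < t" and 2: "?k t - ?k 0 = (t - 0) * ?k' \<tau>"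
    using MVT2[of 0 t ?k ?k', OF assms(1)] by auto
  show thesis
  proof (rule that[of \<sigma> \<tau>])
    have "?D ((x + t *\<^sub>R v) + \<sigma> *\<^sub>R u) - ?D (x + \<sigma> *\<^sub>R u) = ?k t - ?k 0"
      by (simp add: algebra_simps)
    then show "f (x + t *\<^sub>R u + t *\<^sub>R v) - f (x + t *\<^sub>R u) - f (x + t *\<^sub>R v) + f x =
      t * (t * frechet_derivative ?D (at (x + \<sigma> *\<^sub>R u + \<tau> *\<^sub>R v)) v)"
      using 1 2 by (simp add: algebra_simps)
  qed (use \<sigma> \<tau> in auto)
qed

text \<open>
  If the two mixed derivatives differed at \<open>x\<close>, their values on a small ball would be separated
  by a constant, while both represent the same second difference.
\<close>

lemma symmetric_second_derivative_real:
  fixes f :: "'a::real_normed_vector \<Rightarrow> real"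
  assumes "open S" "smooth_on S f" "x \<in> S"
  shows "frechet_derivative (\<lambda>y. frechet_derivative f (at y) u) (at x) v =
    frechet_derivative (\<lambda>y. frechet_derivative f (at y) v) (at x) u"
proof -
  let ?D = "\<lambda>u v x. frechet_derivative (\<lambda>y. frechet_derivative f (at y) u) (at x) v"
  have cont: "continuous_on S (?D u v)" for u v
    by (intro smooth_on_continuous smooth_on_directional assms)
  have lim: "(?D u v \<longlongrightarrow> ?D u v x) (nhds x)" for u v
  proof -
    have "isCont (?D u v) x"
      using cont[of u v] continuous_on_eq_continuous_at[OF assms(1), of "?D u v"] assms(3) by blast
    then show ?thesis
      by (simp only: isCont_def tendsto_at_iff_tendsto_nhds[of "?D u v" x])
  qed
  have "\<not> ?D u v x < ?D v u x" for u v
  proof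
    assume "?D u v x < ?D v u x"
    then obtain m where m: "?D u v x < m" "m < ?D v u x" using dense by blast
    have "\<forall>\<^sub>F y in nhds x. y \<in> S \<and> ?D u v y < m \<and> m < ?D v u y"
    proof (intro eventually_conj)
      show "\<forall>\<^sub>F y in nhds x. y \<in> S" using assms by (auto simp: eventually_nhds)
      show "\<forall>\<^sub>F y in nhds x. ?D u v y < m"
        using order_tendstoD(2)[OF lim] m by blast
      show "\<forall>\<^sub>F y in nhds x. m < ?D v u y"
        using order_tendstoD(1)[OF lim] m by blast
    qed
    then obtain r where r: "r > 0" "\<And>y. dist y x < r \<Longrightarrow> y \<in> S \<and> ?D u v y < m \<and> m < ?D v u y"
      by (auto simp: eventually_nhds_metric)
    define t where "t = r / (2 * (norm u + norm v + 1))"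
    have nz: "norm u + norm v + 1 > 0" by (simp add: add_nonneg_pos)
    have t: "t > 0" using r(1) nz by (simp add: t_def)
    have near: "dist (x + \<sigma> *\<^sub>R u + \<tau> *\<^sub>R v) x < r"
      if "0 \<le> \<sigma>" "\<sigma> \<le> t" "0 \<le> \<tau>" "\<tau> \<le> t" for \<sigma> \<tau>
    proof -
      have "dist (x + \<sigma> *\<^sub>R u + \<tau> *\<^sub>R v) x = norm (\<sigma> *\<^sub>R u + \<tau> *\<^sub>R v)"
        by (simp add: dist_norm algebra_simps)
      also have "\<dots> \<le> \<sigma> * norm u + \<tau> * norm v"
        using norm_triangle_ineq[of "\<sigma> *\<^sub>R u" "\<tau> *\<^sub>R v"] that by simp
      also have "\<dots> \<le> t * norm u + t * norm v"
        using that by (intro add_mono mult_right_mono) auto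
      also have "\<dots> < t * (2 * (norm u + norm v + 1))"
        using t by (simp add: algebra_simps add_nonneg_pos add_pos_nonneg)
      also have "\<dots> = r" using nz by (simp add: t_def)
      finally show ?thesis .
    qed
    have near': "dist (x + \<sigma> *\<^sub>R v + \<tau> *\<^sub>R u) x < r"
      if "0 \<le> \<sigma>" "\<sigma> \<le> t" "0 \<le> \<tau>" "\<tau> \<le> t" for \<sigma> \<tau>
      using near[of \<tau> \<sigma>] that by (simp add: algebra_simps)
    obtain \<sigma> \<tau> where a: "0 \<le> \<sigma>" "\<sigma> \<le> t" "0 \<le> \<tau>" "\<tau> \<le> t"
      "f (x + t *\<^sub>R u + t *\<^sub>R v) - f (x + t *\<^sub>R u) - f (x + t *\<^sub>R v) + f x =
        t * (t * ?D u v (x + \<sigma> *\<^sub>R u + \<tau> *\<^sub>R v))"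
      using second_difference_mean_value[OF t _ assms(2), of x u v] near r(2) by metis
    obtain \<sigma>' \<tau>' where b: "0 \<le> \<sigma>'" "\<sigma>' \<le> t" "0 \<le> \<tau>'" "\<tau>' \<le> t"
      "f (x + t *\<^sub>R v + t *\<^sub>R u) - f (x + t *\<^sub>R v) - f (x + t *\<^sub>R u) + f x =
        t * (t * ?D v u (x + \<sigma>' *\<^sub>R v + \<tau>' *\<^sub>R u))"
      using second_difference_mean_value[OF t _ assms(2), of x v u] near' r(2) by metis
    have "t * (t * ?D u v (x + \<sigma> *\<^sub>R u + \<tau> *\<^sub>R v)) = t * (t * ?D v u (x + \<sigma>' *\<^sub>R v + \<tau>' *\<^sub>R u))"
      using a(5) b(5) by (simp add: algebra_simps)
    then have "?D u v (x + \<sigma> *\<^sub>R u + \<tau> *\<^sub>R v) = ?D v u (x + \<sigma>' *\<^sub>R v + \<tau>' *\<^sub>R u)"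
      using t by simp
    then show False
      using r(2)[OF near[OF a(1-4)]] r(2)[OF near'[OF b(1-4)]] by linarith
  qed
  then show ?thesis by (meson linorder_neqE)
qed

lemma symmetric_second_derivative:
  fixes f :: "'a::real_normed_vector \<Rightarrow> 'b::euclidean_space"
  assumes "open S" "smooth_on S f" "x \<in> S"
  shows "frechet_derivative (\<lambda>y. frechet_derivative f (at y) u) (at x) v =
    frechet_derivative (\<lambda>y. frechet_derivative f (at y) v) (at x) u"
proof (rule euclidean_eqI)
  fix b :: 'b assume "b \<in> Basis"
  let ?f = "\<lambda>y. f y \<bullet> b"
  have sm: "smooth_on S ?f"
    by (rule smooth_on_linear_compose[OF assms(1) bounded_linear_inner_left assms(2)])
  have inner: "frechet_derivative (\<lambda>y. h y \<bullet> b) (at y) w = frechet_derivative h (at y) w \<bullet> b"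
    if "smooth_on S h" "y \<in> S" for h :: "'a \<Rightarrow> 'b" and y w
    using frechet_derivative_at[OF bounded_linear.has_derivative[OF bounded_linear_inner_left
          smooth_on_has_derivative[OF that]], symmetric] by metis
  have "frechet_derivative (\<lambda>y. frechet_derivative ?f (at y) u) (at x) v =
      frechet_derivative (\<lambda>y. frechet_derivative f (at y) u) (at x) v \<bullet> b" for u v
  proof -
    have "((\<lambda>y. frechet_derivative f (at y) u \<bullet> b) has_derivative
        (\<lambda>v. frechet_derivative (\<lambda>y. frechet_derivative f (at y) u) (at x) v \<bullet> b)) (at x)"
      by (rule bounded_linear.has_derivative[OF bounded_linear_inner_left
          smooth_on_has_derivative[OF smooth_on_directional[OF assms(2)] assms(3)]])
    then have "((\<lambda>y. frechet_derivative ?f (at y) u) has_derivative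
        (\<lambda>v. frechet_derivative (\<lambda>y. frechet_derivative f (at y) u) (at x) v \<bullet> b)) (at x)"
      by (rule has_derivative_transform_within_open[OF _ assms(1,3)]) (simp add: inner[OF assms(2)])
    then show ?thesis using frechet_derivative_at by metis
  qed
  then show "frechet_derivative (\<lambda>y. frechet_derivative f (at y) u) (at x) v \<bullet> b =
      frechet_derivative (\<lambda>y. frechet_derivative f (at y) v) (at x) u \<bullet> b"
    using symmetric_second_derivative_real[OF assms(1) sm assms(3)] by metis
qed

section \<open>Derivations and composition of power series\<close>

definition derivation :: "('a::comm_ring_1 \<Rightarrow> 'a) \<Rightarrow> bool"
  where "derivation D \<longleftrightarrow>
    (\<forall>a b. D (a + b) = D a + D b) \<and> (\<forall>a b. D (a * b) = D a * b + a * D b)"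

lemma derivation_add: "derivation D \<Longrightarrow> D (a + b) = D a + D b"
  and derivation_mult: "derivation D \<Longrightarrow> D (a * b) = D a * b + a * D b"
  by (auto simp: derivation_def)

lemma derivation_0: assumes "derivation D" shows "D 0 = 0"
  using derivation_add[OF assms, of 0 0] by simp

lemma derivation_1: assumes "derivation D" shows "D 1 = 0"
  using derivation_mult[OF assms, of 1 1] by simp

lemma derivation_sum: "derivation D \<Longrightarrow> D (sum f S) = (\<Sum>i\<in>S. D (f i))"
  by (induction S rule: infinite_finite_induct) (auto simp: derivation_0 derivation_add)

lemma derivation_power_Suc:
  assumes "derivation D" shows "D (a ^ Suc n) = of_nat (Suc n) * a ^ n * D a"
  by (induction n) (auto simp: derivation_mult[OF assms] derivation_1[OF assms] algebra_simps)

definition coeff_map :: "('a \<Rightarrow> 'b) \<Rightarrow> 'a fps \<Rightarrow> 'b fps"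
  where "coeff_map D F = Abs_fps (\<lambda>n. D (fps_nth F n))"

lemma coeff_map_nth [simp]: "fps_nth (coeff_map D F) n = D (fps_nth F n)"
  by (simp add: coeff_map_def)

lemma derivation_fps_deriv: "derivation (fps_deriv :: 'a::comm_ring_1 fps \<Rightarrow> _)"
  by (simp add: derivation_def algebra_simps)

lemma derivation_coeff_map:
  assumes "derivation D" shows "derivation (coeff_map D)"
  unfolding derivation_def
  by (auto simp: fps_eq_iff derivation_add[OF assms] fps_mult_nth derivation_sum[OF assms]
      derivation_mult[OF assms] sum.distrib)

text \<open>
  This is the chain rule for the derivatives in \<open>x\<close> and \<open>y\<close> under a substitution for \<open>z\<close>. In the
  coefficient of order \<open>n\<close> all sums may be extended to the range \<open>0..n\<close>, because \<open>\<zeta> ^ i\<close> has order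
  at least \<open>i\<close>; a power of \<open>\<zeta>\<close> then splits off by the Leibniz rule.
\<close>

lemma coeff_map_compose:
  fixes F \<zeta> :: "'a::comm_ring_1 fps"
  assumes D: "derivation D" and z0: "fps_nth \<zeta> 0 = 0"
  shows "coeff_map D (fps_compose F \<zeta>) =
    fps_compose (coeff_map D F) \<zeta> + fps_compose (fps_deriv F) \<zeta> * coeff_map D \<zeta>"
proof (rule fps_ext)
  fix n
  let ?E = "coeff_map D"
  note DE = derivation_coeff_map[OF D]
  have low: "fps_nth (\<zeta> ^ i) m = 0" if "m < i" for i m
    using startsby_zero_power_prefix[OF z0] that by blast
  have D\<zeta>0: "fps_nth (?E \<zeta>) 0 = 0"
    by (simp add: z0 derivation_0[OF D])
  \<comment> \<open>Both sides reduce to the sum of \<open>T\<close>, in which the index has been shifted by the differentiation;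
    the extra last term vanishes.\<close>
  define T where "T i = fps_nth F (Suc i) * (of_nat (Suc i) * fps_nth (\<zeta> ^ i * ?E \<zeta>) n)" for i
  have Tn: "T n = 0"
  proof -
    have "fps_nth (\<zeta> ^ n * ?E \<zeta>) n = (\<Sum>m=0..n. fps_nth (\<zeta> ^ n) m * fps_nth (?E \<zeta>) (n - m))"
      by (simp add: fps_mult_nth)
    also have "\<dots> = 0"
      by (rule sum.neutral) (metis D\<zeta>0 atLeastAtMost_iff diff_self_eq_0 le_neq_implies_less low mult_zero_left mult_zero_right)
    finally show ?thesis by (simp add: T_def)
  qed
  have "(\<Sum>i=0..n. fps_nth F i * D (fps_nth (\<zeta> ^ i) n)) = sum T {0..n}"
  proof -
    have D0: "D (fps_nth (\<zeta> ^ 0) n) = 0"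
      by (simp add: derivation_0[OF D] derivation_1[OF D])
    have step: "D (fps_nth (\<zeta> ^ Suc i) n) = of_nat (Suc i) * fps_nth (\<zeta> ^ i * ?E \<zeta>) n" for i
    proof -
      have "D (fps_nth (\<zeta> ^ Suc i) n) = fps_nth (?E (\<zeta> ^ Suc i)) n" by simp
      also have "\<dots> = fps_nth (of_nat (Suc i) * (\<zeta> ^ i * ?E \<zeta>)) n"
        by (subst derivation_power_Suc[OF DE]) (simp only: mult.assoc)
      finally show ?thesis by (simp add: fps_of_nat[symmetric] del: of_nat_Suc)
    qed
    have "(\<Sum>i=0..n. fps_nth F i * D (fps_nth (\<zeta> ^ i) n)) =
        (\<Sum>i=0..Suc n. fps_nth F i * D (fps_nth (\<zeta> ^ i) n))"
      using low[of n "Suc n"] by (simp add: derivation_0[OF D] derivation_1[OF D])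
    also have "\<dots> = (\<Sum>i=0..n. fps_nth F (Suc i) * D (fps_nth (\<zeta> ^ Suc i) n))"
      by (subst sum.atLeast0_atMost_Suc_shift) (simp add: derivation_0[OF D] derivation_1[OF D])
    also have "\<dots> = sum T {0..n}"
      by (intro sum.cong refl) (simp only: T_def step)
    finally show ?thesis .
  qed
  also have "sum T {0..n} = fps_nth (fps_compose (fps_deriv F) \<zeta> * ?E \<zeta>) n"
  proof -
    have "fps_nth (fps_compose (fps_deriv F) \<zeta> * ?E \<zeta>) n =
       (\<Sum>m=0..n. (\<Sum>i=0..m. fps_nth (fps_deriv F) i * fps_nth (\<zeta> ^ i) m) * fps_nth (?E \<zeta>) (n - m))"
      by (simp only: fps_mult_nth fps_compose_nth)
    also have "\<dots> =
       (\<Sum>m=0..n. (\<Sum>i=0..n. fps_nth (fps_deriv F) i * fps_nth (\<zeta> ^ i) m) * fps_nth (?E \<zeta>) (n - m))"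
      by (intro sum.cong refl arg_cong2[where f="(*)"] sum.mono_neutral_left) (auto simp: low)
    also have "\<dots> = (\<Sum>i=0..n. fps_nth (fps_deriv F) i *
        (\<Sum>m=0..n. fps_nth (\<zeta> ^ i) m * fps_nth (?E \<zeta>) (n - m)))"
      by (simp only: sum_distrib_right sum_distrib_left mult.assoc) (rule sum.swap)
    also have "\<dots> = sum T {0..n}"
      unfolding T_def fps_mult_nth fps_deriv_nth by (simp only: Suc_eq_plus1 ac_simps)
    finally show ?thesis by simp
  qed
  finally show "fps_nth (?E (fps_compose F \<zeta>)) n =
      fps_nth (fps_compose (?E F) \<zeta> + fps_compose (fps_deriv F) \<zeta> * ?E \<zeta>) n"
    by (simp add: fps_compose_nth derivation_sum[OF D] derivation_mult[OF D] sum.distrib)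
qed

subsection \<open>Compositional inverses over a ring\<close>

text \<open>
  The coefficient equations of \<open>g \<circ> a = X\<close>, solved for the coefficients of \<open>g\<close>. As the
  \<open>n\<close>-th coefficient of \<open>a ^ n\<close> is the \<open>n\<close>-th power of the linear coefficient of \<open>a\<close>, only an inverse
  \<open>b\<close> of the latter is needed; the coefficients lie in a ring of power series, not in a field.
\<close>

fun compositional_inverse_coeff :: "'a::comm_ring_1 fps \<Rightarrow> 'a \<Rightarrow> nat \<Rightarrow> 'a"
  where "compositional_inverse_coeff a b n =
    ((if n = 1 then 1 else 0) -
      (\<Sum>i<n. compositional_inverse_coeff a b i * fps_nth (a ^ i) n)) * b ^ n"

declare compositional_inverse_coeff.simps [simp del]

definition compositional_inverse :: "'a::comm_ring_1 fps \<Rightarrow> 'a \<Rightarrow> 'a fps"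
  where "compositional_inverse a b = Abs_fps (compositional_inverse_coeff a b)"

lemma compositional_inverse_left:
  fixes a :: "'a::idom fps"
  assumes a0: "fps_nth a 0 = 0" and a1: "fps_nth a 1 * b = 1"
  defines "g \<equiv> compositional_inverse a b"
  shows "fps_compose g a = fps_X" and "fps_nth g 0 = 0" and "fps_nth g 1 = b"
proof -
  have g: "fps_nth g n = ((if n = 1 then 1 else 0) - (\<Sum>i<n. fps_nth g i * fps_nth (a ^ i) n)) * b ^ n" for n
    unfolding g_def compositional_inverse_def fps_nth_Abs_fps
    by (subst compositional_inverse_coeff.simps) (rule refl)
  show "fps_compose g a = fps_X"
  proof (rule fps_ext)
    fix n
    have ab: "b ^ n * fps_nth (a ^ n) n = 1"
      using startsby_zero_power_nth_same[OF a0, of n] a1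
      by (metis mult.commute power_mult_distrib power_one)
    have "{0..n} = insert n {..<n}" by auto
    then have "fps_nth (fps_compose g a) n =
        fps_nth g n * fps_nth (a ^ n) n + (\<Sum>i<n. fps_nth g i * fps_nth (a ^ i) n)"
      by (simp add: fps_compose_nth)
    also have "fps_nth g n * fps_nth (a ^ n) n =
        (if n = 1 then 1 else 0) - (\<Sum>i<n. fps_nth g i * fps_nth (a ^ i) n)"
      by (subst g) (simp only: mult.assoc ab mult_1_right)
    finally show "fps_nth (fps_compose g a) n = fps_nth fps_X n"
      by (simp add: fps_X_def)
  qed
  show g0: "fps_nth g 0 = 0" by (subst g) simp
  show "fps_nth g 1 = b" by (subst g) (simp add: g0)
qed

text \<open>A left inverse again has a left inverse, hence is two-sided by associativity.\<close>

lemma compositional_inverse_right: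
  fixes a :: "'a::idom fps"
  assumes a0: "fps_nth a 0 = 0" and a1: "fps_nth a 1 * b = 1"
  shows "fps_compose a (compositional_inverse a b) = fps_X"
proof -
  define g where "g = compositional_inverse a b"
  note g = compositional_inverse_left[OF a0 a1, folded g_def]
  define k where "k = compositional_inverse g (fps_nth a 1)"
  have "fps_nth g 1 * fps_nth a 1 = 1" using a1 g(3) by (simp add: mult.commute)
  note k = compositional_inverse_left[OF g(2) this, folded k_def]
  have "k = fps_compose k (fps_compose g a)" using g(1) by simp
  also have "\<dots> = a" by (simp add: fps_compose_assoc[OF a0 g(2)] k(1) a0)
  finally show ?thesis using k(1) g_def by simp
qed

section \<open>Formal power series in three variables, filtered by the degree in \<open>x, y\<close>\<close>

lemma fps3_eqI: "(\<And>i j k. coeff3 F i j k = coeff3 G i j k) \<Longrightarrow> F = G"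
  by (simp add: coeff3_def fps_eq_iff)

lemma coeff3_series3 [simp]: "coeff3 (series3 c) i j k = c i j k"
  by (simp add: coeff3_def series3_def)

lemma coeff3_eq_coeff2: "coeff3 F i j k = coeff2 (fps_nth F k) i j"
  by (simp add: coeff3_def coeff2_def)

lemma coeff3_add [simp]: "coeff3 (F + G) i j k = coeff3 F i j k + coeff3 G i j k"
  and coeff3_diff [simp]: "coeff3 (F - G) i j k = coeff3 F i j k - coeff3 G i j k"
  and coeff3_0 [simp]: "coeff3 0 i j k = 0"
  by (simp_all add: coeff3_def)

lemma three_cases: "(n::3) = 1 \<or> n = 2 \<or> n = 3"
  using exhaust_3 by auto

lemma fpartial_1: "fpartial 1 F = coeff_map (coeff_map fps_deriv) F"
  and fpartial_2: "fpartial 2 F = coeff_map fps_deriv F"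
  and fpartial_3: "fpartial 3 F = fps_deriv F"
  by (rule fps3_eqI; simp add: fpartial_def coeff3_def series3_def del: of_nat_Suc)+

lemma derivation_fpartial: "derivation (fpartial n)"
  using three_cases[of n] derivation_fps_deriv derivation_coeff_map
  by (auto simp: fpartial_1[abs_def] fpartial_2[abs_def] fpartial_3[abs_def]
      intro!: derivation_coeff_map derivation_fps_deriv)

lemma fpartial_commute: "fpartial m (fpartial n F) = fpartial n (fpartial m F)"
  using three_cases[of m] three_cases[of n]
  by (elim disjE) (rule fps3_eqI; simp add: fpartial_def)+

lemma fvar_3: "fvar 3 = fps_X"
  by (simp add: fvar_def)

lemma fpartial_fvar: "fpartial m (fvar n) = (if m = n then 1 else 0)"
  using three_cases[of m] three_cases[of n]
  by (elim disjE) (simp_all add: fvar_def fpartial_1 fpartial_2 fpartial_3 fps_eq_iff fps_X_def)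

lemma coeff3_fvar_1_mult: "coeff3 (fvar 1 * F) i j k = (if i = 0 then 0 else coeff3 F (i - 1) j k)"
  and coeff3_fvar_2_mult: "coeff3 (fvar 2 * F) i j k = (if j = 0 then 0 else coeff3 F i (j - 1) k)"
  by (simp_all add: fvar_def coeff3_def)

definition xy_euler :: "fps3 \<Rightarrow> fps3"
  where "xy_euler F = fvar 1 * fpartial 1 F + fvar 2 * fpartial 2 F"

text \<open>
  Integration along the rays through the origin of the \<open>x, y\<close>-plane. Terms free of \<open>x\<close> and \<open>y\<close> are
  divided by \<open>0\<close> and thereby dropped, so the result vanishes for \<open>x = y = 0\<close>.
\<close>

definition xy_primitive :: "fps3 \<Rightarrow> fps3"
  where "xy_primitive F = series3 (\<lambda>i j k. coeff3 F i j k / of_nat (i + j))"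

lemma coeff3_xy_euler [simp]: "coeff3 (xy_euler F) i j k = of_nat (i + j) * coeff3 F i j k"
  by (auto simp: xy_euler_def coeff3_fvar_1_mult coeff3_fvar_2_mult fpartial_def algebra_simps
      gr0_conv_Suc of_nat_diff)

text \<open>
  The filtration by the degree in \<open>x, y\<close>, regardless of the degree in \<open>z\<close>: membership in the \<open>n\<close>-th
  power of the ideal generated by \<open>x\<close> and \<open>y\<close>.
\<close>

definition xy_vanish2 :: "nat \<Rightarrow> fps2 \<Rightarrow> bool"
  where "xy_vanish2 n A \<longleftrightarrow> (\<forall>i j. i + j < n \<longrightarrow> coeff2 A i j = 0)"

definition xy_vanish :: "nat \<Rightarrow> fps3 \<Rightarrow> bool"
  where "xy_vanish n F \<longleftrightarrow> (\<forall>i j k. i + j < n \<longrightarrow> coeff3 F i j k = 0)"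

lemma xy_vanish_iff: "xy_vanish n F \<longleftrightarrow> (\<forall>k. xy_vanish2 n (fps_nth F k))"
  by (auto simp: xy_vanish_def xy_vanish2_def coeff3_eq_coeff2)

lemma coeff2_mult:
  "coeff2 (A * B) i j = (\<Sum>b=0..j. \<Sum>a=0..i. coeff2 A a b * coeff2 B (i - a) (j - b))"
  by (simp add: coeff2_def fps_mult_nth fps_sum_nth)

lemma xy_vanish2_mult: "xy_vanish2 m A \<Longrightarrow> xy_vanish2 n B \<Longrightarrow> xy_vanish2 (m + n) (A * B)"
  unfolding xy_vanish2_def coeff2_mult
proof (intro allI impI sum.neutral ballI)
  fix i j a b
  assume A: "\<forall>i j. i + j < m \<longrightarrow> coeff2 A i j = 0" and B: "\<forall>i j. i + j < n \<longrightarrow> coeff2 B i j = 0"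
    and "i + j < m + n" "b \<in> {0..j}" "a \<in> {0..i}"
  then have "a + b < m \<or> (i - a) + (j - b) < n" by auto
  then show "coeff2 A a b * coeff2 B (i - a) (j - b) = 0" using A B by auto
qed

lemma xy_vanish2_0: "xy_vanish2 0 A" by (simp add: xy_vanish2_def)

lemma xy_vanish2_sum: "(\<And>i. i \<in> I \<Longrightarrow> xy_vanish2 n (f i)) \<Longrightarrow> xy_vanish2 n (sum f I)"
  by (induction I rule: infinite_finite_induct) (auto simp: xy_vanish2_def coeff2_def)

lemma xy_vanish_mult: "xy_vanish m F \<Longrightarrow> xy_vanish n G \<Longrightarrow> xy_vanish (m + n) (F * G)"
  by (auto simp: xy_vanish_iff fps_mult_nth intro!: xy_vanish2_sum xy_vanish2_mult)

lemma xy_vanish_0: "xy_vanish 0 F" by (simp add: xy_vanish_def)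

lemma xy_vanish_add: "xy_vanish n F \<Longrightarrow> xy_vanish n G \<Longrightarrow> xy_vanish n (F + G)"
  and xy_vanish_diff: "xy_vanish n F \<Longrightarrow> xy_vanish n G \<Longrightarrow> xy_vanish n (F - G)"
  by (auto simp: xy_vanish_def)

lemma xy_vanish_mult_left: "xy_vanish n G \<Longrightarrow> xy_vanish n (F * G)"
  and xy_vanish_mult_right: "xy_vanish n F \<Longrightarrow> xy_vanish n (F * G)"
  using xy_vanish_mult[of 0 F n G] xy_vanish_mult[of n F 0 G] by (auto simp: xy_vanish_0)

lemma xy_vanish_nth: "xy_vanish n F \<Longrightarrow> xy_vanish n (fps_const (fps_nth F k))"
  by (auto simp: xy_vanish_iff) (simp add: xy_vanish2_def coeff2_def)

lemma xy_vanish_shift: "xy_vanish n F \<Longrightarrow> xy_vanish n (fps_shift m F)"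
  by (simp add: xy_vanish_iff)

lemma xy_vanish_deriv: "xy_vanish n F \<Longrightarrow> xy_vanish n (fps_deriv F)"
  by (simp add: xy_vanish_def flip: fpartial_3) (simp add: fpartial_def)

lemma xy_vanish_primitive: "xy_vanish n F \<Longrightarrow> xy_vanish n (xy_primitive F)"
  by (simp add: xy_vanish_def xy_primitive_def)

lemma xy_vanish_1_primitive: "xy_vanish 1 (xy_primitive F)"
  by (simp add: xy_vanish_def xy_primitive_def)

lemma xy_euler_primitive: "xy_vanish 1 F \<Longrightarrow> xy_euler (xy_primitive F) = F"
proof (rule fps3_eqI)
  fix i j k :: nat
  assume "xy_vanish 1 F"
  then show "coeff3 (xy_euler (xy_primitive F)) i j k = coeff3 F i j k"
    by (cases "i + j = 0") (auto simp: xy_primitive_def xy_vanish_def simp del: of_nat_add)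
qed

lemma xy_primitive_diff: "xy_primitive (F - G) = xy_primitive F - xy_primitive G"
  by (rule fps3_eqI) (simp add: xy_primitive_def diff_divide_distrib)

subsection \<open>Fixed points of maps that contract the filtration\<close>

text \<open>
  A coefficient of degree \<open>n\<close> in \<open>x, y\<close> of the iterates no longer changes after step \<open>n + 1\<close>;
  collecting the final values gives a fixed point each of whose coefficients is a coefficient of
  one iterate. This is why fixed points inherit smooth dependence on parameters.
\<close>

definition xy_fixpoint :: "(('i \<Rightarrow> fps3) \<Rightarrow> ('i \<Rightarrow> fps3)) \<Rightarrow> 'i \<Rightarrow> fps3"
  where "xy_fixpoint T = (\<lambda>a. series3 (\<lambda>i j k. coeff3 ((T ^^ Suc (i + j)) (\<lambda>_. 0) a) i j k))"

lemma xy_fixpoint: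
  fixes T :: "('i \<Rightarrow> fps3) \<Rightarrow> ('i \<Rightarrow> fps3)"
  assumes T: "\<And>n F G. (\<And>a. xy_vanish n (F a - G a)) \<Longrightarrow> (\<And>a. xy_vanish (Suc n) (T F a - T G a))"
  shows "T (xy_fixpoint T) = xy_fixpoint T"
proof -
  define I where "I m = (T ^^ m) (\<lambda>_. 0)" for m
  have I_Suc: "I (Suc m) = T (I m)" for m by (simp add: I_def)
  have step: "xy_vanish m (I (Suc m) a - I m a)" for m a
  proof (induction m arbitrary: a)
    case (Suc m)
    show ?case unfolding I_Suc[of "Suc m"] I_Suc[of m]
      using T[of m "T (I m)" "I m"] Suc by (simp add: I_Suc)
  qed (simp add: xy_vanish_0)
  have far: "xy_vanish m (I (m + d) a - I m a)" for m d a
  proof (induction d)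
    case (Suc d)
    have "xy_vanish m (I (Suc (m + d)) a - I (m + d) a)"
      using step[of "m + d" a] by (auto simp: xy_vanish_def)
    from xy_vanish_add[OF this Suc] show ?case by simp
  qed (simp add: xy_vanish_def)
  have lim: "xy_vanish m (xy_fixpoint T a - I m a)" for m a
    unfolding xy_vanish_def
  proof (intro allI impI)
    fix i j k assume *: "i + j < m"
    then have "m = Suc (i + j) + (m - Suc (i + j))" by simp
    then have "coeff3 (I m a - I (Suc (i + j)) a) i j k = 0"
      using far[of "Suc (i + j)" "m - Suc (i + j)" a] unfolding xy_vanish_def by (metis lessI)
    then show "coeff3 (xy_fixpoint T a - I m a) i j k = 0"
      by (simp add: xy_fixpoint_def I_def)
  qed
  have "T (xy_fixpoint T) a = xy_fixpoint T a" for a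
  proof (rule fps3_eqI)
    fix i j k :: nat
    let ?n = "i + j"
    have "xy_vanish (Suc ?n) (T (xy_fixpoint T) a - I (Suc ?n) a)"
      unfolding I_Suc by (rule T[OF lim])
    moreover have "xy_vanish (Suc ?n) (xy_fixpoint T a - I (Suc ?n) a)"
      by (rule lim)
    ultimately show "coeff3 (T (xy_fixpoint T) a) i j k = coeff3 (xy_fixpoint T a) i j k"
      by (auto simp: xy_vanish_def)
  qed
  then show ?thesis by blast
qed

subsection \<open>Series with smooth coefficients\<close>

lemma smooth_coeffs3_iff: "smooth_coeffs3 W F \<longleftrightarrow> (\<forall>k. smooth_coeffs2 W (\<lambda>e. fps_nth (F e) k))"
  by (auto simp: smooth_coeffs3_def smooth_coeffs2_def coeff3_eq_coeff2)

context
  fixes W :: "(real^'l) set"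
  assumes W: "open W"
begin

lemma smooth_coeffs2_const: "smooth_coeffs2 W (\<lambda>_. c)"
  by (simp add: smooth_coeffs2_def smooth_on_const[OF W])

lemma smooth_coeffs2_add:
  "smooth_coeffs2 W F \<Longrightarrow> smooth_coeffs2 W G \<Longrightarrow> smooth_coeffs2 W (\<lambda>e. F e + G e)"
  by (simp add: smooth_coeffs2_def coeff2_def smooth_on_add[OF W])

lemma smooth_coeffs2_diff:
  "smooth_coeffs2 W F \<Longrightarrow> smooth_coeffs2 W G \<Longrightarrow> smooth_coeffs2 W (\<lambda>e. F e - G e)"
  by (simp add: smooth_coeffs2_def coeff2_def smooth_on_diff[OF W])

lemma smooth_coeffs2_mult:
  "smooth_coeffs2 W F \<Longrightarrow> smooth_coeffs2 W G \<Longrightarrow> smooth_coeffs2 W (\<lambda>e. F e * G e)"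
  by (simp add: smooth_coeffs2_def coeff2_mult smooth_on_sum[OF W] smooth_on_mult[OF W])

lemma smooth_coeffs2_sum:
  "(\<And>i. i \<in> I \<Longrightarrow> smooth_coeffs2 W (F i)) \<Longrightarrow> smooth_coeffs2 W (\<lambda>e. \<Sum>i\<in>I. F i e)"
  by (induction I rule: infinite_finite_induct) (auto intro: smooth_coeffs2_const smooth_coeffs2_add)

lemma smooth_coeffs2_power:
  "smooth_coeffs2 W F \<Longrightarrow> smooth_coeffs2 W (\<lambda>e. F e ^ n)"
  by (induction n) (auto intro: smooth_coeffs2_const smooth_coeffs2_mult)

lemma smooth_coeffs3_const: "smooth_coeffs3 W (\<lambda>_. c)"
  by (simp add: smooth_coeffs3_iff smooth_coeffs2_const)

lemma smooth_coeffs3_add: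
  "smooth_coeffs3 W F \<Longrightarrow> smooth_coeffs3 W G \<Longrightarrow> smooth_coeffs3 W (\<lambda>e. F e + G e)"
  by (simp add: smooth_coeffs3_iff smooth_coeffs2_add)

lemma smooth_coeffs3_diff:
  "smooth_coeffs3 W F \<Longrightarrow> smooth_coeffs3 W G \<Longrightarrow> smooth_coeffs3 W (\<lambda>e. F e - G e)"
  by (simp add: smooth_coeffs3_iff smooth_coeffs2_diff)

lemma smooth_coeffs3_mult:
  "smooth_coeffs3 W F \<Longrightarrow> smooth_coeffs3 W G \<Longrightarrow> smooth_coeffs3 W (\<lambda>e. F e * G e)"
  by (simp add: smooth_coeffs3_iff fps_mult_nth smooth_coeffs2_sum smooth_coeffs2_mult)

lemma smooth_coeffs3_power:
  "smooth_coeffs3 W F \<Longrightarrow> smooth_coeffs3 W (\<lambda>e. F e ^ n)"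
  by (induction n) (auto intro: smooth_coeffs3_const smooth_coeffs3_mult)

lemma smooth_coeffs3_fps_const: "smooth_coeffs2 W A \<Longrightarrow> smooth_coeffs3 W (\<lambda>e. fps_const (A e))"
  unfolding smooth_coeffs3_iff
proof
  fix k assume "smooth_coeffs2 W A"
  then show "smooth_coeffs2 W (\<lambda>e. fps_nth (fps_const (A e)) k)"
    by (cases "k = 0") (auto intro: smooth_coeffs2_const)
qed

lemma smooth_coeffs3_nth: "smooth_coeffs3 W F \<Longrightarrow> smooth_coeffs2 W (\<lambda>e. fps_nth (F e) k)"
  by (simp add: smooth_coeffs3_iff)

lemma smooth_coeffs3_shift: "smooth_coeffs3 W F \<Longrightarrow> smooth_coeffs3 W (\<lambda>e. fps_shift n (F e))"
  by (simp add: smooth_coeffs3_iff)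

lemma smooth_coeffs3_deriv: "smooth_coeffs3 W F \<Longrightarrow> smooth_coeffs3 W (\<lambda>e. fps_deriv (F e))"
  by (simp add: smooth_coeffs3_iff smooth_coeffs2_const smooth_coeffs2_mult)

lemma smooth_coeffs3_primitive:
  "smooth_coeffs3 W F \<Longrightarrow> smooth_coeffs3 W (\<lambda>e. xy_primitive (F e))"
  by (simp add: smooth_coeffs3_def xy_primitive_def divide_inverse smooth_on_mult[OF W] smooth_on_const[OF W])

lemma smooth_coeffs3_compose:
  "smooth_coeffs3 W F \<Longrightarrow> smooth_coeffs3 W G \<Longrightarrow> smooth_coeffs3 W (\<lambda>e. fps_compose (F e) (G e))"
  using smooth_coeffs3_power[of G]
  by (simp add: smooth_coeffs3_iff fps_compose_nth smooth_coeffs2_sum smooth_coeffs2_mult)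

lemma smooth_coeffs3_compositional_inverse:
  assumes F: "smooth_coeffs3 W F" and b: "smooth_coeffs2 W b"
  shows "smooth_coeffs3 W (\<lambda>e. compositional_inverse (F e) (b e))"
proof -
  have "smooth_coeffs2 W (\<lambda>e. compositional_inverse_coeff (F e) (b e) n)" for n
  proof (induction n rule: less_induct)
    case (less n)
    show ?case
      by (subst compositional_inverse_coeff.simps)
        (intro smooth_coeffs2_mult smooth_coeffs2_diff smooth_coeffs2_const smooth_coeffs2_sum
          smooth_coeffs2_power smooth_coeffs3_nth smooth_coeffs3_power F b less.IH; simp)
  qed
  then show ?thesis by (simp add: smooth_coeffs3_iff compositional_inverse_def)
qed

lemma smooth_coeffs3_xy_fixpoint:
  fixes T :: "real^'l \<Rightarrow> ('i \<Rightarrow> fps3) \<Rightarrow> ('i \<Rightarrow> fps3)"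
  assumes T: "\<And>F a. (\<And>a. smooth_coeffs3 W (\<lambda>e. F e a)) \<Longrightarrow> smooth_coeffs3 W (\<lambda>e. T e (F e) a)"
  shows "smooth_coeffs3 W (\<lambda>e. xy_fixpoint (T e) a)"
proof -
  have "smooth_coeffs3 W (\<lambda>e. (T e ^^ m) (\<lambda>_. 0) a)" for m a
  proof (induction m arbitrary: a)
    case (Suc m)
    then show ?case using T[of "\<lambda>e. (T e ^^ m) (\<lambda>_. 0)"] by simp
  qed (simp add: smooth_coeffs3_const)
  then show ?thesis
    by (simp add: smooth_coeffs3_def xy_fixpoint_def del: funpow.simps)
qed

end

section \<open>The formal normal form\<close>

subsection \<open>The radial equation\<close>

text \<open>
  The right-hand side of the equation for the unit \<open>Y\<close> such that \<open>w = z Y\<close> is the coordinate of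
  the normal form. With \<open>E\<close> the Euler field of the \<open>x, y\<close>-plane, \<open>P = x U + y V\<close> the radial component of the
  form and \<open>V = 1 / Y\<close>, the equation is
  \<open>z\<^sup>2 E Y = (Y + z Y\<^sub>z) P - a V - z b\<close>,
  where \<open>a\<close> and \<open>b\<close> are series in \<open>x, y\<close> that are forced by the coefficients of \<open>z\<^sup>0\<close> and \<open>z\<^sup>1\<close>:
  the choice \<open>a = Y\<^sub>0\<^sup>2 P\<^sub>0\<close> annihilates the first one, and \<open>b\<close> is whatever the shift by two
  discards.
\<close>

definition radial_rhs :: "fps3 \<Rightarrow> fps3 \<Rightarrow> fps3 \<Rightarrow> fps3"
  where "radial_rhs P Y V = fps_shift 2
    ((Y + fps_X * fps_deriv Y) * P - fps_const (fps_nth Y 0 * fps_nth Y 0 * fps_nth P 0) * V)"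

text \<open>
  The pair \<open>(Y, 1 / Y)\<close> is treated as one unknown with index set \<^typ>\<open>bool\<close>: then the right-hand
  side is polynomial, and the inverse is obtained by the same iteration.
\<close>

definition radial_step :: "fps3 \<Rightarrow> (bool \<Rightarrow> fps3) \<Rightarrow> (bool \<Rightarrow> fps3)"
  where "radial_step P F = (\<lambda>b. let Q = xy_primitive (radial_rhs P (F True) (F False))
    in if b then 1 + Q else 1 - Q * F False)"

lemma xy_vanish_radial_rhs: "xy_vanish 1 P \<Longrightarrow> xy_vanish 1 (radial_rhs P Y V)"
  unfolding radial_rhs_def fps_const_mult[symmetric]
  by (intro xy_vanish_shift xy_vanish_diff xy_vanish_mult_left xy_vanish_mult_right xy_vanish_nth)

text \<open>
  \<open>P\<close> vanishes for \<open>x = y = 0\<close> and occurs in every term, which gains one degree.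
\<close>

lemma radial_rhs_contracts:
  assumes P: "xy_vanish 1 P" and Y: "xy_vanish n (Y - Y')" and V: "xy_vanish n (V - V')"
  shows "xy_vanish (Suc n) (radial_rhs P Y V - radial_rhs P Y' V')"
proof -
  let ?c = "\<lambda>F. fps_const (fps_nth F 0)"
  have c: "xy_vanish n (?c Y - ?c Y')"
    using xy_vanish_nth[OF Y, of 0] by simp
  have "((Y + fps_X * fps_deriv Y) * P - a * a * p * V) - ((Y' + fps_X * fps_deriv Y') * P - b * b * p * V') =
      ((Y - Y') + fps_X * fps_deriv (Y - Y')) * P - ((a - b) * (a + b) * V + b * b * (V - V')) * p"
    for a b p by (simp add: algebra_simps)
  from this[of "?c Y" "?c P" "?c Y'"]
  have "((Y + fps_X * fps_deriv Y) * P - ?c Y * ?c Y * ?c P * V) -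
        ((Y' + fps_X * fps_deriv Y') * P - ?c Y' * ?c Y' * ?c P * V') =
      ((Y - Y') + fps_X * fps_deriv (Y - Y')) * P -
      ((?c Y - ?c Y') * (?c Y + ?c Y') * V + ?c Y' * ?c Y' * (V - V')) * ?c P" .
  moreover have "xy_vanish (n + 1) \<dots>"
    by (intro xy_vanish_diff xy_vanish_mult P xy_vanish_nth xy_vanish_add Y V c xy_vanish_deriv
        xy_vanish_mult_left[OF V] xy_vanish_mult_left[OF xy_vanish_deriv[OF Y]]
        xy_vanish_mult_right[OF xy_vanish_mult_right[OF c]])
  ultimately show ?thesis
    unfolding radial_rhs_def fps_shift_diff[symmetric] fps_const_mult[symmetric]
    by (intro xy_vanish_shift) simp
qed

lemma radial_step_contracts:
  assumes P: "xy_vanish 1 P" and FG: "\<And>b. xy_vanish n (F b - G b)"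
  shows "xy_vanish (Suc n) (radial_step P F b - radial_step P G b)"
proof -
  define Q where "Q = xy_primitive (radial_rhs P (F True) (F False))"
  define R where "R = xy_primitive (radial_rhs P (G True) (G False))"
  have QR: "xy_vanish (Suc n) (Q - R)"
    unfolding Q_def R_def xy_primitive_diff[symmetric]
    by (intro xy_vanish_primitive radial_rhs_contracts P FG)
  have R: "xy_vanish 1 R"
    unfolding R_def by (rule xy_vanish_1_primitive)
  show ?thesis
  proof (cases b)
    case True
    then show ?thesis using QR by (simp add: radial_step_def Let_def Q_def R_def)
  next
    case False
    have "xy_vanish (Suc n) ((R - Q) * F False + R * (G False - F False))"
    proof (rule xy_vanish_add)
      show "xy_vanish (Suc n) ((R - Q) * F False)"
        using xy_vanish_diff[of _ 0 "Q - R"] QR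
        by (intro xy_vanish_mult_right) (auto simp: xy_vanish_def)
      have "xy_vanish n (G False - F False)"
        using FG[of False] by (auto simp: xy_vanish_def)
      from xy_vanish_mult[OF R this] show "xy_vanish (Suc n) (R * (G False - F False))"
        by simp
    qed
    moreover have "radial_step P F b - radial_step P G b = (R - Q) * F False + R * (G False - F False)"
      using False by (simp add: radial_step_def Let_def Q_def R_def algebra_simps)
    ultimately show ?thesis by simp
  qed
qed

definition radial_unit :: "fps3 \<Rightarrow> fps3"
  where "radial_unit P = xy_fixpoint (radial_step P) True"

definition radial_unit_inverse :: "fps3 \<Rightarrow> fps3"
  where "radial_unit_inverse P = xy_fixpoint (radial_step P) False"

definition radial_const :: "fps3 \<Rightarrow> fps2"
  where "radial_const P = fps_nth (radial_unit P) 0 * fps_nth (radial_unit P) 0 * fps_nth P 0"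

definition radial_slope :: "fps3 \<Rightarrow> fps2"
  where "radial_slope P = fps_nth ((radial_unit P + fps_X * fps_deriv (radial_unit P)) * P
    - fps_const (radial_const P) * radial_unit_inverse P) 1"

lemma radial_solution:
  assumes P: "xy_vanish 1 P"
  defines "Y \<equiv> radial_unit P" and "V \<equiv> radial_unit_inverse P"
  shows "Y * V = 1"
    and "fps_X * (fps_X * xy_euler Y) = (Y + fps_X * fps_deriv Y) * P -
      fps_const (radial_const P) * V - fps_X * fps_const (radial_slope P)"
    and "xy_vanish 1 (fps_const (radial_const P))" and "xy_vanish 1 (fps_const (radial_slope P))"
proof -
  define F where "F = xy_fixpoint (radial_step P)"
  have fixed: "radial_step P F = F"
    unfolding F_def by (rule xy_fixpoint) (rule radial_step_contracts[OF P])
  have YV: "Y = F True" "V = F False"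
    by (simp_all add: Y_def V_def radial_unit_def radial_unit_inverse_def F_def)
  define Q where "Q = xy_primitive (radial_rhs P Y V)"
  have Y: "Y = 1 + Q" and V: "V = 1 - Q * V"
    using fun_cong[OF fixed, of True] fun_cong[OF fixed, of False]
    by (simp_all add: radial_step_def Let_def Q_def YV)
  show inv: "Y * V = 1"
    using V by (subst Y) (simp add: algebra_simps)
  let ?N = "(Y + fps_X * fps_deriv Y) * P - fps_const (radial_const P) * V"
  have rhs: "radial_rhs P Y V = fps_shift 2 ?N"
    by (simp add: radial_rhs_def radial_const_def Y_def)
  have "xy_euler Y = xy_euler Q"
    unfolding Y by (simp add: xy_euler_def derivation_add[OF derivation_fpartial] derivation_1[OF derivation_fpartial])
  also have "\<dots> = fps_shift 2 ?N"
    unfolding Q_def rhs[symmetric] by (rule xy_euler_primitive[OF xy_vanish_radial_rhs[OF P]])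
  finally have E: "xy_euler Y = fps_shift 2 ?N" .
  have inv0: "fps_nth Y 0 * fps_nth V 0 = 1"
    using arg_cong[OF inv, of "\<lambda>F. fps_nth F 0"] by simp
  have N0: "fps_nth ?N 0 = 0"
  proof -
    have "fps_nth Y 0 * fps_nth Y 0 * fps_nth P 0 * fps_nth V 0 =
        fps_nth Y 0 * fps_nth P 0 * (fps_nth Y 0 * fps_nth V 0)" by (simp only: ac_simps)
    then show ?thesis by (simp add: radial_const_def Y_def[symmetric] inv0)
  qed
  have N1: "fps_nth ?N 1 = radial_slope P"
    by (simp add: radial_slope_def Y_def V_def)
  show "fps_X * (fps_X * xy_euler Y) = ?N - fps_X * fps_const (radial_slope P)"
  proof (rule fps_ext)
    fix n
    consider "n = 0" | "n = 1" | m where "n = Suc (Suc m)" by (metis One_nat_def old.nat.exhaust)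
    then show "fps_nth (fps_X * (fps_X * xy_euler Y)) n = fps_nth (?N - fps_X * fps_const (radial_slope P)) n"
    proof cases
      case 1 then show ?thesis using N0 by simp
    next
      case 2 then show ?thesis using N1 by simp
    next
      case 3 then show ?thesis by (simp add: E numeral_2_eq_2 del: fps_mult_nth_1 fps_shift_nth) (simp add: numeral_2_eq_2)
    qed
  qed
  show A0: "xy_vanish 1 (fps_const (radial_const P))"
    unfolding radial_const_def fps_const_mult[symmetric]
    by (intro xy_vanish_mult_left xy_vanish_nth P)
  show "xy_vanish 1 (fps_const (radial_slope P))"
    unfolding radial_slope_def
    by (intro xy_vanish_nth xy_vanish_diff xy_vanish_mult_left[OF P] xy_vanish_mult_right[OF A0])
qed

subsection \<open>Integrable forms with affine radial component\<close>

text \<open>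
  Write \<open>F = \<Sum> z\<^sup>k F\<^sub>k\<close> and compare the coefficients of \<open>z\<^sup>k\<^sup>+\<^sup>1\<close>. For \<open>k \<ge> 2\<close> the term in degree \<open>m\<close>
  (in \<open>x, y\<close>) of \<open>(E + 1) F\<^sub>k\<close> is \<open>m + 1\<close> times that of \<open>F\<^sub>k\<close>, while the right-hand side contains only
  \<open>a F\<^sub>k\<^sub>+\<^sub>2\<close> and \<open>b F\<^sub>k\<^sub>+\<^sub>1\<close>, where \<open>a\<close> and \<open>b\<close> vanish at the origin; so all these
  \<open>F\<^sub>k\<close> vanish by induction on \<open>m\<close>. What is left are the equations
  \<open>(E + 1) F\<^sub>0 = \<partial>\<^sub>n a\<close> and \<open>(E + 1) F\<^sub>1 = \<partial>\<^sub>n b\<close>, which the derivatives of the primitives of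
  \<open>a\<close> and \<open>b\<close> solve as well, because \<open>\<partial>\<^sub>n E = (E + 1) \<partial>\<^sub>n\<close>.
\<close>

lemma affine_of_radial_equation:
  fixes F :: fps3
  assumes eq: "fps_X * (xy_euler F + F - fpartial n (fps_const a + fps_X * fps_const b)) =
      (fps_const a + fps_X * fps_const b) * fps_deriv F - fps_const b * F"
    and n: "n \<noteq> 3"
    and a: "xy_vanish 1 (fps_const a)" and b: "xy_vanish 1 (fps_const b)"
  shows "F = fpartial n (xy_primitive (fps_const a)) + fps_X * fpartial n (xy_primitive (fps_const b))"
proof -
  have n12: "n = 1 \<or> n = 2" using n three_cases by blast
  let ?B = "fps_const a + fps_X * fps_const b"
  have coeff: "fps_nth (xy_euler F) k + fps_nth F k - fps_nth (fpartial n ?B) k =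
      of_nat (k + 2) * (a * fps_nth F (k + 2)) + of_nat (k + 1) * (b * fps_nth F (k + 1)) - b * fps_nth F (k + 1)" for k
    using arg_cong[OF eq, of "\<lambda>G. fps_nth G (Suc k)"]
    by (cases k) (simp_all add: algebra_simps)
  have ab: "xy_vanish2 1 a" "xy_vanish2 1 b"
    using a b unfolding xy_vanish_iff by (metis fps_nth_fps_const)+
  have B_high: "fps_nth (fpartial n ?B) k = 0" if "k \<ge> 2" for k
    using n12 that derivation_0[OF derivation_coeff_map[OF derivation_fps_deriv]]
    by (auto simp: fpartial_1 fpartial_2)
  have high: "xy_vanish2 m (fps_nth F k)" if "k \<ge> 2" for k m
    using that
  proof (induction m arbitrary: k)
    case (Suc m)
    have v: "xy_vanish2 (Suc m) (c * (A * fps_nth F l))" if "xy_vanish2 1 A" "l \<ge> 2" for A c l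
      using xy_vanish2_mult[OF xy_vanish2_0[of c] xy_vanish2_mult[OF that(1) Suc.IH[OF that(2)]]] by simp
    have "xy_vanish2 (Suc m) (fps_nth (xy_euler F) k + fps_nth F k)"
    proof -
      have 1: "fps_nth (xy_euler F) k + fps_nth F k = of_nat (k + 2) * (a * fps_nth F (k + 2)) +
          of_nat (k + 1) * (b * fps_nth F (k + 1)) - 1 * (b * fps_nth F (k + 1))"
        using coeff[of k] B_high[OF Suc.prems] by simp
      have "xy_vanish2 (Suc m) (of_nat (k + 2) * (a * fps_nth F (k + 2)))"
        "xy_vanish2 (Suc m) (of_nat (k + 1) * (b * fps_nth F (k + 1)))"
        "xy_vanish2 (Suc m) (1 * (b * fps_nth F (k + 1)))"
        using Suc.prems by (intro v ab; simp)+
      then show ?thesis unfolding 1 xy_vanish2_def coeff2_def by simp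
    qed
    moreover have "coeff2 (fps_nth (xy_euler F) k + fps_nth F k) i j =
        (of_nat (i + j) + 1) * coeff2 (fps_nth F k) i j" for i j
      using coeff3_xy_euler[of F i j k] by (simp add: coeff3_def coeff2_def algebra_simps)
    ultimately show ?case unfolding xy_vanish2_def
      by (metis mult_eq_0_iff of_nat_Suc of_nat_neq_0 add.commute)
  qed (simp add: xy_vanish2_0)
  have F_high: "fps_nth F k = 0" if "k \<ge> 2" for k
    using high[OF that] unfolding xy_vanish2_def coeff2_def by (metis fps_ext fps_zero_nth lessI)
  have F_low: "fps_nth (xy_euler F) k + fps_nth F k = fps_nth (fpartial n ?B) k" if "k < 2" for k
  proof -
    have "k = 0 \<or> k = 1" using that by auto
    then show ?thesis using coeff[of k] F_high[of "k + 2"] F_high[of 2] by (elim disjE) (simp_all add: eval_nat_numeral)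
  qed
  define G where "G = fpartial n (xy_primitive (fps_const a)) + fps_X * fpartial n (xy_primitive (fps_const b))"
  have primitive: "of_nat (Suc (i + j)) * coeff3 (fpartial n (xy_primitive H)) i j k = coeff3 (fpartial n H) i j k"
    for H i j k
    using n12 by (elim disjE) (simp_all add: fpartial_def xy_primitive_def del: of_nat_Suc of_nat_add)
  have X: "coeff3 (fps_X * H) i j k = (if k = 0 then 0 else coeff3 H i j (k - 1))" for H i j k
    by (simp add: coeff3_def)
  have "fpartial n fps_X = 0"
    using n fpartial_fvar[of n 3] by (simp add: fvar_3)
  then have "fpartial n ?B = fpartial n (fps_const a) + fps_X * fpartial n (fps_const b)"
    by (simp add: derivation_add[OF derivation_fpartial] derivation_mult[OF derivation_fpartial])
  then have G: "of_nat (Suc (i + j)) * coeff3 G i j k = coeff3 (fpartial n ?B) i j k" for i j k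
    by (simp add: G_def X distrib_left primitive del: of_nat_Suc)
  have "F = G"
  proof (rule fps3_eqI)
    fix i j k :: nat
    show "coeff3 F i j k = coeff3 G i j k"
    proof (cases "k < 2")
      case True
      have "of_nat (Suc (i + j)) * coeff3 F i j k = coeff3 (fpartial n ?B) i j k"
        using F_low[OF True, symmetric] coeff3_xy_euler[of F i j k]
        by (simp add: coeff3_def algebra_simps)
      with G[of i j k] have "of_nat (Suc (i + j)) * (coeff3 F i j k - coeff3 G i j k) = 0"
        by (simp add: algebra_simps)
      then show ?thesis by (simp del: of_nat_Suc)
    next
      case False
      then have "coeff3 (fpartial n ?B) i j k = 0" using B_high[of k] by (simp add: coeff3_def)
      with G[of i j k] have "of_nat (Suc (i + j)) * coeff3 G i j k = 0" by simp
      then show ?thesis using F_high[of k] False by (simp add: coeff3_def del: of_nat_Suc)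
    qed
  qed
  then show ?thesis by (simp add: G_def)
qed

subsection \<open>Substitutions that change \<open>z\<close> only\<close>

definition shear :: "fps3 \<Rightarrow> fps3^3"
  where "shear \<zeta> = vector [fvar 1, fvar 2, \<zeta>]"

lemma shear_nth [simp]: "shear \<zeta> $ 1 = fvar 1" "shear \<zeta> $ 2 = fvar 2" "shear \<zeta> $ 3 = \<zeta>"
  by (simp_all add: shear_def)

lemma coeff3_fvar_power_mult:
  "coeff3 (fvar 1 ^ i * fvar 2 ^ j * F) a b c =
    (if i \<le> a \<and> j \<le> b then coeff3 F (a - i) (b - j) c else 0)"
proof -
  have y: "coeff3 (fvar 2 ^ j * F) a b c = (if j \<le> b then coeff3 F a (b - j) c else 0)" for a b
  proof (induction j arbitrary: b)
    case (Suc j)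
    then show ?case by (auto simp: coeff3_fvar_2_mult mult.assoc)
  qed simp
  have "coeff3 (fvar 1 ^ i * G) a b c = (if i \<le> a then coeff3 G (a - i) b c else 0)" for G a
  proof (induction i arbitrary: a)
    case (Suc i)
    then show ?case by (auto simp: coeff3_fvar_1_mult mult.assoc)
  qed simp
  then show ?thesis by (simp add: y mult.assoc)
qed

text \<open>
  Only powers of \<open>x, y\<close> not exceeding the target exponents contribute, so the sum over all
  monomials of bounded total degree collapses to the sum that defines composition in \<open>z\<close>.
\<close>

lemma fsubst_shear:
  assumes "fps_nth \<zeta> 0 = 0"
  shows "fsubst F (shear \<zeta>) = fps_compose F \<zeta>"
proof (rule fps3_eqI)
  fix a b c :: nat
  let ?t = "\<lambda>i j k. coeff3 F i j k * coeff3 (\<zeta> ^ k) (a - i) (b - j) c"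
  have low: "coeff3 (\<zeta> ^ k) i j c = 0" if "c < k" for i j k
    using startsby_zero_power_prefix[OF assms] that by (simp add: coeff3_def)
  then have low': "coeff3 (\<zeta> ^ k) i j c \<noteq> 0 \<Longrightarrow> k \<le> c" for i j k
    using not_le by blast
  let ?S = "{(i, j, k). i + j + k \<le> a + b + c}"
  have fin: "finite ?S"
    by (rule finite_subset[of _ "{..a+b+c} \<times> {..a+b+c} \<times> {..a+b+c}"]) auto
  have "coeff3 (fsubst F (shear \<zeta>)) a b c =
      (\<Sum>(i, j, k)\<in>?S. if i \<le> a \<and> j \<le> b then ?t i j k else 0)"
    by (simp add: fsubst_def coeff3_fvar_power_mult) (intro sum.cong refl; auto)
  also have "\<dots> = (\<Sum>(i, j, k)\<in>{..a} \<times> {..b} \<times> {..c}. ?t i j k)"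
    by (rule sum.mono_neutral_cong_right[OF fin]) (auto split: if_splits dest: low')
  also have "\<dots> = (\<Sum>i\<le>a. \<Sum>j\<le>b. \<Sum>k\<le>c. ?t i j k)"
    by (simp add: sum.cartesian_product[symmetric])
  also have "\<dots> = (\<Sum>i\<le>a. \<Sum>k\<le>c. \<Sum>j\<le>b. ?t i j k)"
    by (intro sum.cong refl sum.swap)
  also have "\<dots> = (\<Sum>k\<le>c. \<Sum>i\<le>a. \<Sum>j\<le>b. ?t i j k)"
    by (rule sum.swap)
  also have "\<dots> = (\<Sum>k\<le>c. \<Sum>j\<le>b. \<Sum>i\<le>a. ?t i j k)"
    by (intro sum.cong refl sum.swap)
  also have "\<dots> = coeff3 (fps_compose F \<zeta>) a b c"
    by (simp add: coeff3_eq_coeff2 fps_compose_nth atLeast0AtMost)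
      (simp add: coeff2_def fps_sum_nth fps_mult_nth atLeast0AtMost)
  finally show "coeff3 (fsubst F (shear \<zeta>)) a b c = coeff3 (fps_compose F \<zeta>) a b c" .
qed

lemma fps_compose_fvar: "fps_compose (fvar 1) \<zeta> = fvar 1" "fps_compose (fvar 2) \<zeta> = fvar 2"
  by (simp_all add: fvar_def)

lemma formal_change_shear:
  assumes "fps_nth \<zeta> 0 = 0" "fps_nth Z 0 = 0"
    and "fps_compose \<zeta> Z = fps_X" "fps_compose Z \<zeta> = fps_X"
  shows "formal_change (shear \<zeta>)"
proof -
  have c: "centered (shear \<zeta>)" if "fps_nth \<zeta> 0 = 0" for \<zeta>
    unfolding centered_def forall_3 using that by (simp add: coeff3_def fvar_def)
  have "\<forall>n. fsubst (shear \<zeta> $ n) (shear Z) = fvar n \<and> fsubst (shear Z $ n) (shear \<zeta>) = fvar n"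
    unfolding forall_3
    by (simp add: fsubst_shear assms fps_compose_fvar fvar_3)
  then show ?thesis
    unfolding formal_change_def using c assms(1,2) by blast
qed

lemma formal_pullback_shear:
  assumes "fps_nth \<zeta> 0 = 0"
  shows "formal_pullback (shear \<zeta>) (vector [U, V, fps_X]) =
    vector [fps_compose U \<zeta> + \<zeta> * fpartial 1 \<zeta>, fps_compose V \<zeta> + \<zeta> * fpartial 2 \<zeta>, \<zeta> * fps_deriv \<zeta>]"
  unfolding vec_eq_iff forall_3
  by (simp add: formal_pullback_def sum_3 fsubst_shear assms fd_def fpartial_fvar fpartial_3
      fps_X_fps_compose_startby0)

lemma fpartial_compose:
  assumes "fps_nth \<zeta> 0 = 0" and "n \<noteq> 3"
  shows "fpartial n (fps_compose F \<zeta>) =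
    fps_compose (fpartial n F) \<zeta> + fps_compose (fps_deriv F) \<zeta> * fpartial n \<zeta>"
  using three_cases[of n] assms(2)
    coeff_map_compose[OF derivation_fps_deriv assms(1)]
    coeff_map_compose[OF derivation_coeff_map[OF derivation_fps_deriv] assms(1)]
  by (auto simp: fpartial_1 fpartial_2)

subsection \<open>Integrability\<close>

text \<open>The coefficient of \<open>A \<and> dA\<close> with respect to \<open>dx \<and> dy \<and> dz\<close>.\<close>

definition integrability :: "formal_form \<Rightarrow> fps3"
  where "integrability A =
    A $ 1 * (fpartial 2 (A $ 3) - fpartial 3 (A $ 2)) +
    A $ 2 * (fpartial 3 (A $ 1) - fpartial 1 (A $ 3)) +
    A $ 3 * (fpartial 1 (A $ 2) - fpartial 2 (A $ 1))"

lemma integrability_scale: "integrability (H *s A) = H * H * integrability A"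
  by (simp add: integrability_def derivation_mult[OF derivation_fpartial] algebra_simps)

text \<open>
  With \<open>\<phi>\<close> the substitution, the pullback is \<open>\<phi>\<^sup>*(U dx + V dy) + d(\<zeta>\<^sup>2 / 2)\<close>; the exact term does not
  contribute to the exterior derivative, and the chain rule makes the coefficient of the
  pullback equal to \<open>\<zeta>\<^sub>z\<close> times the composed coefficient of the form.
\<close>

lemma integrability_pullback_shear:
  assumes z0: "fps_nth \<zeta> 0 = 0" and int: "integrability (vector [U, V, fps_X]) = 0"
  shows "integrability (formal_pullback (shear \<zeta>) (vector [U, V, fps_X])) = 0"
proof -
  let ?c = "\<lambda>F. fps_compose F \<zeta>"
  have X: "fpartial 1 fps_X = 0" "fpartial 2 fps_X = 0"
    using fpartial_fvar[of 1 3] fpartial_fvar[of 2 3] by (simp_all add: fvar_3)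
  have "?c (integrability (vector [U, V, fps_X])) =
      - ?c U * ?c (fps_deriv V) + ?c V * ?c (fps_deriv U) + \<zeta> * (?c (fpartial 1 V) - ?c (fpartial 2 U))"
    by (simp add: integrability_def X fpartial_3 fps_compose_add_distrib fps_compose_sub_distrib
        fps_compose_mult_distrib[OF z0] fps_X_fps_compose_startby0[OF z0] fps_compose_uminus)
  then have 0: "?c V * ?c (fps_deriv U) + \<zeta> * ?c (fpartial 1 V) =
      ?c U * ?c (fps_deriv V) + \<zeta> * ?c (fpartial 2 U)"
    by (simp add: int algebra_simps)
  have comm: "fps_deriv (fpartial 1 \<zeta>) = fpartial 1 (fps_deriv \<zeta>)"
    "fps_deriv (fpartial 2 \<zeta>) = fpartial 2 (fps_deriv \<zeta>)" "fpartial 1 (fpartial 2 \<zeta>) = fpartial 2 (fpartial 1 \<zeta>)"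
    using fpartial_commute[of 1 2 \<zeta>] fpartial_commute[of 1 3 \<zeta>] fpartial_commute[of 2 3 \<zeta>] by (simp_all add: fpartial_3)
  have "integrability (formal_pullback (shear \<zeta>) (vector [U, V, fps_X])) =
      fps_deriv \<zeta> * ((?c V * ?c (fps_deriv U) + \<zeta> * ?c (fpartial 1 V)) -
        (?c U * ?c (fps_deriv V) + \<zeta> * ?c (fpartial 2 U)))"
    unfolding formal_pullback_shear[OF z0] integrability_def
    by (simp add: fpartial_3 fpartial_compose[OF z0] fps_compose_deriv[OF z0] comm
      derivation_add[OF derivation_fpartial] derivation_mult[OF derivation_fpartial] algebra_simps)
  then show ?thesis by (simp add: 0)
qed

text \<open>
  For \<open>\<beta> = p dx + q dy\<close> integrability of \<open>z dz + \<beta>\<close> reads \<open>z d\<beta> = \<beta> \<and> \<beta>\<^sub>z\<close>, with \<open>d\<close> the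
  differential in \<open>x, y\<close>. Contraction with the Euler field \<open>E\<close> and Cartan's formula
  \<open>L\<^sub>E = i\<^sub>E d + d i\<^sub>E\<close> turn this into \<open>z (L\<^sub>E \<beta> - dB) = B \<beta>\<^sub>z - B\<^sub>z \<beta>\<close>, where \<open>B = \<beta>(E)\<close>. Thus the two
  coefficients no longer interact, except through \<open>B\<close>.
\<close>

lemma radial_equation_of_integrability:
  assumes int: "integrability (vector [p, q, fps_X]) = 0"
    and B: "fvar 1 * p + fvar 2 * q = B"
  shows "fps_X * (xy_euler p + p - fpartial 1 B) = B * fps_deriv p - fps_deriv B * p"
    and "fps_X * (xy_euler q + q - fpartial 2 B) = B * fps_deriv q - fps_deriv B * q"
proof -
  have X: "fpartial 1 fps_X = 0" "fpartial 2 fps_X = 0"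
    using fpartial_fvar[of 1 3] fpartial_fvar[of 2 3] by (simp_all add: fvar_3)
  have "fpartial 3 (fvar 1) = 0" "fpartial 3 (fvar 2) = 0"
    by (simp_all add: fpartial_fvar)
  then have D3: "fps_deriv (fvar 1) = 0" "fps_deriv (fvar 2) = 0" by (simp_all add: fpartial_3)
  have int': "fps_X * (fpartial 1 q - fpartial 2 p) = p * fps_deriv q - q * fps_deriv p"
    using int by (simp add: integrability_def X fpartial_3 algebra_simps)
  note rules = xy_euler_def derivation_add[OF derivation_fpartial] derivation_mult[OF derivation_fpartial]
    fpartial_fvar D3
  have "fps_X * (xy_euler p + p - fpartial 1 B) = - fvar 2 * (fps_X * (fpartial 1 q - fpartial 2 p))"
    unfolding B[symmetric] by (simp add: rules algebra_simps)
  also have "\<dots> = B * fps_deriv p - fps_deriv B * p"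
    unfolding B[symmetric] int' by (simp add: rules algebra_simps)
  finally show "fps_X * (xy_euler p + p - fpartial 1 B) = B * fps_deriv p - fps_deriv B * p" .
  have "fps_X * (xy_euler q + q - fpartial 2 B) = fvar 1 * (fps_X * (fpartial 1 q - fpartial 2 p))"
    unfolding B[symmetric] by (simp add: rules algebra_simps)
  also have "\<dots> = B * fps_deriv q - fps_deriv B * q"
    unfolding B[symmetric] int' by (simp add: rules algebra_simps)
  finally show "fps_X * (xy_euler q + q - fpartial 2 B) = B * fps_deriv q - fps_deriv B * q" .
qed

subsection \<open>Reduction to the normal form\<close>

definition radial_form :: "fps3 \<Rightarrow> fps3 \<Rightarrow> fps3"
  where "radial_form U V = fvar 1 * U + fvar 2 * V"

text \<open>
  The old coordinate \<open>z\<close> as a series in the new one, \<open>w = z Y\<close>, and the factor between the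
  pullback by this change and the normal form.
\<close>

definition normalizing_series :: "fps3 \<Rightarrow> fps3"
  where "normalizing_series P =
    compositional_inverse (fps_X * radial_unit P) (fps_nth (radial_unit_inverse P) 0)"

definition normalizing_factor :: "fps3 \<Rightarrow> fps3"
  where "normalizing_factor P =
    fps_compose (radial_unit_inverse P) (normalizing_series P) * fps_deriv (normalizing_series P)"

definition normalizing_factor_inverse :: "fps3 \<Rightarrow> fps3"
  where "normalizing_factor_inverse P =
    fps_compose (radial_unit P * fps_deriv (fps_X * radial_unit P)) (normalizing_series P)"

definition plane_primitive :: "fps2 \<Rightarrow> fps2"
  where "plane_primitive A = fps_nth (xy_primitive (fps_const A)) 0"

lemma fps_const_plane_primitive: "fps_const (plane_primitive A) = xy_primitive (fps_const A)"
  by (rule fps3_eqI) (simp add: plane_primitive_def xy_primitive_def coeff3_def series3_def)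

lemma formal_normal_form_eq:
  "formal_normal_form f g = vector
    [fpartial 1 (fps_const f) + fps_X * fpartial 1 (fps_const g),
     fpartial 2 (fps_const f) + fps_X * fpartial 2 (fps_const g), fps_X]"
  unfolding vec_eq_iff forall_3
  by (simp add: formal_normal_form_def fd_def fpartial_fvar fpartial_3 fvar_3 flip: fvar_3)

text \<open>
  Put \<open>Z = z Y\<close> and \<open>H = Y Z\<^sub>z\<close>. Then \<open>H (z dz + U dx + V dy) = Z dZ + \<gamma>\<close> with a form \<open>\<gamma>\<close> in
  \<open>dx, dy\<close>, and the radial equation says exactly that \<open>\<gamma>(E) = a + Z b\<close>. Passing to the
  coordinate \<open>w = Z\<close>, one has an integrable form \<open>w dw + \<beta>\<close> whose radial component \<open>a + w b\<close> is affine
  in \<open>w\<close>, hence \<open>\<beta> = df + w dg\<close>. The relation \<open>df \<and> dg = 0\<close> is the coefficient of \<open>w\<^sup>0\<close> in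
  the integrability condition.
\<close>

lemma formal_normalization:
  assumes int: "integrability (vector [U, V, fps_X]) = 0"
  defines "P \<equiv> radial_form U V"
  defines "f \<equiv> plane_primitive (radial_const P)" and "g \<equiv> plane_primitive (radial_slope P)"
  shows "formal_change (shear (normalizing_series P))"
    and "normalizing_factor P * normalizing_factor_inverse P = 1"
    and "formal_pullback (shear (normalizing_series P)) (vector [U, V, fps_X]) =
      normalizing_factor P *s formal_normal_form f g"
    and "formal_wedge (fd (fps_const f)) (fd (fps_const g)) = 0"
proof -
  have P: "xy_vanish 1 P"
    by (auto simp: P_def radial_form_def xy_vanish_def coeff3_fvar_1_mult coeff3_fvar_2_mult)
  define Y where "Y = radial_unit P"
  define Vi where "Vi = radial_unit_inverse P"
  define Z where "Z = fps_X * Y"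
  define \<zeta> where "\<zeta> = normalizing_series P"
  define a where "a = radial_const P"
  define b where "b = radial_slope P"
  note sol = radial_solution[OF P, folded Y_def Vi_def a_def b_def]
  have Z0: "fps_nth Z 0 = 0" and Z1: "fps_nth Z 1 * fps_nth Vi 0 = 1"
    using arg_cong[OF sol(1), of "\<lambda>F. fps_nth F 0"] by (simp_all add: Z_def)
  note left = compositional_inverse_left[OF Z0 Z1] and right = compositional_inverse_right[OF Z0 Z1]
  have \<zeta>_eq: "\<zeta> = compositional_inverse Z (fps_nth Vi 0)"
    by (simp add: \<zeta>_def normalizing_series_def Z_def Y_def Vi_def)
  have \<zeta>0: "fps_nth \<zeta> 0 = 0" and \<zeta>Z: "fps_compose \<zeta> Z = fps_X" and Z\<zeta>: "fps_compose Z \<zeta> = fps_X"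
    using left right by (simp_all add: \<zeta>_eq)
  show "formal_change (shear (normalizing_series P))"
    using formal_change_shear[OF \<zeta>0 Z0 \<zeta>Z Z\<zeta>] by (simp add: \<zeta>_def)
  let ?c = "\<lambda>F. fps_compose F \<zeta>"
  note c_mult = fps_compose_mult_distrib[OF \<zeta>0] and cX = fps_X_fps_compose_startby0[OF \<zeta>0]
  define K where "K = ?c (Y * fps_deriv Z)"
  have K: "K = normalizing_factor_inverse P"
    by (simp add: K_def normalizing_factor_inverse_def \<zeta>_def Z_def Y_def)
  have Z': "?c (fps_deriv Z) * fps_deriv \<zeta> = 1"
    using fps_compose_deriv[OF \<zeta>0, of Z] by (simp add: Z\<zeta>)
  have YV: "?c Y * ?c Vi = 1"
    using c_mult[of Y Vi] sol(1) by simp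
  have hK: "normalizing_factor P * K = 1"
  proof -
    have "normalizing_factor P * K = (?c Y * ?c Vi) * (?c (fps_deriv Z) * fps_deriv \<zeta>)"
      unfolding K_def normalizing_factor_def \<zeta>_def[symmetric] Vi_def[symmetric] c_mult by (simp only: ac_simps)
    then show ?thesis by (simp add: YV Z')
  qed
  then show "normalizing_factor P * normalizing_factor_inverse P = 1" by (simp add: K)
  have K\<zeta>: "K * \<zeta> = fps_X * ?c (fps_deriv Z)"
  proof -
    have "K * \<zeta> = ?c (Y * fps_X) * ?c (fps_deriv Z)"
      unfolding K_def c_mult cX by (simp only: ac_simps)
    then show ?thesis using Z\<zeta> by (simp add: Z_def mult.commute)
  qed
  have cD: "?c (fpartial n Z) + ?c (fps_deriv Z) * fpartial n \<zeta> = 0" if "n \<noteq> 3" for n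
    using fpartial_compose[OF \<zeta>0 that, of Z] fpartial_fvar[of n 3] that by (simp add: Z\<zeta> fvar_3)
  define \<gamma> where "\<gamma> n W = Y * fps_deriv Z * W - Z * fpartial n Z" for n W
  \<comment> \<open>The components of the pullback of \<open>Z dZ + \<gamma>\<close>, where \<open>dZ\<close> becomes \<open>dw\<close>.\<close>
  have scaled: "K * (?c W + \<zeta> * fpartial n \<zeta>) = ?c (\<gamma> n W)" if "n \<noteq> 3" for n W
  proof -
    have "?c (\<gamma> n W) = K * ?c W - fps_X * ?c (fpartial n Z)"
      unfolding \<gamma>_def fps_compose_sub_distrib c_mult[of "Y * fps_deriv Z"] c_mult[of Z] Z\<zeta> K_def ..
    also have "?c (fpartial n Z) = - ?c (fps_deriv Z) * fpartial n \<zeta>"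
      using cD[OF that] by (simp add: eq_neg_iff_add_eq_0)
    also have "K * ?c W - fps_X * (- ?c (fps_deriv Z) * fpartial n \<zeta>) = K * ?c W + K * \<zeta> * fpartial n \<zeta>"
      by (simp add: K\<zeta> algebra_simps)
    finally show ?thesis by (simp add: algebra_simps)
  qed
  define p where "p = ?c (\<gamma> 1 U)"
  define q where "q = ?c (\<gamma> 2 V)"
  have pull: "K *s formal_pullback (shear \<zeta>) (vector [U, V, fps_X]) = vector [p, q, fps_X]"
    unfolding formal_pullback_shear[OF \<zeta>0] vec_eq_iff forall_3 p_def q_def
    using scaled[of 1 U] scaled[of 2 V] K\<zeta> Z' 
    by (simp flip: mult.assoc)
  have intpq: "integrability (vector [p, q, fps_X]) = 0"
    unfolding pull[symmetric] integrability_scale integrability_pullback_shear[OF \<zeta>0 int] by simp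
  define B where "B = fps_const a + fps_X * fps_const b"
  have B: "fvar 1 * p + fvar 2 * q = B"
  proof -
    have fp: "fpartial n Z = fps_X * fpartial n Y" if "n \<noteq> 3" for n
      using fpartial_fvar[of n 3] that unfolding Z_def derivation_mult[OF derivation_fpartial] by (simp add: fvar_3)
    have dZ: "fps_deriv Z = Y + fps_X * fps_deriv Y" by (simp add: Z_def)
    have "fvar 1 * \<gamma> 1 U + fvar 2 * \<gamma> 2 V =
        Y * ((Y + fps_X * fps_deriv Y) * P - fps_X * (fps_X * xy_euler Y))"
      by (simp add: \<gamma>_def fp dZ P_def radial_form_def xy_euler_def) (simp add: Z_def algebra_simps)
    also have "\<dots> = Y * (fps_const a * Vi + fps_X * fps_const b)"
      unfolding sol(2) by (simp add: algebra_simps)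
    also have "\<dots> = (Y * Vi) * fps_const a + Z * fps_const b"
      unfolding Z_def by (simp only: algebra_simps)
    finally have *: "fvar 1 * \<gamma> 1 U + fvar 2 * \<gamma> 2 V = fps_const a + Z * fps_const b"
      by (simp add: sol(1))
    show ?thesis
      using arg_cong[OF *, of ?c]
      by (simp add: fps_compose_add_distrib c_mult fps_compose_fvar Z\<zeta> p_def q_def B_def)
  qed
  have B': "fps_deriv B = fps_const b" by (simp add: B_def)
  note eqs = radial_equation_of_integrability[OF intpq B, unfolded B' , unfolded B_def]
  have p: "p = fpartial 1 (fps_const f) + fps_X * fpartial 1 (fps_const g)"
    and q: "q = fpartial 2 (fps_const f) + fps_X * fpartial 2 (fps_const g)"
    using affine_of_radial_equation[OF eqs(1) _ sol(3,4)] affine_of_radial_equation[OF eqs(2) _ sol(3,4)]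
    by (simp_all add: f_def g_def fps_const_plane_primitive a_def b_def)
  then have nf: "vector [p, q, fps_X] = formal_normal_form f g"
    by (simp add: formal_normal_form_eq)
  show "formal_pullback (shear (normalizing_series P)) (vector [U, V, fps_X]) =
      normalizing_factor P *s formal_normal_form f g"
    unfolding nf[symmetric] pull[symmetric] \<zeta>_def[symmetric] vector_smult_assoc hK by (rule vector_smult_lid[symmetric])
  show "formal_wedge (fd (fps_const f)) (fd (fps_const g)) = 0"
  proof -
    define w where "w = fpartial 1 (fps_const f) * fpartial 2 (fps_const g) - fpartial 2 (fps_const f) * fpartial 1 (fps_const g)"
    have hi: "fps_nth (fpartial n (fps_const h)) k = 0" if "n \<noteq> 3" "k > 0" for n h k
      using three_cases[of n] that derivation_0[OF derivation_coeff_map[OF derivation_fps_deriv]]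
      by (auto simp: fpartial_1 fpartial_2)
    have z: "fpartial 3 (fps_const h) = 0" for h :: fps2 by (simp add: fpartial_3)
    have X: "fpartial 1 fps_X = 0" "fpartial 2 fps_X = 0"
      using fpartial_fvar[of 1 3] fpartial_fvar[of 2 3] by (simp_all add: fvar_3)
    have "fps_nth (integrability (vector [p, q, fps_X])) 0 = - fps_nth w 0"
      using z[of f] z[of g] hi[of 1] hi[of 2]
      by (simp add: integrability_def X fpartial_3 p q w_def numeral_eq_Suc algebra_simps)
    then have w0: "fps_nth w 0 = 0" by (simp add: intpq)
    have w: "w = 0"
    proof (rule fps_ext)
      fix k show "fps_nth w k = fps_nth 0 k"
      proof (cases "k = 0")
        case False
        have "fps_nth (F * G) k = 0" if "\<And>j. j > 0 \<Longrightarrow> fps_nth F j = 0" "\<And>j. j > 0 \<Longrightarrow> fps_nth G j = 0" for F G :: fps3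
          unfolding fps_mult_nth
        proof (rule sum.neutral, rule ballI)
          fix i show "fps_nth F i * fps_nth G (k - i) = 0"
            using that(1)[of i] that(2)[of "k - i"] False by (cases "i = 0") auto
        qed
        then show ?thesis unfolding w_def using hi by simp
      qed (simp add: w0)
    qed
    have w': "fpartial 1 (fps_const f) * fpartial 2 (fps_const g) = fpartial 2 (fps_const f) * fpartial 1 (fps_const g)"
      using w by (simp add: w_def)
    show ?thesis
      unfolding formal_wedge_def fd_def vec_eq_iff forall_3 using w' by (simp add: z mult.commute)
  qed
qed

subsection \<open>Dependence on parameters\<close>

context
  fixes W :: "(real^'l) set"
  assumes W: "open W"
begin

lemma smooth_coeffs3_radial:
  assumes P: "smooth_coeffs3 W P"
  shows "smooth_coeffs3 W (\<lambda>e. radial_unit (P e))"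
    and "smooth_coeffs3 W (\<lambda>e. radial_unit_inverse (P e))"
    and "smooth_coeffs2 W (\<lambda>e. radial_const (P e))"
    and "smooth_coeffs2 W (\<lambda>e. radial_slope (P e))"
    and "smooth_coeffs3 W (\<lambda>e. normalizing_series (P e))"
    and "smooth_coeffs3 W (\<lambda>e. normalizing_factor (P e))"
    and "smooth_coeffs3 W (\<lambda>e. normalizing_factor_inverse (P e))"
proof -
  note rules = smooth_coeffs3_add[OF W] smooth_coeffs3_diff[OF W] smooth_coeffs3_mult[OF W]
    smooth_coeffs3_const[OF W] smooth_coeffs3_shift[OF W] smooth_coeffs3_deriv[OF W]
    smooth_coeffs3_primitive[OF W] smooth_coeffs3_fps_const[OF W]
    smooth_coeffs2_mult[OF W] smooth_coeffs3_nth[OF W] P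
  have step: "smooth_coeffs3 W (\<lambda>e. radial_step (P e) (F e) b)"
    if F: "\<And>b. smooth_coeffs3 W (\<lambda>e. F e b)" for F b
  proof -
    have Q: "smooth_coeffs3 W (\<lambda>e. xy_primitive (radial_rhs (P e) (F e True) (F e False)))"
      unfolding radial_rhs_def by (intro rules F)
    show ?thesis
    proof (cases b)
      case True
      have "smooth_coeffs3 W (\<lambda>e. 1 + xy_primitive (radial_rhs (P e) (F e True) (F e False)))"
        by (intro rules Q)
      then show ?thesis using True by (simp add: radial_step_def)
    next
      case False
      have "smooth_coeffs3 W (\<lambda>e. 1 - xy_primitive (radial_rhs (P e) (F e True) (F e False)) * F e False)"
        by (intro rules Q F)
      then show ?thesis using False by (simp add: radial_step_def)
    qed
  qed
  show Y: "smooth_coeffs3 W (\<lambda>e. radial_unit (P e))"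
    unfolding radial_unit_def by (rule smooth_coeffs3_xy_fixpoint[OF W step])
  show V: "smooth_coeffs3 W (\<lambda>e. radial_unit_inverse (P e))"
    unfolding radial_unit_inverse_def by (rule smooth_coeffs3_xy_fixpoint[OF W step])
  show A: "smooth_coeffs2 W (\<lambda>e. radial_const (P e))"
    unfolding radial_const_def by (intro rules Y)
  show "smooth_coeffs2 W (\<lambda>e. radial_slope (P e))"
    unfolding radial_slope_def by (intro rules Y V A)
  show \<zeta>: "smooth_coeffs3 W (\<lambda>e. normalizing_series (P e))"
    unfolding normalizing_series_def by (intro smooth_coeffs3_compositional_inverse[OF W] rules Y V)
  show "smooth_coeffs3 W (\<lambda>e. normalizing_factor (P e))"
    unfolding normalizing_factor_def by (intro smooth_coeffs3_compose[OF W] rules \<zeta> V)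
  show "smooth_coeffs3 W (\<lambda>e. normalizing_factor_inverse (P e))"
    unfolding normalizing_factor_inverse_def by (intro smooth_coeffs3_compose[OF W] rules \<zeta> Y)
qed

lemma smooth_coeffs2_plane_primitive:
  "smooth_coeffs2 W A \<Longrightarrow> smooth_coeffs2 W (\<lambda>e. plane_primitive (A e))"
  unfolding plane_primitive_def
  by (intro smooth_coeffs3_nth[OF W] smooth_coeffs3_primitive[OF W] smooth_coeffs3_fps_const[OF W])

lemma formal_pfaffian_unit_multiple:
  assumes H: "smooth_coeffs3 W H" and K: "smooth_coeffs3 W K"
    and e: "\<And>e. e \<in> W \<Longrightarrow> H e * K e = 1" "\<And>e. e \<in> W \<Longrightarrow> A e = H e *s B e"
  shows "formal_pfaffian W A = formal_pfaffian W B"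
proof -
  have sub: "formal_pfaffian W A \<subseteq> formal_pfaffian W B"
    if "smooth_coeffs3 W H" "\<And>e. e \<in> W \<Longrightarrow> A e = H e *s B e" for A B H
  proof
    fix C assume "C \<in> formal_pfaffian W A"
    then obtain G where "smooth_coeffs3 W G" "\<forall>e\<in>W. C e = G e *s A e"
      by (auto simp: formal_pfaffian_def)
    then have "smooth_coeffs3 W (\<lambda>e. G e * H e)" "\<forall>e\<in>W. C e = (G e * H e) *s B e"
      using that by (auto simp: smooth_coeffs3_mult[OF W] vector_smult_assoc)
    then show "C \<in> formal_pfaffian W B"
      by (auto simp: formal_pfaffian_def)
  qed
  have "B e = K e *s A e" if "e \<in> W" for e
    using e[OF that] by (simp add: vector_smult_assoc mult.commute[of "K e"] vector_smult_lid)
  then show ?thesis using sub[OF H e(2)] sub[OF K, of B A] by blast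
qed

lemma formal_normalization_family:
  assumes U: "smooth_coeffs3 W U" and V: "smooth_coeffs3 W V"
    and A: "\<And>e. e \<in> W \<Longrightarrow> A e = vector [U e, V e, fps_X]"
    and int: "\<And>e. e \<in> W \<Longrightarrow> integrability (A e) = 0"
  shows "\<exists>\<Phi> f g. (\<forall>n. smooth_coeffs3 W (\<lambda>e. \<Phi> e $ n)) \<and> (\<forall>e\<in>W. formal_change (\<Phi> e)) \<and>
      smooth_coeffs2 W f \<and> smooth_coeffs2 W g \<and>
      formal_pfaffian W (\<lambda>e. formal_pullback (\<Phi> e) (A e))
        = formal_pfaffian W (\<lambda>e. formal_normal_form (f e) (g e)) \<and>
      (\<forall>e\<in>W. formal_wedge (fd (fps_const (f e))) (fd (fps_const (g e))) = 0)"
proof -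
  define P where "P e = radial_form (U e) (V e)" for e
  have P: "smooth_coeffs3 W P"
    unfolding P_def radial_form_def
    by (intro smooth_coeffs3_add[OF W] smooth_coeffs3_mult[OF W] smooth_coeffs3_const[OF W] U V)
  note smooth = smooth_coeffs3_radial[OF P]
  define \<Phi> where "\<Phi> e = shear (normalizing_series (P e))" for e
  define f where "f e = plane_primitive (radial_const (P e))" for e
  define g where "g e = plane_primitive (radial_slope (P e))" for e
  have int': "integrability (vector [U e, V e, fps_X]) = 0" if "e \<in> W" for e
    using A[OF that] int[OF that] by simp
  note nf = formal_normalization[OF int', folded P_def, folded \<Phi>_def f_def g_def]
  have "formal_pfaffian W (\<lambda>e. formal_pullback (\<Phi> e) (A e))
        = formal_pfaffian W (\<lambda>e. formal_normal_form (f e) (g e))"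
    by (rule formal_pfaffian_unit_multiple[OF smooth(6,7)]) (simp_all add: nf A)
  moreover have "\<forall>n. smooth_coeffs3 W (\<lambda>e. \<Phi> e $ n)"
    unfolding forall_3 by (simp add: \<Phi>_def smooth smooth_coeffs3_const[OF W])
  moreover have "smooth_coeffs2 W f" "smooth_coeffs2 W g"
    unfolding f_def g_def by (intro smooth_coeffs2_plane_primitive smooth)+
  ultimately show ?thesis using nf by blast
qed

end

section \<open>Taylor series\<close>

lemma fps3_eqI_partials:
  assumes 0: "coeff3 F 0 0 0 = coeff3 G 0 0 0"
    and 1: "\<And>n. fpartial n F = fpartial n G"
  shows "F = G"
proof (rule fps3_eqI)
  fix i j k
  consider "i = 0" "j = 0" "k = 0" | a where "i = Suc a" | b where "j = Suc b" | c where "k = Suc c"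
    by (cases i; cases j; cases k) auto
  then show "coeff3 F i j k = coeff3 G i j k"
  proof cases
    case 2 then show ?thesis
      using arg_cong[OF 1[of 1], of "\<lambda>F. coeff3 F a j k"] by (simp add: fpartial_def del: of_nat_Suc)
  next
    case 3 then show ?thesis
      using arg_cong[OF 1[of 2], of "\<lambda>F. coeff3 F i b k"] by (simp add: fpartial_def del: of_nat_Suc)
  next
    case 4 then show ?thesis
      using arg_cong[OF 1[of 3], of "\<lambda>F. coeff3 F i j c"] by (simp add: fpartial_def del: of_nat_Suc)
  qed (simp add: 0)
qed

lemma partial_deriv_cong:
  assumes "open S" "\<And>p. p \<in> S \<Longrightarrow> f p = g p" "p \<in> S"
  shows "partial_deriv n f p = partial_deriv n g p"
proof -
  have *: "(\<lambda>h. (f has_derivative h) (at p)) = (\<lambda>h. (g has_derivative h) (at p))"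
    using has_derivative_transform_within_open[OF _ assms(1,3), of f _ UNIV g]
      has_derivative_transform_within_open[OF _ assms(1,3), of g _ UNIV f] assms(2) by fastforce
  show ?thesis unfolding partial_deriv_def frechet_derivative_def * ..
qed

lemma partial_deriv_iterate_cong:
  assumes "open S" "\<And>p. p \<in> S \<Longrightarrow> f p = g p" "p \<in> S"
  shows "(partial_deriv n ^^ i) f p = (partial_deriv n ^^ i) g p"
  using assms(3)
proof (induction i arbitrary: p)
  case (Suc i)
  show ?case using partial_deriv_cong[OF assms(1) Suc.IH Suc.prems] by simp
qed (simp add: assms(2))

lemma partial_deriv_eqI: "(f has_derivative f') (at p) \<Longrightarrow> partial_deriv n f p = f' (axis n 1)"
  unfolding partial_deriv_def using frechet_derivative_at by metis

lemma smooth_on_partial_deriv: "smooth_on S f \<Longrightarrow> smooth_on S (partial_deriv n f)"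
  unfolding partial_deriv_def by (rule smooth_on_directional)

lemma smooth_on_partial_deriv_iterate: "smooth_on S f \<Longrightarrow> smooth_on S ((partial_deriv n ^^ i) f)"
  by (induction i) (auto intro: smooth_on_partial_deriv)

context
  fixes S :: "(real^3) set"
  assumes S: "open S" and zero: "0 \<in> S"
begin

lemma taylor_cong:
  assumes "\<And>p. p \<in> S \<Longrightarrow> f p = g p" shows "taylor f = taylor g"
proof (rule fps3_eqI)
  fix i j k
  note cong = partial_deriv_iterate_cong[OF S]
  show "coeff3 (taylor f) i j k = coeff3 (taylor g) i j k"
    using cong[OF cong[OF cong[OF assms]] zero] by (simp add: taylor_def)
qed

lemma partial_deriv_commute:
  assumes "smooth_on S f" "p \<in> S"
  shows "partial_deriv m (partial_deriv n f) p = partial_deriv n (partial_deriv m f) p"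
  unfolding partial_deriv_def by (rule symmetric_second_derivative[OF S assms])

lemma partial_deriv_iterate_commute:
  assumes "smooth_on S f" "p \<in> S"
  shows "(partial_deriv m ^^ i) (partial_deriv n f) p = partial_deriv n ((partial_deriv m ^^ i) f) p"
  using assms(2)
proof (induction i arbitrary: p)
  case (Suc i)
  have "partial_deriv m ((partial_deriv m ^^ i) (partial_deriv n f)) p =
      partial_deriv m (partial_deriv n ((partial_deriv m ^^ i) f)) p"
    by (rule partial_deriv_cong[OF S Suc])
  also have "\<dots> = partial_deriv n (partial_deriv m ((partial_deriv m ^^ i) f)) p"
    by (rule partial_deriv_commute[OF smooth_on_partial_deriv_iterate[OF assms(1)] Suc.prems])
  finally show ?case by simp
qed simp

text \<open>
  The coefficients of a Taylor series are defined by partial derivatives in a fixed order; the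
  additional derivative has to be commuted to its place.
\<close>

lemma taylor_partial_deriv:
  assumes f: "smooth_on S f"
  shows "taylor (partial_deriv n f) = fpartial n (taylor f)"
proof (rule fps3_eqI)
  fix i j k
  have fact_cancel: "real (Suc m) * x / (fact (Suc m) * a * b) = x / (fact m * a * b)"
    "real (Suc m) * x / (a * fact (Suc m) * b) = x / (a * fact m * b)"
    "real (Suc m) * x / (a * b * fact (Suc m)) = x / (a * b * fact m)" for m x a b
    by (simp_all add: fact_Suc divide_simps del: of_nat_Suc)
  let ?D = "\<lambda>n i. (partial_deriv n ^^ i)"
  note cong = partial_deriv_iterate_cong[OF S]
    and comm = partial_deriv_iterate_commute and smooth = smooth_on_partial_deriv_iterate
  consider "n = 1" | "n = 2" | "n = 3" using three_cases by blast
  then show "coeff3 (taylor (partial_deriv n f)) i j k = coeff3 (fpartial n (taylor f)) i j k"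
  proof cases
    case 1
    have "?D 1 i (?D 2 j (?D 3 k (partial_deriv 1 f))) 0 = ?D 1 i (?D 2 j (partial_deriv 1 (?D 3 k f))) 0"
      by (rule cong[OF cong[OF comm[OF f]] zero])
    also have "\<dots> = ?D 1 i (partial_deriv 1 (?D 2 j (?D 3 k f))) 0"
      by (rule cong[OF comm[OF smooth[OF f]] zero])
    also have "\<dots> = ?D 1 (Suc i) (?D 2 j (?D 3 k f)) 0"
      by (simp add: funpow_swap1)
    finally show ?thesis using 1 by (simp add: taylor_def fpartial_def fact_cancel del: of_nat_Suc fact_Suc)
  next
    case 2
    have "?D 1 i (?D 2 j (?D 3 k (partial_deriv 2 f))) 0 = ?D 1 i (?D 2 j (partial_deriv 2 (?D 3 k f))) 0"
      by (rule cong[OF cong[OF comm[OF f]] zero])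
    also have "\<dots> = ?D 1 i (?D 2 (Suc j) (?D 3 k f)) 0"
      by (simp add: funpow_swap1)
    finally show ?thesis using 2 by (simp add: taylor_def fpartial_def fact_cancel del: of_nat_Suc fact_Suc)
  next
    case 3
    have "?D 1 i (?D 2 j (?D 3 k (partial_deriv 3 f))) 0 = ?D 1 i (?D 2 j (?D 3 (Suc k) f)) 0"
      by (simp add: funpow_swap1)
    then show ?thesis using 3 by (simp add: taylor_def fpartial_def fact_cancel del: of_nat_Suc fact_Suc)
  qed
qed

lemma partial_deriv_add:
  assumes "smooth_on S f" "smooth_on S g" "p \<in> S"
  shows "partial_deriv n (\<lambda>p. f p + g p) p = partial_deriv n f p + partial_deriv n g p"
  using partial_deriv_eqI[OF has_derivative_add[OF smooth_on_has_derivative[OF assms(1,3)]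
    smooth_on_has_derivative[OF assms(2,3)]]] by (simp add: partial_deriv_def)

lemma partial_deriv_mult:
  assumes "smooth_on S f" "smooth_on S g" "p \<in> S"
  shows "partial_deriv n (\<lambda>p. f p * g p) p = partial_deriv n f p * g p + f p * partial_deriv n g p"
  using partial_deriv_eqI[OF has_derivative_mult[OF smooth_on_has_derivative[OF assms(1,3)]
    smooth_on_has_derivative[OF assms(2,3)]]] by (simp add: partial_deriv_def)

lemma taylor_coeff_0: "coeff3 (taylor f) 0 0 0 = f 0"
  by (simp add: taylor_def)

text \<open>
  Here and for products, both sides have the same constant term and obey the same rule for
  partial derivatives, so their coefficients agree by induction on the degree.
\<close>

lemma taylor_add:
  assumes "smooth_on S f" "smooth_on S g"
  shows "taylor (\<lambda>p. f p + g p) = taylor f + taylor g"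
proof (rule fps3_eqI)
  fix i j k
  have "coeff3 (taylor (\<lambda>p. f p + g p)) i j k = coeff3 (taylor f + taylor g) i j k" if "i + j + k = m" for m
    using assms that
  proof (induction m arbitrary: f g i j k)
    case 0
    then show ?case by (simp add: taylor_coeff_0)
  next
    case (Suc m)
    have n: "coeff3 (fpartial n (taylor (\<lambda>p. f p + g p))) i j k = coeff3 (fpartial n (taylor f + taylor g)) i j k"
      if "i + j + k = m" for n i j k
    proof -
      have "fpartial n (taylor (\<lambda>p. f p + g p)) = taylor (\<lambda>p. partial_deriv n f p + partial_deriv n g p)"
        unfolding taylor_partial_deriv[OF smooth_on_add[OF S Suc.prems(1,2)], symmetric]
        by (rule taylor_cong) (rule partial_deriv_add[OF Suc.prems(1,2)])
      then show ?thesis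
        using Suc.IH[OF smooth_on_partial_deriv[OF Suc.prems(1)] smooth_on_partial_deriv[OF Suc.prems(2)] that, of n n]
        by (simp add: taylor_partial_deriv Suc.prems derivation_add[OF derivation_fpartial])
    qed
    consider a where "i = Suc a" | b where "j = Suc b" | c where "k = Suc c"
      using Suc.prems(3) by (cases i; cases j; cases k) auto
    then show ?case
    proof cases
      case 1 then show ?thesis using n[of a j k 1] Suc.prems(3)
        by (simp add: fpartial_def distrib_left[symmetric] del: of_nat_Suc)
    next
      case 2 then show ?thesis using n[of i b k 2] Suc.prems(3)
        by (simp add: fpartial_def distrib_left[symmetric] del: of_nat_Suc)
    next
      case 3 then show ?thesis using n[of i j c 3] Suc.prems(3)
        by (simp add: fpartial_def distrib_left[symmetric] del: of_nat_Suc)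
    qed
  qed
  then show "coeff3 (taylor (\<lambda>p. f p + g p)) i j k = coeff3 (taylor f + taylor g) i j k" by blast
qed

lemma taylor_mult:
  assumes "smooth_on S f" "smooth_on S g"
  shows "taylor (\<lambda>p. f p * g p) = taylor f * taylor g"
proof (rule fps3_eqI)
  fix i j k
  have "coeff3 (taylor (\<lambda>p. f p * g p)) i j k = coeff3 (taylor f * taylor g) i j k" if "i + j + k = m" for m
    using assms that
  proof (induction m arbitrary: f g i j k)
    case 0
    then show ?case using taylor_coeff_0 by (simp add: coeff3_def)
  next
    case (Suc m)
    note fg = Suc.prems(1,2)
    have n: "coeff3 (fpartial n (taylor (\<lambda>p. f p * g p))) i j k = coeff3 (fpartial n (taylor f * taylor g)) i j k"
      if "i + j + k = m" for n i j k
    proof -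
      note d = smooth_on_partial_deriv[OF fg(1), of n] smooth_on_partial_deriv[OF fg(2), of n]
      have "fpartial n (taylor (\<lambda>p. f p * g p)) = taylor (\<lambda>p. partial_deriv n f p * g p + f p * partial_deriv n g p)"
        unfolding taylor_partial_deriv[OF smooth_on_mult[OF S fg], symmetric]
        by (rule taylor_cong) (rule partial_deriv_mult[OF fg])
      also have "\<dots> = taylor (\<lambda>p. partial_deriv n f p * g p) + taylor (\<lambda>p. f p * partial_deriv n g p)"
        by (intro taylor_add smooth_on_mult[OF S] d fg)
      finally show ?thesis
        using Suc.IH[OF d(1) fg(2) that] Suc.IH[OF fg(1) d(2) that]
        by (simp add: taylor_partial_deriv fg derivation_mult[OF derivation_fpartial])
    qed
    consider a where "i = Suc a" | b where "j = Suc b" | c where "k = Suc c"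
      using Suc.prems(3) by (cases i; cases j; cases k) auto
    then show ?case
    proof cases
      case 1 then show ?thesis using n[of a j k 1] Suc.prems(3)
        by (simp add: fpartial_def del: of_nat_Suc)
    next
      case 2 then show ?thesis using n[of i b k 2] Suc.prems(3)
        by (simp add: fpartial_def del: of_nat_Suc)
    next
      case 3 then show ?thesis using n[of i j c 3] Suc.prems(3)
        by (simp add: fpartial_def del: of_nat_Suc)
    qed
  qed
  then show "coeff3 (taylor (\<lambda>p. f p * g p)) i j k = coeff3 (taylor f * taylor g) i j k" by blast
qed

lemma taylor_const: "taylor (\<lambda>_. c) = fps_const (fps_const (fps_const c))"
proof -
  have d: "partial_deriv n (\<lambda>_. c) = (\<lambda>_. 0)" for n and c :: real
    using partial_deriv_eqI[OF has_derivative_const] by blast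
  have z: "(partial_deriv n ^^ i) (\<lambda>_. 0) = (\<lambda>_. 0)" for n i
    by (induction i) (simp_all add: d)
  have c: "(partial_deriv n ^^ i) (\<lambda>_. c) = (if i = 0 then \<lambda>_. c else (\<lambda>_. 0))" for n i
    by (cases i) (simp_all add: funpow_swap1 d z)
  show ?thesis
    by (rule fps3_eqI) (simp add: taylor_def c z, simp add: coeff3_def)
qed

lemma taylor_coordinate: "taylor (\<lambda>p. p $ m) = fvar m"
proof (rule fps3_eqI_partials)
  have bl: "bounded_linear (\<lambda>p::real^3. p $ m)" by (rule bounded_linear_vec_nth)
  show "coeff3 (taylor (\<lambda>p. p $ m)) 0 0 0 = coeff3 (fvar m) 0 0 0"
    by (simp add: taylor_coeff_0) (simp add: coeff3_def fvar_def)
  fix n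
  have "partial_deriv n (\<lambda>p. p $ m) = (\<lambda>_. axis n 1 $ m)"
    using partial_deriv_eqI[OF bounded_linear_imp_has_derivative[OF bl]] by blast
  then show "fpartial n (taylor (\<lambda>p. p $ m)) = fpartial n (fvar m)"
    by (simp add: taylor_partial_deriv[OF smooth_on_bounded_linear[OF S bl], symmetric]
        taylor_const fpartial_fvar axis_def)
qed

end

section \<open>Straightening a function\<close>

text \<open>
  The map \<open>f x = x + (C x - x \<bullet> k) k\<close> replaces the coordinate along \<open>k\<close> by \<open>C\<close>. Its derivative is
  invertible where the derivative \<open>D C k\<close> of \<open>C\<close> in direction \<open>k\<close> does not vanish, with inverse
  \<open>h \<mapsto> h + ((h \<bullet> k - D C h) / D C k) k\<close>. Hence the derivative of the local inverse \<open>g\<close> is a smooth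
  expression in \<open>g\<close>, and smoothness of \<open>g\<close> follows by raising the order of differentiability
  one by one.
\<close>

lemma straighten_function:
  fixes C :: "'a::euclidean_space \<Rightarrow> real"
  assumes N: "open N" "0 \<in> N" and C: "smooth_on N C" and C0: "C 0 = 0"
    and k: "k \<bullet> k = 1" and Dk: "frechet_derivative C (at 0) k \<noteq> 0"
  obtains M g N' where "open M" "0 \<in> M" "smooth_on M g" "g 0 = 0" "open N'" "0 \<in> N'" "N' \<subseteq> N"
    "\<And>y. y \<in> M \<Longrightarrow> g y \<in> N" "\<And>y. y \<in> M \<Longrightarrow> C (g y) = y \<bullet> k"
    "\<And>y. y \<in> M \<Longrightarrow> g y = y + (g y \<bullet> k - y \<bullet> k) *\<^sub>R k"
    "\<And>y. y \<in> M \<Longrightarrow> frechet_derivative C (at (g y)) k \<noteq> 0"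
    "\<And>y. y \<in> M \<Longrightarrow> frechet_derivative g (at y) k = inverse (frechet_derivative C (at (g y)) k) *\<^sub>R k"
    "\<And>x. x \<in> N' \<Longrightarrow> x + (C x - x \<bullet> k) *\<^sub>R k \<in> M \<and> g (x + (C x - x \<bullet> k) *\<^sub>R k) = x"
proof -
  define D where "D x = frechet_derivative C (at x)" for x
  define f where "f x = x + (C x - x \<bullet> k) *\<^sub>R k" for x
  define F where "F x = Blinfun (\<lambda>h. h + (D x h - h \<bullet> k) *\<^sub>R k)" for x
  have DC: "(C has_derivative D x) (at x)" if "x \<in> N" for x
    unfolding D_def by (rule smooth_on_has_derivative[OF C that])
  have linD: "bounded_linear (D x)" if "x \<in> N" for x
    using DC[OF that] has_derivative_bounded_linear by blast
  have F: "blinfun_apply (F x) = (\<lambda>h. h + (D x h - h \<bullet> k) *\<^sub>R k)" if "x \<in> N" for x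
    unfolding F_def
    by (rule bounded_linear_Blinfun_apply)
      (intro bounded_linear_add bounded_linear_ident bounded_linear_scaleR_const bounded_linear_sub linD that
        bounded_linear_inner_left)
  define N1 where "N1 = N \<inter> (\<lambda>x. D x k) -` (- {0})"
  have openN1: "open N1" unfolding N1_def D_def
    by (rule continuous_open_preimage[OF smooth_on_continuous[OF smooth_on_directional[OF C]] N(1)])
      (rule open_Compl[OF closed_singleton])
  have N1: "x \<in> N" "D x k \<noteq> 0" if "x \<in> N1" for x using that by (auto simp: N1_def)
  have derf: "(f has_derivative blinfun_apply (F x)) (at x)" if "x \<in> N1" for x
    unfolding F[OF N1(1)[OF that]] f_def
    by (auto intro!: derivative_eq_intros DC N1 that)
  have "continuous_on N (\<lambda>x. blinfun_apply (F x) i)" for i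
  proof -
    have "continuous_on N (\<lambda>x. i + (D x i - i \<bullet> k) *\<^sub>R k)"
      unfolding D_def by (intro continuous_intros smooth_on_continuous smooth_on_directional C)
    then show ?thesis using F by simp
  qed
  then have contF: "continuous_on N1 F"
    by (intro continuous_on_blinfun_componentwise) (auto simp: N1_def intro: continuous_on_subset)
  define I where "I = Blinfun (\<lambda>y. y + ((y \<bullet> k - D 0 y) * inverse (D 0 k)) *\<^sub>R k)"
  have I: "blinfun_apply I = (\<lambda>y. y + ((y \<bullet> k - D 0 y) * inverse (D 0 k)) *\<^sub>R k)"
    unfolding I_def
    by (rule bounded_linear_Blinfun_apply)
      (intro bounded_linear_add bounded_linear_ident bounded_linear_scaleR_const bounded_linear_mult_const
        bounded_linear_sub linD N bounded_linear_inner_left)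
  have D0: "D 0 k \<noteq> 0" using Dk by (simp add: D_def)
  have D_line: "D x (h + s *\<^sub>R k) = D x h + s * D x k" if "x \<in> N" for x h s
    using linear_add[OF bounded_linear.linear[OF linD[OF that]]]
      linear_scale[OF bounded_linear.linear[OF linD[OF that]]] by simp
  have inv: "I o\<^sub>L F 0 = id_blinfun"
  proof (rule blinfun_eqI)
    fix h
    have "(h + (D 0 h - h \<bullet> k) *\<^sub>R k) \<bullet> k = D 0 h" using k by (simp add: inner_add_left)
    moreover have "(D 0 h - (D 0 h + (D 0 h - h \<bullet> k) * D 0 k)) * inverse (D 0 k) = - (D 0 h - h \<bullet> k)"
      using D0 by (simp add: field_simps)
    ultimately show "blinfun_apply (I o\<^sub>L F 0) h = blinfun_apply id_blinfun h"
      by (simp add: I F[OF N(2)] D_line[OF N(2)] flip: scaleR_add_left)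
  qed
  have "0 \<in> N1" using N D0 by (simp add: N1_def)
  obtain U' V g g' where U': "open U'" "U' \<subseteq> N1" "0 \<in> U'" and V: "open V" "f 0 \<in> V"
    and hom: "homeomorphism U' V f g" and g': "\<And>y. y \<in> V \<Longrightarrow> (g has_derivative g' y) (at y)"
  proof (rule inverse_function_theorem[OF openN1 derf contF \<open>0 \<in> N1\<close> inv])
    fix U' V g g'
    assume "open U'" "U' \<subseteq> N1" "0 \<in> U'" "open V" "f 0 \<in> V" "homeomorphism U' V f g"
      and "\<And>y. y \<in> V \<Longrightarrow> (g has_derivative g' y) (at y)"
    then show thesis by (rule that)
  qed
  have f0: "f 0 = 0" by (simp add: f_def C0)
  have gU: "g y \<in> U'" and fg: "f (g y) = y" if "y \<in> V" for y
    using hom that unfolding homeomorphism_def by auto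
  have gf: "f x \<in> V" "g (f x) = x" if "x \<in> U'" for x
    using hom that unfolding homeomorphism_def by auto
  have gN: "g y \<in> N1" "g y \<in> N" if "y \<in> V" for y
    using gU[OF that] U'(2) N1(1) by auto
  have Cg: "C (g y) = y \<bullet> k" if "y \<in> V" for y
    using arg_cong[OF fg[OF that], of "\<lambda>x. x \<bullet> k"] k by (simp add: f_def inner_add_left)
  have gy: "g y = y + (g y \<bullet> k - y \<bullet> k) *\<^sub>R k" if "y \<in> V" for y
    using fg[OF that] Cg[OF that] by (simp add: f_def algebra_simps)
  have Dg: "g' y h = h + ((h \<bullet> k - D (g y) h) * inverse (D (g y) k)) *\<^sub>R k" if y: "y \<in> V" for y h
  proof -
    have "((\<lambda>y. f (g y)) has_derivative (\<lambda>h. blinfun_apply (F (g y)) (g' y h))) (at y)"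
      by (rule has_derivative_compose[OF g'[OF y] derf[OF gN(1)[OF y]]])
    moreover have "((\<lambda>y. f (g y)) has_derivative (\<lambda>h. h)) (at y)"
      by (rule has_derivative_transform_within_open[OF has_derivative_ident V(1) y]) (simp add: fg)
    ultimately have "blinfun_apply (F (g y)) (g' y h) = h"
      using has_derivative_unique by metis
    then have h: "g' y h + (D (g y) (g' y h) - g' y h \<bullet> k) *\<^sub>R k = h"
      by (simp add: F[OF gN(2)[OF y]])
    define t where "t = g' y h \<bullet> k - D (g y) (g' y h)"
    have g'h: "g' y h = h + t *\<^sub>R k" using h by (simp add: t_def algebra_simps)
    have "D (g y) (g' y h) = h \<bullet> k"
      using arg_cong[OF h, of "\<lambda>x. x \<bullet> k"] k by (simp add: inner_add_left)
    then have "D (g y) h + t * D (g y) k = h \<bullet> k"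
      unfolding g'h D_line[OF gN(2)[OF y]] .
    then have "t = (h \<bullet> k - D (g y) h) * inverse (D (g y) k)"
      using N1(2)[OF gN(1)[OF y]] by (simp add: field_simps)
    then show ?thesis using g'h by simp
  qed
  have "C_k_on n V g" for n
  proof (induction n)
    case 0
    then show ?case using hom by (simp add: homeomorphism_def)
  next
    case (Suc n)
    have comp: "C_k_on n V (\<lambda>y. D (g y) h)" for h
    proof (rule C_k_on_compose[OF V(1) N(1) _ _ Suc])
      show "g ` V \<subseteq> N" using gN by auto
      show "C_k_on n N (\<lambda>x. D x h)"
        using smooth_on_directional[OF C, of h] by (simp add: smooth_on_def D_def)
    qed
    show ?case
    proof (rule C_k_on_SucI[OF V(1) g'], assumption)
      fix h
      have "C_k_on n V (\<lambda>y. h + ((h \<bullet> k + (-1) * D (g y) h) * inverse (D (g y) k)) *\<^sub>R k)"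
        using N1(2)[OF gN(1)]
        by (intro C_k_on_add[OF V(1)] C_k_on_bilinear[OF bounded_bilinear_mult V(1)] C_k_on_const[OF V(1)]
            C_k_on_bilinear[OF bounded_bilinear_scaleR V(1)] comp C_k_on_inverse[OF V(1)])
      then show "C_k_on n V (\<lambda>y. g' y h)"
        by (subst C_k_on_cong[OF V(1), of _ "\<lambda>y. h + ((h \<bullet> k + (-1) * D (g y) h) * inverse (D (g y) k)) *\<^sub>R k"])
          (simp_all add: Dg)
    qed
  qed
  then have smooth: "smooth_on V g" by (simp add: smooth_on_def)
  show thesis
  proof (rule that[of V g U'])
    fix y assume y: "y \<in> V"
    have "frechet_derivative g (at y) = g' y" using frechet_derivative_at[OF g'[OF y]] by simp
    then show "frechet_derivative g (at y) k = inverse (frechet_derivative C (at (g y)) k) *\<^sub>R k"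
      using N1(2)[OF gN(1)[OF y]] Dg[OF y, of k] k
      by (simp add: D_def left_diff_distrib scaleR_diff_left)
    show "frechet_derivative C (at (g y)) k \<noteq> 0" using N1(2)[OF gN(1)[OF y]] by (simp add: D_def)
  next
    show "0 \<in> V" using V f0 by simp
    show "g 0 = 0" using gf(2)[OF U'(3)] f0 by simp
    show "U' \<subseteq> N" using U'(2) N1(1) by auto
  next
    fix x assume "x \<in> U'"
    then show "x + (C x - x \<bullet> k) *\<^sub>R k \<in> V \<and> g (x + (C x - x \<bullet> k) *\<^sub>R k) = x"
      using gf by (simp add: f_def)
  qed (use V U' smooth gN Cg gy in auto)
qed

section \<open>Linear algebra of the 1-jet\<close>

lemma dcoord_apply [simp]: "blinfun_apply (dcoord i) v = v $ i"
  by (simp add: dcoord_def blinfun_inner_right.rep_eq inner_axis')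

lemma vec3_expand: "(u::real^3) = u $ 1 *\<^sub>R axis 1 1 + u $ 2 *\<^sub>R axis 2 1 + u $ 3 *\<^sub>R axis 3 1"
  by (simp add: vec_eq_iff forall_3 axis_def)

lemma linear_bij_with_third_column:
  fixes v :: "real^3"
  assumes "v \<noteq> 0"
  obtains L :: "real^3 \<Rightarrow> real^3" where "linear L" "bij L" "L (axis 3 1) = v"
proof -
  have "norm (norm v *\<^sub>R axis 3 1 :: real^3) = norm v" by simp
  then obtain f :: "real^3 \<Rightarrow> real^3" where f: "orthogonal_transformation f" "f (norm v *\<^sub>R axis 3 1) = v"
    using orthogonal_transformation_exists by metis
  define L where "L x = f (norm v *\<^sub>R x)" for x
  have lf: "linear f" using f(1) orthogonal_transformation_linear by blast
  have "linear L" unfolding L_def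
    by (rule linearI) (simp_all add: scaleR_add_right linear_add[OF lf] linear_scale[OF lf])
  moreover have "inj L"
  proof (rule injI)
    fix x y assume "L x = L y"
    then have "norm v *\<^sub>R x = norm v *\<^sub>R y"
      unfolding L_def by (rule injD[OF orthogonal_transformation_inj[OF f(1)]])
    then show "x = y" using assms by simp
  qed
  ultimately show thesis
    using that[of L] f(2) linear_inj_imp_surj[of L] by (auto simp: bij_def L_def)
qed

lemma alternating_antisym:
  fixes B :: "'a::real_vector \<Rightarrow> 'a \<Rightarrow> real"
  assumes l: "\<And>v. linear (\<lambda>u. B u v)" and r: "\<And>u. linear (B u)" and alt: "\<And>v. B v v = 0"
  shows "B a b = - B b a"
proof -
  have "B (a + b) (a + b) = B a b + B b a + (B a a + B b b)"
    unfolding linear_add[OF l] linear_add[OF r] by simp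
  then have "B a b + B b a = 0" unfolding alt by simp
  then show ?thesis by simp
qed

lemma alternating_expand:
  fixes B :: "real^3 \<Rightarrow> real^3 \<Rightarrow> real"
  assumes l: "\<And>v. linear (\<lambda>u. B u v)" and r: "\<And>u. linear (B u)" and alt: "\<And>v. B v v = 0"
  shows "B u v = (u $ 1 * v $ 2 - u $ 2 * v $ 1) * B (axis 1 1) (axis 2 1) +
    (u $ 2 * v $ 3 - u $ 3 * v $ 2) * B (axis 2 1) (axis 3 1) +
    (u $ 3 * v $ 1 - u $ 1 * v $ 3) * B (axis 3 1) (axis 1 1)"
proof -
  note add = linear_add[OF l] linear_add[OF r] and scale = linear_scale[OF l] linear_scale[OF r]
  note anti = alternating_antisym[OF l r alt]
  have "B u v = B (u $ 1 *\<^sub>R axis 1 1 + u $ 2 *\<^sub>R axis 2 1 + u $ 3 *\<^sub>R axis 3 1)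
      (v $ 1 *\<^sub>R axis 1 1 + v $ 2 *\<^sub>R axis 2 1 + v $ 3 *\<^sub>R axis 3 1)"
    using vec3_expand[of u] vec3_expand[of v] by simp
  also have "\<dots> = (u $ 1 * v $ 2) * B (axis 1 1) (axis 2 1) + (u $ 2 * v $ 1) * B (axis 2 1) (axis 1 1) +
    (u $ 2 * v $ 3) * B (axis 2 1) (axis 3 1) + (u $ 3 * v $ 2) * B (axis 3 1) (axis 2 1) +
    (u $ 3 * v $ 1) * B (axis 3 1) (axis 1 1) + (u $ 1 * v $ 3) * B (axis 1 1) (axis 3 1)"
    unfolding add scale by (simp add: alt algebra_simps)
  also have "B (axis 2 1) (axis 1 1) = - B (axis 1 1) (axis 2 1)" by (rule anti)
  also have "B (axis 3 1) (axis 2 1) = - B (axis 2 1) (axis 3 1)" by (rule anti)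
  also have "B (axis 1 1) (axis 3 1) = - B (axis 3 1) (axis 1 1)" by (rule anti)
  finally show ?thesis by (simp add: algebra_simps)
qed

text \<open>
  An alternating form on a space of dimension three has a kernel vector, namely the vector \<open>c\<close>
  with \<open>B u v = c \<bullet> (u \<times> v)\<close>. If it is nonzero, taking it as the third basis vector leaves only one
  coefficient; otherwise \<open>B\<close> vanishes.
\<close>

lemma alternating_is_rotation:
  fixes B :: "real^3 \<Rightarrow> real^3 \<Rightarrow> real"
  assumes l: "\<And>v. linear (\<lambda>u. B u v)" and r: "\<And>u. linear (B u)" and alt: "\<And>v. B v v = 0"
  obtains L :: "real^3 \<Rightarrow> real^3" and a where "linear L" "bij L" "\<And>u v. B (L u) (L v) = a * (u $ 1 * v $ 2 - u $ 2 * v $ 1)"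
proof -
  define c :: "real^3" where
    "c = vector [B (axis 2 1) (axis 3 1), B (axis 3 1) (axis 1 1), B (axis 1 1) (axis 2 1)]"
  note expand = alternating_expand[OF l r alt]
  have kernel: "B c v = 0" for v
    by (subst expand) (simp add: c_def algebra_simps)
  show thesis
  proof (cases "c = 0")
    case True
    then have "B (axis 2 1) (axis 3 1) = 0" "B (axis 3 1) (axis 1 1) = 0" "B (axis 1 1) (axis 2 1) = 0"
      unfolding c_def by (auto simp: vec_eq_iff forall_3)
    then have "B u v = 0" for u v by (subst expand) simp
    then show ?thesis by (intro that[of id 0]) (simp_all add: linear_id)
  next
    case False
    obtain L :: "real^3 \<Rightarrow> real^3" where L: "linear L" "bij L" "L (axis 3 1) = c"
      by (rule linear_bij_with_third_column[OF False])
    have l': "linear (\<lambda>u. B (L u) (L v))" for v using linear_compose[OF L(1) l[of "L v"]] by (simp add: o_def)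
    have r': "linear (\<lambda>v. B (L u) (L v))" for u using linear_compose[OF L(1) r[of "L u"]] by (simp add: o_def)
    have anti: "B v c = 0" for v
      using alternating_antisym[OF l r alt, of v c] kernel by simp
    have "B (L u) (L v) = B (L (axis 1 1)) (L (axis 2 1)) * (u $ 1 * v $ 2 - u $ 2 * v $ 1)" for u v
      using alternating_expand[of "\<lambda>u v. B (L u) (L v)" u v, OF l' r' alt] by (simp add: L(3) kernel anti)
    then show ?thesis by (rule that[OF L(1,2)])
  qed
qed

text \<open>
  Were the linear part alternating, it would be equivalent to a multiple of the rotation form.
\<close>

lemma linear_part_not_alternating:
  fixes \<omega> :: one_form
  assumes d: "\<omega> differentiable at 0" and 0: "\<omega> 0 = 0"
    and rot: "\<not> (\<exists>a. linearly_equivalent (jet1 \<omega>) (rotation_form a))"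
  obtains v where "blinfun_apply (frechet_derivative \<omega> (at 0) v) v \<noteq> 0"
proof (rule ccontr)
  assume "\<not> thesis"
  then have alt: "blinfun_apply (frechet_derivative \<omega> (at 0) v) v = 0" for v using that by blast
  let ?B = "\<lambda>u v. blinfun_apply (frechet_derivative \<omega> (at 0) u) v"
  have lin: "linear (frechet_derivative \<omega> (at 0))"
    using d frechet_derivative_works has_derivative_linear by blast
  have l: "linear (\<lambda>u. ?B u v)" for v
    by (rule linearI) (simp_all add: linear_add[OF lin] linear_scale[OF lin] blinfun.add_left blinfun.scaleR_left)
  have r: "linear (?B u)" for u
    by (simp add: blinfun.bounded_linear_right bounded_linear.linear)
  obtain L :: "real^3 \<Rightarrow> real^3" and a where L: "linear L" "bij L" and B: "\<And>u v. ?B (L u) (L v) = a * (u $ 1 * v $ 2 - u $ 2 * v $ 1)"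
  proof (rule alternating_is_rotation[of ?B, OF l r alt])
    fix L :: "real^3 \<Rightarrow> real^3" and a
    assume "linear L" "bij L" and "\<And>u v. ?B (L u) (L v) = a * (u $ 1 * v $ 2 - u $ 2 * v $ 1)"
    then show thesis by (rule that)
  qed
  have bL: "bounded_linear L" using L(1) linear_conv_bounded_linear by blast
  have "frechet_derivative L (at p) = L" for p
    using frechet_derivative_at[OF bounded_linear_imp_has_derivative[OF bL]] by simp
  then have "pullback L (jet1 \<omega>) = rotation_form a"
    by (intro ext blinfun_eqI)
      (simp add: pullback_def jet1_def 0 bounded_linear_Blinfun_apply[OF bL] B rotation_form_def
        blinfun.scaleR_left blinfun.diff_left)
  then show False using rot L by (auto simp: linearly_equivalent_def)
qed

section \<open>Integrability under pullback and rescaling\<close>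

text \<open>
  The second derivatives of \<open>\<phi>\<close> are symmetric and cancel in the exterior derivative. The derivative of \<open>k\<close>
  enters through \<open>dk \<and> \<phi>\<^sup>*\<omega>\<close>, whose product with \<open>\<phi>\<^sup>*\<omega>\<close> vanishes.
\<close>

lemma integrable_form_transfer:
  fixes \<eta> \<omega> :: one_form
  assumes S: "open S" "p \<in> S" and \<eta>: "\<eta> differentiable at p"
    and eq: "\<And>q v. q \<in> S \<Longrightarrow> blinfun_apply (\<eta> q) v = k q * blinfun_apply (\<omega> (\<phi> q)) (frechet_derivative \<phi> (at q) v)"
    and k: "smooth_on S k" and \<phi>: "smooth_on S \<phi>" and \<omega>: "\<omega> differentiable at (\<phi> p)"
    and int: "integrable_form_at \<omega> (\<phi> p)"
  shows "integrable_form_at \<eta> p"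
proof -
  let ?\<phi>' = "frechet_derivative \<phi> (at p)" and ?k' = "frechet_derivative k (at p)"
  let ?\<omega>' = "frechet_derivative \<omega> (at (\<phi> p))"
  let ?\<phi>'' = "\<lambda>v u. frechet_derivative (\<lambda>q. frechet_derivative \<phi> (at q) v) (at p) u"
  let ?w = "\<lambda>v. blinfun_apply (\<omega> (\<phi> p)) (?\<phi>' v)"
  have d\<omega>: "(\<omega> has_derivative ?\<omega>') (at (\<phi> p))"
    using \<omega> by (simp add: frechet_derivative_works)
  have d\<eta>: "blinfun_apply (frechet_derivative \<eta> (at p) u) v =
      k p * (blinfun_apply (\<omega> (\<phi> p)) (?\<phi>'' v u) + blinfun_apply (?\<omega>' (?\<phi>' u)) (?\<phi>' v)) + ?k' u * ?w v" for u v
  proof -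
    have 1: "((\<lambda>q. blinfun_apply (\<eta> q) v) has_derivative (\<lambda>u. blinfun_apply (frechet_derivative \<eta> (at p) u) v)) (at p)"
      by (rule bounded_linear.has_derivative[OF blinfun.bounded_linear_left])
        (use \<eta> in \<open>simp add: frechet_derivative_works\<close>)
    have "((\<lambda>q. k q * blinfun_apply (\<omega> (\<phi> q)) (frechet_derivative \<phi> (at q) v)) has_derivative
      (\<lambda>u. k p * (blinfun_apply (\<omega> (\<phi> p)) (?\<phi>'' v u) + blinfun_apply (?\<omega>' (?\<phi>' u)) (?\<phi>' v)) + ?k' u * ?w v)) (at p)"
      by (rule has_derivative_mult[OF smooth_on_has_derivative[OF k S(2)]
            bounded_bilinear.FDERIV[OF bounded_bilinear_blinfun_apply
              has_derivative_compose[OF smooth_on_has_derivative[OF \<phi> S(2)] d\<omega>]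
              smooth_on_has_derivative[OF smooth_on_directional[OF \<phi>] S(2)]]])
    then have "((\<lambda>q. blinfun_apply (\<eta> q) v) has_derivative
      (\<lambda>u. k p * (blinfun_apply (\<omega> (\<phi> p)) (?\<phi>'' v u) + blinfun_apply (?\<omega>' (?\<phi>' u)) (?\<phi>' v)) + ?k' u * ?w v)) (at p)"
      by (rule has_derivative_transform_within_open[OF _ S]) (simp add: eq)
    from has_derivative_unique[OF 1 this] show ?thesis by metis
  qed
  have sym: "?\<phi>'' u v = ?\<phi>'' v u" for u v
    by (rule symmetric_second_derivative[OF S(1) \<phi> S(2)])
  have ext: "ext_deriv \<eta> p u v = k p * ext_deriv \<omega> (\<phi> p) (?\<phi>' u) (?\<phi>' v) + ?k' u * ?w v - ?k' v * ?w u" for u v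
    unfolding ext_deriv_def d\<eta> sym[of u v] by (simp add: algebra_simps)
  show ?thesis
    unfolding integrable_form_at_def
  proof (intro allI)
    fix u v w
    have "wedge12 (\<eta> p) (ext_deriv \<eta> p) u v w =
        k p * k p * wedge12 (\<omega> (\<phi> p)) (ext_deriv \<omega> (\<phi> p)) (?\<phi>' u) (?\<phi>' v) (?\<phi>' w)"
      unfolding wedge12_def ext eq[OF S(2)] by (simp add: algebra_simps)
    then show "wedge12 (\<eta> p) (ext_deriv \<eta> p) u v w = 0"
      using int by (simp add: integrable_form_at_def)
  qed
qed

section \<open>Families of functions and their fibers\<close>

lemma fiber_has_derivative:
  assumes "((\<lambda>(e, p). f e p) has_derivative D) (at (e, p))"
  shows "(f e has_derivative (\<lambda>v. D (0, v))) (at p)"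
proof -
  have "((\<lambda>p. (e, p)) has_derivative (\<lambda>v. (0, v))) (at p)"
    by (auto intro!: derivative_eq_intros)
  from has_derivative_compose[OF this assms] show ?thesis by simp
qed

lemma smooth_on_fiber:
  fixes f :: "'a::euclidean_space \<Rightarrow> 'b::euclidean_space \<Rightarrow> 'c::real_normed_vector"
  assumes "open N" "smooth_on N (\<lambda>(e, p). f e p)" "open B" "{e} \<times> B \<subseteq> N"
  shows "smooth_on B (f e)"
proof -
  have "(\<lambda>p. (e, p)) ` B \<subseteq> N" using assms(4) by auto
  from smooth_on_compose[OF assms(3,1) this assms(2) smooth_on_Pair[OF assms(3)
    smooth_on_const[OF assms(3)] smooth_on_bounded_linear[OF assms(3) bounded_linear_ident]]]
  show ?thesis by simp
qed

lemma smooth_on_fiber_base: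
  fixes f :: "'a::euclidean_space \<Rightarrow> 'b::euclidean_space \<Rightarrow> 'c::real_normed_vector"
  assumes "open N" "smooth_on N (\<lambda>(e, p). f e p)" "open W" "W \<times> {p} \<subseteq> N"
  shows "smooth_on W (\<lambda>e. f e p)"
proof -
  have "(\<lambda>e. (e, p)) ` W \<subseteq> N" using assms(4) by auto
  from smooth_on_compose[OF assms(3,1) this assms(2) smooth_on_Pair[OF assms(3)
    smooth_on_bounded_linear[OF assms(3) bounded_linear_ident] smooth_on_const[OF assms(3)]]]
  show ?thesis by simp
qed

lemma smooth_on_partial_deriv_family:
  fixes f :: "real^'l \<Rightarrow> real^3 \<Rightarrow> real"
  assumes N: "open N" and f: "smooth_on N (\<lambda>(e, p). f e p)"
  shows "smooth_on N (\<lambda>(e, p). (partial_deriv n ^^ i) (f e) p)"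
proof (induction i)
  case (Suc i)
  let ?h = "\<lambda>e. (partial_deriv n ^^ i) (f e)"
  have "partial_deriv n (?h e) p = frechet_derivative (\<lambda>(e, p). ?h e p) (at (e, p)) (0, axis n 1)"
    if "(e, p) \<in> N" for e p
    by (rule partial_deriv_eqI[OF fiber_has_derivative[OF smooth_on_has_derivative[OF Suc that]]])
  then have "smooth_on N (\<lambda>(e, p). (partial_deriv n ^^ Suc i) (f e) p) \<longleftrightarrow>
      smooth_on N (\<lambda>y. frechet_derivative (\<lambda>(e, p). ?h e p) (at y) (0, axis n 1))"
    by (intro smooth_on_cong[OF N]) auto
  then show ?case
    using smooth_on_directional[OF Suc, of "(0, axis n 1)"] by blast
qed (simp add: f)

lemma smooth_coeffs3_taylor:
  fixes f :: "real^'l \<Rightarrow> real^3 \<Rightarrow> real"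
  assumes W: "open W" and B: "open B" "0 \<in> B" and f: "smooth_on (W \<times> B) (\<lambda>(e, p). f e p)"
  shows "smooth_coeffs3 W (\<lambda>e. taylor (f e))"
  unfolding smooth_coeffs3_def
proof (intro allI)
  fix i j k
  let ?h = "\<lambda>e. (partial_deriv 1 ^^ i) ((partial_deriv 2 ^^ j) ((partial_deriv 3 ^^ k) (f e)))"
  have WB: "open (W \<times> B)" by (rule open_Times[OF W B(1)])
  have "smooth_on (W \<times> B) (\<lambda>(e, p). ?h e p)"
    by (intro smooth_on_partial_deriv_family WB f)
  then have "smooth_on W (\<lambda>e. ?h e 0)"
    by (rule smooth_on_fiber_base[OF WB _ W]) (use B in auto)
  from smooth_on_mult[OF W this smooth_on_const[OF W, of "inverse (fact i * fact j * fact k)"]]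
  show "smooth_on W (\<lambda>e. coeff3 (taylor (f e)) i j k)"
    by (simp add: taylor_def divide_inverse)
qed

subsection \<open>Taylor series of the forms \<open>z dz + U dx + V dy\<close>\<close>

lemma prenormal_form_axis:
  "blinfun_apply (prenormal_form U V p) (axis 1 1) = U p"
  "blinfun_apply (prenormal_form U V p) (axis 2 1) = V p"
  "blinfun_apply (prenormal_form U V p) (axis 3 1) = p $ 3"
  by (simp_all add: prenormal_form_def blinfun.add_left blinfun.scaleR_left axis_def)

lemma smooth_on_prenormal_form:
  assumes "open B" "smooth_on B U" "smooth_on B V"
  shows "smooth_on B (prenormal_form U V)"
  unfolding prenormal_form_def[abs_def]
  by (intro smooth_on_add smooth_on_bilinear[OF bounded_bilinear_scaleR] smooth_on_const assms
      smooth_on_bounded_linear[OF _ bounded_linear_vec_nth])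

lemma taylor_form_prenormal_form:
  "taylor_form (prenormal_form U V) = vector [taylor U, taylor V, fps_X]"
  unfolding vec_eq_iff forall_3
  by (simp add: taylor_form_def prenormal_form_axis taylor_coordinate[OF open_UNIV] fvar_3)

text \<open>
  Taking Taylor series is a homomorphism of differential rings, so it may be applied to the
  equation of integrability.
\<close>

lemma integrability_taylor_form:
  assumes B: "open B" "0 \<in> B" and U: "smooth_on B U" and V: "smooth_on B V"
    and int: "\<And>p. p \<in> B \<Longrightarrow> integrable_form_at (prenormal_form U V) p"
  shows "integrability (taylor_form (prenormal_form U V)) = 0"
proof -
  let ?z = "\<lambda>p::real^3. p $ 3"
  have z: "smooth_on B ?z" by (rule smooth_on_bounded_linear[OF B(1) bounded_linear_vec_nth])
  have "V p * partial_deriv 3 U p + ?z p * partial_deriv 1 V p =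
      U p * partial_deriv 3 V p + ?z p * partial_deriv 2 U p" if p: "p \<in> B" for p
  proof -
    let ?\<eta> = "prenormal_form U V"
    have d: "blinfun_apply (frechet_derivative ?\<eta> (at p) u) v = frechet_derivative (\<lambda>p. blinfun_apply (?\<eta> p) v) (at p) u" for u v
      using fun_cong[OF frechet_derivative_at[OF bounded_linear.has_derivative[OF blinfun.bounded_linear_left
            smooth_on_has_derivative[OF smooth_on_prenormal_form[OF B(1) U V] p]]], of u v] by simp
    have "partial_deriv n ?z p = axis n 1 $ 3" for n
      by (rule partial_deriv_eqI[OF bounded_linear_imp_has_derivative[OF bounded_linear_vec_nth]])
    then have "partial_deriv 1 ?z p = 0" "partial_deriv 2 ?z p = 0" by (simp_all add: axis_def)
    moreover have "wedge12 (?\<eta> p) (ext_deriv ?\<eta> p) (axis 1 1) (axis 2 1) (axis 3 1) = 0"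
      using int[OF p] by (simp add: integrable_form_at_def)
    ultimately show ?thesis
      unfolding wedge12_def ext_deriv_def d prenormal_form_axis partial_deriv_def by (simp add: algebra_simps)
  qed
  then have "taylor (\<lambda>p. V p * partial_deriv 3 U p + ?z p * partial_deriv 1 V p) =
      taylor (\<lambda>p. U p * partial_deriv 3 V p + ?z p * partial_deriv 2 U p)"
    by (rule taylor_cong[OF B])
  then have "taylor V * fpartial 3 (taylor U) + fps_X * fpartial 1 (taylor V) =
      taylor U * fpartial 3 (taylor V) + fps_X * fpartial 2 (taylor U)"
    by (simp add: taylor_add[OF B] taylor_mult[OF B] smooth_on_mult[OF B(1)] smooth_on_partial_deriv U V z
        taylor_partial_deriv[OF B] taylor_coordinate[OF B] fvar_3)
  moreover have "fpartial 1 fps_X = 0" "fpartial 2 fps_X = 0"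
    using fpartial_fvar[of 1 3] fpartial_fvar[of 2 3] by (simp_all add: fvar_3)
  ultimately show ?thesis
    by (simp add: taylor_form_prenormal_form integrability_def algebra_simps)
qed

section \<open>Reduction to \<open>z dz + U dx + V dy\<close>\<close>

lemma pullback_apply:
  assumes "\<phi> differentiable at p"
  shows "blinfun_apply (pullback \<phi> \<omega> p) v = blinfun_apply (\<omega> (\<phi> p)) (frechet_derivative \<phi> (at p) v)"
proof -
  have "bounded_linear (frechet_derivative \<phi> (at p))"
    using assms frechet_derivative_works has_derivative_bounded_linear by blast
  then show ?thesis by (simp add: pullback_def bounded_linear_Blinfun_apply)
qed

lemma blinfun_eqI_axis:
  fixes \<alpha> \<beta> :: "(real^3) \<Rightarrow>\<^sub>L real"
  assumes "\<And>i. blinfun_apply \<alpha> (axis i 1) = blinfun_apply \<beta> (axis i 1)"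
  shows "\<alpha> = \<beta>"
proof (rule blinfun_eqI)
  fix v
  show "blinfun_apply \<alpha> v = blinfun_apply \<beta> v"
    by (subst (1 2) vec3_expand[of v]) (simp add: blinfun.add_right blinfun.scaleR_right assms)
qed

lemma pfaffian_unit_multiple:
  fixes \<theta> \<eta> :: "real^'l \<Rightarrow> one_form"
  assumes M: "open M" "(0, 0) \<in> M" and k: "smooth_on M (\<lambda>(e, p). k e p)"
    and nz: "\<And>e p. (e, p) \<in> M \<Longrightarrow> k e p \<noteq> 0"
    and eq: "\<And>e p. (e, p) \<in> M \<Longrightarrow> \<eta> e p = k e p *\<^sub>R \<theta> e p"
  shows "pfaffian \<theta> = pfaffian \<eta>"
proof -
  have sub: "pfaffian \<eta> \<subseteq> pfaffian \<theta>"
    if k: "smooth_on M (\<lambda>(e, p). k e p)" and eq: "\<And>e p. (e, p) \<in> M \<Longrightarrow> \<eta> e p = k e p *\<^sub>R \<theta> e p"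
    for k :: "real^'l \<Rightarrow> real^3 \<Rightarrow> real" and \<theta> \<eta> :: "real^'l \<Rightarrow> one_form"
  proof
    fix \<sigma> assume "\<sigma> \<in> pfaffian \<eta>"
    then obtain h N where N: "open N" "(0, 0) \<in> N" and h: "smooth_on N (\<lambda>(e, p). h e p)"
      and ev: "\<forall>\<^sub>F (e, p) in nhds (0, 0). \<sigma> e p = h e p *\<^sub>R \<eta> e p"
      unfolding pfaffian_def smooth_family_def by auto
    have "smooth_on (N \<inter> M) (\<lambda>y. (case y of (e, p) \<Rightarrow> h e p) * (case y of (e, p) \<Rightarrow> k e p))"
      using N M by (intro smooth_on_mult smooth_on_subset[OF h] smooth_on_subset[OF k]) auto
    then have "smooth_family (\<lambda>e p. h e p * k e p)"
      unfolding smooth_family_def using N M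
      by (intro exI[of _ "N \<inter> M"]) (auto simp: case_prod_unfold)
    moreover have "\<forall>\<^sub>F y in nhds (0, 0). y \<in> M" using M by (auto simp: eventually_nhds)
    with ev have "\<forall>\<^sub>F (e, p) in nhds (0, 0). \<sigma> e p = (h e p * k e p) *\<^sub>R \<theta> e p"
      by eventually_elim (auto simp: eq)
    ultimately show "\<sigma> \<in> pfaffian \<theta>" unfolding pfaffian_def by blast
  qed
  have "smooth_on M (\<lambda>y. inverse (case y of (e, p) \<Rightarrow> k e p))"
    using nz by (intro smooth_on_inverse M k) auto
  then have inv: "smooth_on M (\<lambda>(e, p). inverse (k e p))" by (simp add: case_prod_unfold)
  show ?thesis
  proof
    show "pfaffian \<eta> \<subseteq> pfaffian \<theta>" by (rule sub[OF k eq])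
    show "pfaffian \<theta> \<subseteq> pfaffian \<eta>" by (rule sub[OF inv]) (simp add: eq nz)
  qed
qed

text \<open>
  In coordinates \<open>L\<close> whose third basis vector \<open>v\<close> is not isotropic for the linear part, the
  coefficient \<open>C\<close> of \<open>dz\<close> has nonzero derivative in \<open>z\<close> and vanishes at the origin for \<open>\<epsilon> = 0\<close>. With
  \<open>C\<close> as new third coordinate, \<open>dz\<close> becomes \<open>dC / C\<^sub>z\<close> up to terms in \<open>dx, dy\<close>, so \<open>C\<^sub>z\<close> times the
  form has third coefficient \<open>C\<close>, which is the new coordinate.
\<close>

lemma prenormalization:
  fixes \<omega> :: "real^'l \<Rightarrow> one_form"
  assumes int: "integrable_family \<omega>" and \<omega>0: "\<omega> 0 0 = 0"
    and rot: "\<not> (\<exists>a. linearly_equivalent (jet1 (\<omega> 0)) (rotation_form a))"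
  obtains U V :: "real^'l \<Rightarrow> real^3 \<Rightarrow> real" and M where "open M" "(0, 0) \<in> M"
    "smooth_on M (\<lambda>(e, p). U e p)" "smooth_on M (\<lambda>(e, p). V e p)"
    "pfaffian_equivalent \<omega> (\<lambda>e. prenormal_form (U e) (V e))"
    "\<And>e p. (e, p) \<in> M \<Longrightarrow> integrable_form_at (prenormal_form (U e) (V e)) p"
proof -
  let ?\<omega> = "\<lambda>(e, p). \<omega> e p"
  obtain N1 where N1: "open N1" "(0, 0) \<in> N1" and \<omega>1: "smooth_on N1 ?\<omega>"
    using int unfolding integrable_family_def smooth_family_def by auto
  obtain N2 where N2: "open N2" "(0, 0) \<in> N2" and int2: "\<And>e p. (e, p) \<in> N2 \<Longrightarrow> integrable_form_at (\<omega> e) p"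
    using int unfolding integrable_family_def eventually_nhds by fastforce
  define N0 where "N0 = N1 \<inter> N2"
  have N0: "open N0" "(0, 0) \<in> N0" and \<omega>: "smooth_on N0 ?\<omega>"
    using N1 N2 smooth_on_subset[OF \<omega>1] by (auto simp: N0_def)
  have d\<omega>: "(\<omega> e has_derivative (\<lambda>v. frechet_derivative ?\<omega> (at (e, p)) (0, v))) (at p)" if "(e, p) \<in> N0" for e p
    by (rule fiber_has_derivative[OF smooth_on_has_derivative[OF \<omega> that]])
  have diff0: "\<omega> 0 differentiable at 0"
    using d\<omega>[OF N0(2)] differentiableI by blast
  obtain v where v: "blinfun_apply (frechet_derivative (\<omega> 0) (at 0) v) v \<noteq> 0"
    by (rule linear_part_not_alternating[OF diff0 \<omega>0 rot])
  then have v0: "v \<noteq> 0"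
    using blinfun.zero_right by metis
  obtain L :: "real^3 \<Rightarrow> real^3" where L: "linear L" "bij L" "L (axis 3 1) = v"
    by (rule linear_bij_with_third_column[OF v0])
  have bL: "bounded_linear L" using L(1) linear_conv_bounded_linear by blast
  have bLi: "bounded_linear (inv L)"
    using inj_linear_imp_inv_linear[OF L(1) bij_is_inj[OF L(2)]] linear_conv_bounded_linear by blast
  have LLi: "L (inv L q) = q" "inv L (L q) = q" for q
    using L(2) by (simp_all add: bij_is_surj surj_f_inv_f bij_is_inj)
  have bl2: "bounded_linear (\<lambda>y::(real^'l) \<times> (real^3). (fst y, T (snd y)))" if "bounded_linear T"
    for T :: "real^3 \<Rightarrow> real^3"
    by (intro bounded_linear_Pair bounded_linear_fst bounded_linear_compose[OF that bounded_linear_snd])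
  \<comment> \<open>\<open>C\<close> is the coefficient of \<open>dz\<close> in the coordinates given by \<open>L\<close>.\<close>
  define C where "C y = blinfun_apply (\<omega> (fst y) (L (snd y))) v" for y
  define N where "N = (\<lambda>y. (fst y, L (snd y))) -` N0"
  have N: "open N"
    unfolding N_def using linear_continuous_on[OF bl2[OF bL], of UNIV] N0(1)
    by (simp add: continuous_on_open_vimage)
  have N_0: "0 \<in> N" using N0(2) linear_0[OF L(1)] by (simp add: N_def zero_prod_def)
  have sm\<omega>L: "smooth_on N (\<lambda>y. \<omega> (fst y) (L (snd y)))"
  proof -
    have "smooth_on N (\<lambda>y. ?\<omega> (fst y, L (snd y)))"
      by (rule smooth_on_compose[OF N N0(1) _ \<omega> smooth_on_bounded_linear[OF N bl2[OF bL]]])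
        (auto simp: N_def)
    then show ?thesis by simp
  qed
  have C: "smooth_on N C"
    unfolding C_def by (intro smooth_on_linear_compose[OF N blinfun.bounded_linear_left] sm\<omega>L)
  have C0: "C 0 = 0" by (simp add: C_def linear_0[OF L(1)] \<omega>0)
  define k where "k = (0::real^'l, axis 3 1 :: real^3)"
  have kk: "k \<bullet> k = 1" by (simp add: k_def inner_prod_def inner_axis_axis)
  have yk: "y \<bullet> k = snd y $ 3" for y by (simp add: k_def inner_prod_def inner_axis)
  have Dk: "frechet_derivative C (at 0) k \<noteq> 0"
  proof -
    have 1: "((\<lambda>p. C (0, p)) has_derivative (\<lambda>w. frechet_derivative C (at 0) (0, w))) (at 0)"
      using fiber_has_derivative[of "\<lambda>e p. C (e, p)" "frechet_derivative C (at 0)" 0 0]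
        smooth_on_has_derivative[OF C N_0] by (simp add: zero_prod_def case_prod_unfold)
    have "(\<omega> 0 has_derivative frechet_derivative (\<omega> 0) (at 0)) (at (L 0))"
      using diff0 by (simp add: frechet_derivative_works linear_0[OF L(1)])
    from bounded_linear.has_derivative[OF blinfun.bounded_linear_left
        has_derivative_compose[OF bounded_linear_imp_has_derivative[OF bL] this]]
    have 2: "((\<lambda>p. C (0, p)) has_derivative (\<lambda>w. blinfun_apply (frechet_derivative (\<omega> 0) (at 0) (L w)) v)) (at 0)"
      by (simp add: C_def)
    from fun_cong[OF has_derivative_unique[OF 1 2], of "axis 3 1"] show ?thesis
      using v by (simp add: L(3) k_def)
  qed
  obtain M g N' where M: "open M" "0 \<in> M" "smooth_on M g" "g 0 = 0" and N': "open N'" "0 \<in> N'" "N' \<subseteq> N"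
    and gN: "\<And>y. y \<in> M \<Longrightarrow> g y \<in> N" and Cg: "\<And>y. y \<in> M \<Longrightarrow> C (g y) = y \<bullet> k"
    and gy: "\<And>y. y \<in> M \<Longrightarrow> g y = y + (g y \<bullet> k - y \<bullet> k) *\<^sub>R k"
    and c0: "\<And>y. y \<in> M \<Longrightarrow> frechet_derivative C (at (g y)) k \<noteq> 0"
    and dg: "\<And>y. y \<in> M \<Longrightarrow> frechet_derivative g (at y) k = inverse (frechet_derivative C (at (g y)) k) *\<^sub>R k"
    and gf: "\<And>x. x \<in> N' \<Longrightarrow> x + (C x - x \<bullet> k) *\<^sub>R k \<in> M \<and> g (x + (C x - x \<bullet> k) *\<^sub>R k) = x"
  proof (rule straighten_function[OF N N_0 C C0 kk Dk], goal_cases)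
    case 1
    from 1(2-14) show thesis by (rule 1(1))
  qed
  have fst_g: "fst (g y) = fst y" if "y \<in> M" for y
    by (subst gy[OF that]) (simp add: k_def)
  define \<phi> where "\<phi> e p = L (snd (g (e, p)))" for e p
  have \<phi>: "smooth_on M (\<lambda>(e, p). \<phi> e p)"
    unfolding \<phi>_def case_prod_unfold prod.collapse
    by (rule smooth_on_linear_compose[OF M(1) bounded_linear_compose[OF bL bounded_linear_snd] M(3)])
  have d\<phi>: "(\<phi> e has_derivative (\<lambda>w. frechet_derivative (\<lambda>(e, p). \<phi> e p) (at (e, p)) (0, w))) (at p)" if "(e, p) \<in> M" for e p
    by (rule fiber_has_derivative[OF smooth_on_has_derivative[OF \<phi> that]])
  then have \<phi>': "frechet_derivative (\<phi> e) (at p) w = frechet_derivative (\<lambda>(e, p). \<phi> e p) (at (e, p)) (0, w)"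
    if "(e, p) \<in> M" for e p w
    using fun_cong[OF frechet_derivative_at[OF d\<phi>[OF that]], of w] by simp
  have \<phi>N0: "(e, \<phi> e p) \<in> N0" if "(e, p) \<in> M" for e p
    using gN[OF that] fst_g[OF that] by (simp add: N_def \<phi>_def)
  have diffeo: "local_diffeo_family \<phi>"
  proof -
    define \<psi> where "\<psi> e q = snd ((e, inv L q) + (C (e, inv L q) - (e, inv L q) \<bullet> k) *\<^sub>R k)" for e q
    define Q where "Q = (\<lambda>y. (fst y, inv L (snd y))) -` N'"
    have Q: "open Q"
      unfolding Q_def using linear_continuous_on[OF bl2[OF bLi], of UNIV] N'(1)
      by (simp add: continuous_on_open_vimage)
    have Q0: "(0, 0) \<in> Q"
      using N'(2) linear_0[OF bounded_linear.linear[OF bLi]] by (simp add: Q_def zero_prod_def)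
    have sm: "smooth_on Q (\<lambda>y. (fst y, inv L (snd y)))"
      by (rule smooth_on_bounded_linear[OF Q bl2[OF bLi]])
    have smf: "smooth_on N' (\<lambda>x. snd (x + (C x - x \<bullet> k) *\<^sub>R k))"
      by (rule smooth_on_linear_compose[OF N'(1) bounded_linear_snd smooth_on_add[OF N'(1)
            smooth_on_bounded_linear[OF N'(1) bounded_linear_ident]
            smooth_on_bilinear[OF bounded_bilinear_scaleR N'(1)
              smooth_on_diff[OF N'(1) smooth_on_subset[OF C N'(3)]
                smooth_on_bounded_linear[OF N'(1) bounded_linear_inner_left]]
              smooth_on_const[OF N'(1)]]]])
    have "smooth_on Q (\<lambda>y. snd ((fst y, inv L (snd y)) + (C (fst y, inv L (snd y)) - (fst y, inv L (snd y)) \<bullet> k) *\<^sub>R k))"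
      by (rule smooth_on_compose[OF Q N'(1) _ smf sm]) (auto simp: Q_def)
    then have \<psi>: "smooth_family \<psi>"
      unfolding smooth_family_def using Q Q0
      by (intro exI[of _ Q]) (simp add: \<psi>_def case_prod_unfold)
    have "\<psi> e (\<phi> e p) = p" if "(e, p) \<in> M" for e p
    proof -
      have "(e, inv L (\<phi> e p)) = g (e, p)"
        using fst_g[OF that] by (simp add: \<phi>_def LLi prod_eq_iff)
      then have "\<psi> e (\<phi> e p) = snd (g (e, p) + ((e, p) \<bullet> k - g (e, p) \<bullet> k) *\<^sub>R k)"
        by (simp add: \<psi>_def Cg[OF that])
      also have "g (e, p) + ((e, p) \<bullet> k - g (e, p) \<bullet> k) *\<^sub>R k = (e, p)"
        using gy[OF that] by (simp add: algebra_simps)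
      finally show ?thesis by simp
    qed
    moreover have "\<phi> e (\<psi> e q) = q" if "(e, q) \<in> Q" for e q
    proof -
      have "(e, inv L q) \<in> N'" using that by (simp add: Q_def)
      note gf' = gf[OF this]
      have "(e, \<psi> e q) = (e, inv L q) + (C (e, inv L q) - (e, inv L q) \<bullet> k) *\<^sub>R k"
        by (simp add: \<psi>_def prod_eq_iff k_def)
      then have "g (e, \<psi> e q) = (e, inv L q)" using gf' by simp
      then show ?thesis by (simp add: \<phi>_def LLi)
    qed
    moreover have "\<forall>\<^sub>F y in nhds (0, 0). y \<in> M \<inter> Q"
      using M(1,2) Q Q0 by (auto simp: eventually_nhds zero_prod_def)
    ultimately have "\<forall>\<^sub>F (e, p) in nhds (0, 0). \<psi> e (\<phi> e p) = p \<and> \<phi> e (\<psi> e p) = p"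
      by (auto elim!: eventually_mono)
    moreover have "smooth_family \<phi>"
      unfolding smooth_family_def using M \<phi> by (auto simp: zero_prod_def)
    moreover have "\<phi> 0 0 = 0"
      using M(4) linear_0[OF L(1)] by (simp add: \<phi>_def zero_prod_def)
    ultimately show ?thesis using \<psi> unfolding local_diffeo_family_def by blast
  qed
  define c where "c e p = frechet_derivative C (at (g (e, p))) k" for e p
  have c: "smooth_on M (\<lambda>(e, p). c e p)"
    unfolding c_def case_prod_unfold prod.collapse
    by (rule smooth_on_compose[OF M(1) N _ smooth_on_directional[OF C] M(3)]) (use gN in auto)
  have c_nz: "c e p \<noteq> 0" if "(e, p) \<in> M" for e p using c0[OF that] by (simp add: c_def)
  define A where "A i e p = c e p * blinfun_apply (pullback (\<phi> e) (\<omega> e) p) (axis i 1)" for i e p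
  have pull: "blinfun_apply (pullback (\<phi> e) (\<omega> e) p) w =
      blinfun_apply (\<omega> e (\<phi> e p)) (frechet_derivative (\<phi> e) (at p) w)" if "(e, p) \<in> M" for e p w
    using d\<phi>[OF that] by (intro pullback_apply) (auto simp: differentiable_def)
  have sm\<omega>\<phi>: "smooth_on M (\<lambda>y. \<omega> (fst y) (\<phi> (fst y) (snd y)))"
  proof -
    have "smooth_on M (\<lambda>y. ?\<omega> (fst y, \<phi> (fst y) (snd y)))"
      using \<phi> \<phi>N0 by (intro smooth_on_compose[OF M(1) N0(1) _ \<omega>] smooth_on_Pair[OF M(1)]
          smooth_on_bounded_linear[OF M(1) bounded_linear_fst]) (auto simp: case_prod_unfold)
    then show ?thesis by simp
  qed
  have A: "smooth_on M (\<lambda>(e, p). A i e p)" for i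
  proof -
    have "smooth_on M (\<lambda>y. c (fst y) (snd y) * blinfun_apply (\<omega> (fst y) (\<phi> (fst y) (snd y)))
        (frechet_derivative (\<lambda>(e, p). \<phi> e p) (at y) (0, axis i 1)))"
      using c by (intro smooth_on_mult[OF M(1)] smooth_on_bilinear[OF bounded_bilinear_blinfun_apply M(1)]
          sm\<omega>\<phi> smooth_on_directional[OF \<phi>]) (simp add: case_prod_unfold)
    then show ?thesis
      by (subst smooth_on_cong[OF M(1)]) (auto simp: A_def pull \<phi>')
  qed
  have A3: "A 3 e p = p $ 3" if "(e, p) \<in> M" for e p
  proof -
    have "((\<lambda>(e, p). \<phi> e p) has_derivative (\<lambda>h. L (snd (frechet_derivative g (at (e, p)) h)))) (at (e, p))"
      unfolding \<phi>_def case_prod_unfold prod.collapse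
      by (rule bounded_linear.has_derivative[OF bounded_linear_compose[OF bL bounded_linear_snd]
            smooth_on_has_derivative[OF M(3) that]])
    then have "frechet_derivative (\<phi> e) (at p) (axis 3 1) = L (snd (frechet_derivative g (at (e, p)) k))"
      using frechet_derivative_at \<phi>'[OF that] by (metis k_def)
    also have "\<dots> = inverse (c e p) *\<^sub>R v"
      by (simp add: dg[OF that] c_def) (simp add: k_def linear_scale[OF L(1)] L(3))
    finally have "A 3 e p = blinfun_apply (\<omega> e (\<phi> e p)) v"
      using c_nz[OF that] by (simp add: A_def pull[OF that] blinfun.scaleR_right)
    also have "\<dots> = C (g (e, p))"
      using fst_g[OF that] by (simp add: C_def \<phi>_def)
    finally show ?thesis by (simp add: Cg[OF that] yk)
  qed
  have form: "prenormal_form (A 1 e) (A 2 e) p = c e p *\<^sub>R pullback (\<phi> e) (\<omega> e) p" if "(e, p) \<in> M" for e p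
  proof (rule blinfun_eqI_axis)
    fix i
    show "blinfun_apply (prenormal_form (A 1 e) (A 2 e) p) (axis i 1) =
        blinfun_apply (c e p *\<^sub>R pullback (\<phi> e) (\<omega> e) p) (axis i 1)"
      using three_cases[of i] A3[OF that] by (auto simp: prenormal_form_axis A_def blinfun.scaleR_left)
  qed
  have M0: "(0, 0) \<in> M" using M(2) by (simp add: zero_prod_def)
  show thesis
  proof (rule that[of M "A 1" "A 2"])
    show "pfaffian_equivalent \<omega> (\<lambda>e. prenormal_form (A 1 e) (A 2 e))"
      unfolding pfaffian_equivalent_def
      using diffeo pfaffian_unit_multiple[OF M(1) M0 c c_nz form] by blast
  next
    fix e p assume ep: "(e, p) \<in> M"
    obtain T S where TS: "open T" "open S" "(e, p) \<in> T \<times> S" "T \<times> S \<subseteq> M"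
      using open_prod_elim[OF M(1) ep] by blast
    then have S: "open S" "p \<in> S" "{e} \<times> S \<subseteq> M" by auto
    note fiber = smooth_on_fiber[OF M(1) _ S(1) S(3)]
    have inM: "(e, q) \<in> M" if "q \<in> S" for q using S(3) that by auto
    show "integrable_form_at (prenormal_form (A 1 e) (A 2 e)) p"
    proof (rule integrable_form_transfer[OF S(1,2) _ _ fiber[OF c] fiber[OF \<phi>]])
      show "prenormal_form (A 1 e) (A 2 e) differentiable at p"
        using smooth_on_has_derivative[OF smooth_on_prenormal_form[OF S(1) fiber[OF A] fiber[OF A]] S(2)]
          differentiableI by blast
      show "blinfun_apply (prenormal_form (A 1 e) (A 2 e) q) w =
          c e q * blinfun_apply (\<omega> e (\<phi> e q)) (frechet_derivative (\<phi> e) (at q) w)" if "q \<in> S" for q w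
        by (simp add: form[OF inM[OF that]] blinfun.scaleR_left pull[OF inM[OF that]])
      show "\<omega> e differentiable at (\<phi> e p)"
        using d\<omega>[OF \<phi>N0[OF ep]] differentiableI by blast
      show "integrable_form_at (\<omega> e) (\<phi> e p)"
        using \<phi>N0[OF ep] int2 by (simp add: N0_def)
    qed
  qed (use M M0 A in auto)
qed

theorem theorem6p1:
  fixes \<omega> :: "real^'l \<Rightarrow> one_form"
  assumes "integrable_family \<omega>"
    and "\<omega> 0 0 = 0"
    and "\<not> (\<exists>a. linearly_equivalent (jet1 (\<omega> 0)) (rotation_form a))"
  shows "\<exists>U V :: real^'l \<Rightarrow> real^3 \<Rightarrow> real.
    smooth_family U \<and> smooth_family V \<and>
    pfaffian_equivalent \<omega> (\<lambda>e. prenormal_form (U e) (V e)) \<and>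
    (\<exists>W \<Phi> f g.
      open W \<and> 0 \<in> W \<and>
      (\<forall>n. smooth_coeffs3 W (\<lambda>e. \<Phi> e $ n)) \<and> (\<forall>e\<in>W. formal_change (\<Phi> e)) \<and>
      smooth_coeffs2 W f \<and> smooth_coeffs2 W g \<and>
      formal_pfaffian W (\<lambda>e. formal_pullback (\<Phi> e) (taylor_form (prenormal_form (U e) (V e))))
        = formal_pfaffian W (\<lambda>e. formal_normal_form (f e) (g e)) \<and>
      (\<forall>e\<in>W. formal_wedge (fd (fps_const (f e))) (fd (fps_const (g e))) = 0))"
proof -
  obtain U V :: "real^'l \<Rightarrow> real^3 \<Rightarrow> real" and M where M: "open M" "(0, 0) \<in> M"
    and U: "smooth_on M (\<lambda>(e, p). U e p)" and V: "smooth_on M (\<lambda>(e, p). V e p)"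
    and equivalent: "pfaffian_equivalent \<omega> (\<lambda>e. prenormal_form (U e) (V e))"
    and int: "\<And>e p. (e, p) \<in> M \<Longrightarrow> integrable_form_at (prenormal_form (U e) (V e)) p"
  proof (rule prenormalization[OF assms], goal_cases)
    case 1
    from 1(2-7) show thesis by (rule 1(1))
  qed
  obtain W B where "open W" "open B" "(0, 0) \<in> W \<times> B" and WB: "W \<times> B \<subseteq> M"
    using open_prod_elim[OF M] by blast
  then have W: "open W" "0 \<in> W" and B: "open B" "0 \<in> B" by auto
  let ?A = "\<lambda>e. taylor_form (prenormal_form (U e) (V e))"
  have "\<exists>\<Phi> f g. (\<forall>n. smooth_coeffs3 W (\<lambda>e. \<Phi> e $ n)) \<and> (\<forall>e\<in>W. formal_change (\<Phi> e)) \<and>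
      smooth_coeffs2 W f \<and> smooth_coeffs2 W g \<and>
      formal_pfaffian W (\<lambda>e. formal_pullback (\<Phi> e) (?A e))
        = formal_pfaffian W (\<lambda>e. formal_normal_form (f e) (g e)) \<and>
      (\<forall>e\<in>W. formal_wedge (fd (fps_const (f e))) (fd (fps_const (g e))) = 0)"
  proof (rule formal_normalization_family[OF W(1)])
    show "smooth_coeffs3 W (\<lambda>e. taylor (U e))" "smooth_coeffs3 W (\<lambda>e. taylor (V e))"
      by (intro smooth_coeffs3_taylor[OF W(1) B] smooth_on_subset[OF U WB] smooth_on_subset[OF V WB])+
  next
    fix e assume "e \<in> W"
    then have eB: "{e} \<times> B \<subseteq> M" using WB by auto
    show "?A e = vector [taylor (U e), taylor (V e), fps_X]"
      by (rule taylor_form_prenormal_form)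
    show "integrability (?A e) = 0"
      using eB by (intro integrability_taylor_form[OF B] smooth_on_fiber[OF M(1) U B(1)]
          smooth_on_fiber[OF M(1) V B(1)] int) auto
  qed
  moreover have "smooth_family U" "smooth_family V"
    using M U V unfolding smooth_family_def by auto
  ultimately show ?thesis using W equivalent by blast
qed

end
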